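(* Let $a,b\ge 1$ be integers, $r=a+b$, and $k\ge 2$. Then, as $n\to\infty$ with $a,b,k$ fixed: (1) if $r$ is odd, then ${\rm ex}_r(n,P_{2k-1}(a,b))=(k-1)\binom{n}{r-1}+o(n^{r-1})$; (2) if $a>b$, then ${\rm ex}_r(n,P_{2k}(a,b))=(k-1)\binom{n}{r-1}+o(n^{r-1})$. Moreover, if $a\neq b$ and $a,b\ge 2$, then for all sufficiently large $n$ the $r$-graph $\Psi_{k-1}(n,r)$ is the only extremal $n$-vertex $P_{2k-1}(a,b)$-free $r$-graph (up to isomorphism).
   Context: An $r$-graph is a family of $r$-element subsets of a finite vertex set. For an $r$-graph $F$, ${\rm ex}_r(n,F)$ is the maximum number of edges of an $r$-graph on $n$ vertices containing no copy of $F$; an $F$-free $n$-vertex $r$-graph with this many edges is called extremal. The $(a,b)$-path $P_{2k-1}(a,b)$ is the $r$-graph defined as follows: take pairwise disjoint sets $A_0,B_1,A_2,B_3,\dots,A_{2k-2},B_{2k-1}$ with $|A_i|=a$ and $|B_j|=b$, listed in this linear order; its $2k-1$ edges are the unions of each two consecutive sets in this list, i.e. $A_i\cup B_{i+1}$ ($i$ even, $0\le i\le 2k-2$) and $B_j\cup A_{j+1}$ ($j$ odd, $1\le j\le 2k-3$). The path $P_{2k}(a,b)$ is obtained by adding one further $a$-set $A_{2k}$ disjoint from all previous sets, together with the edge $B_{2k-1}\cup A_{2k}$. $\Psi_{c}(n,r)$ denotes the $r$-graph on vertex set $[n]=\{1,\dots,n\}$ consisting of all $r$-subsets of $[n]$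 that meet $[c]$. *)

theory Defs
  imports Complex_Main "HOL-Library.Landau_Symbols"
begin

datatype 'a hypergraph = Hypergraph (verts: "'a set") (edges: "'a set set")

definition is_rgraph :: "nat \<Rightarrow> 'a hypergraph \<Rightarrow> bool" where
  "is_rgraph r G \<longleftrightarrow> finite (verts G) \<and> (\<forall>e\<in>edges G. e \<subseteq> verts G \<and> card e = r)"

text \<open>Copies are not required to be induced.\<close>
definition contains_copy :: "'a hypergraph \<Rightarrow> 'b hypergraph \<Rightarrow> bool" where
  "contains_copy G F \<longleftrightarrow>
     (\<exists>f. inj_on f (verts F) \<and> f ` verts F \<subseteq> verts G \<and> (\<forall>e\<in>edges F. f ` e \<in> edges G))"

definition isomorphic :: "'a hypergraph \<Rightarrow> 'b hypergraph \<Rightarrow> bool" where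
  "isomorphic G H \<longleftrightarrow>
     (\<exists>f. bij_betw f (verts G) (verts H) \<and> (\<lambda>e. f ` e) ` edges G = edges H)"

definition free_rgraphs :: "nat \<Rightarrow> nat \<Rightarrow> 'b hypergraph \<Rightarrow> nat hypergraph set" where
  "free_rgraphs r n F =
     {H. is_rgraph r H \<and> card (verts H) = n \<and> \<not> contains_copy H F}"

text \<open>The maximum is over a finite set, which is nonempty as soon as \<open>F\<close> has an edge; see below.\<close>
definition ex :: "nat \<Rightarrow> nat \<Rightarrow> 'b hypergraph \<Rightarrow> nat" where
  "ex r n F = Max ((\<lambda>H. card (edges H)) ` free_rgraphs r n F)"

definition extremal :: "nat \<Rightarrow> nat \<Rightarrow> 'b hypergraph \<Rightarrow> nat hypergraph \<Rightarrow> bool" where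
  "extremal r n F H \<longleftrightarrow> H \<in> free_rgraphs r n F \<and> card (edges H) = ex r n F"

text \<open>The \<open>i\<close>-th set in the sequence \<open>A\<^sub>0, B\<^sub>1, A\<^sub>2, B\<^sub>3, \<dots>\<close>; the first component makes
  the sets pairwise disjoint.\<close>
definition block :: "nat \<Rightarrow> nat \<Rightarrow> nat \<Rightarrow> (nat \<times> nat) set" where
  "block a b i = {i} \<times> {..<(if even i then a else b)}"

text \<open>The path \<open>P\<^sub>m(a,b)\<close>: it has \<open>m + 1\<close> blocks and \<open>m\<close> edges.\<close>
definition ab_path :: "nat \<Rightarrow> nat \<Rightarrow> nat \<Rightarrow> (nat \<times> nat) hypergraph" where
  "ab_path m a b =
     Hypergraph (\<Union>i\<le>m. block a b i) ((\<lambda>i. block a b i \<union> block a b (Suc i)) ` {..<m})"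

definition Psi :: "nat \<Rightarrow> nat \<Rightarrow> nat \<Rightarrow> nat hypergraph" where
  "Psi c n r = Hypergraph {1..n} {e. e \<subseteq> {1..n} \<and> card e = r \<and> e \<inter> {1..c} \<noteq> {}}"

lemma is_rgraph_ab_path: "is_rgraph (a + b) (ab_path m a b)"
proof -
  have c: "finite (block a b i)" "card (block a b i) = (if even i then a else b)" for i
    by (auto simp: block_def)
  have "block a b i \<inter> block a b (Suc i) = {}" for i
    by (auto simp: block_def)
  then have "card (block a b i \<union> block a b (Suc i)) = a + b" for i
    by (subst card_Un_disjoint) (auto simp: c)
  moreover have "block a b i \<union> block a b (Suc i) \<subseteq> (\<Union>j\<le>m. block a b j)" if "i < m" for i
    using that by (intro Un_least UN_upper) auto
  ultimately show ?thesis
    by (simp add: is_rgraph_def ab_path_def c(1))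
qed

lemma finite_ex_set: "finite ((\<lambda>H. card (edges H)) ` free_rgraphs r n F)"
proof (rule finite_subset)
  show "(\<lambda>H. card (edges H)) ` free_rgraphs r n F \<subseteq> {..2 ^ n}"
  proof (clarsimp simp: free_rgraphs_def is_rgraph_def)
    fix H :: "nat hypergraph"
    assume "finite (verts H)" "\<forall>e\<in>edges H. e \<subseteq> verts H \<and> card e = r"
    then show "card (edges H) \<le> 2 ^ card (verts H)"
      using card_mono[of "Pow (verts H)" "edges H"] by (auto simp: card_Pow)
  qed
qed simp

lemma free_rgraphs_nonempty:
  assumes "edges F \<noteq> {}"
  shows "free_rgraphs r n F \<noteq> {}"
proof -
  have "Hypergraph {..<n} {} \<in> free_rgraphs r n F"
    using assms by (auto simp: free_rgraphs_def is_rgraph_def contains_copy_def)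
  then show ?thesis by blast
qed

end

(*
  In a hypergraph without the path, Fueredi's delta-system method singles out in almost every edge e
  a centre c(e): the set e - {c(e)} has bounded codegree, whereas every set containing c(e) can be
  extended to edges in many almost disjoint ways. If many (r-1)-sets f had k or more centres v with
  c(f + v) = v, one could split the vertices into potential centres and the rest, clean up, and build
  the path greedily, changing the centre in every second step. Hence almost every f has at most k-1
  centres, which is the upper bound. In a nearly extremal hypergraph almost every f has exactly k-1
  centres; neighbouring sets f have the same centres, since otherwise two different stars could be
  linked to a path, and so a single set W of k-1 centres serves almost all f. Finally, an edge
  outside W forces so many missing edges at W that a hypergraph with as many edges as the star of W
  has no such edge.
*)

theory Submission
  imports Defs "HOL-Library.FuncSet"
begin

section \<open>Kernels and peeling\<close>

text \<open>Passing to a homogeneous subfamily keeps only a constant share of the edges, while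
  stability and the exact result need almost all sets \<open>f\<close>. Homogeneity therefore serves
  for counting only: it shows that a path-free family, or the family of edges removed by cleaning,
  is small up to a constant factor. This requires reasons of removal that pass to subfamilies, hence
  \<open>peeled\<close>. There are two scales for \<open>s\<close>. A multiple of
  \<open>k * r\<close> suffices to find paths and fixes constants \<open>fur r s\<close>; a much
  larger \<open>s\<close> is needed to make edges without a centre rare, and the constants of the
  first scale must not depend on it. The condition \<open>b < a\<close> serves to distribute the
  colours over an \<open>a\<close>-block and a \<open>b\<close>-block, and to fit two disjoint
  \<open>b\<close>-sets into an own subset, which makes the bound on the edges outside the stars
  quadratic in their \<open>b\<close>-shadow. The condition \<open>b \<ge> 2\<close> makes two
  \<open>(r-1)\<close>-subsets of an \<open>r\<close>-set share an \<open>a\<close>-set.\<close>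

definition ksub :: "'a set \<Rightarrow> nat \<Rightarrow> 'a set set" where
  "ksub V r = {e. e \<subseteq> V \<and> card e = r}"

lemma finite_ksub [simp]: "finite V \<Longrightarrow> finite (ksub V r)"
  by (simp add: ksub_def)

lemma card_ksub: "finite V \<Longrightarrow> card (ksub V r) = card V choose r"
  by (simp add: ksub_def n_subsets)

lemma choose_le_power: "n choose r \<le> n ^ r"
  by (cases "r \<le> n") (auto simp: binomial_le_pow binomial_eq_0)

lemma card_ksub_le: "finite V \<Longrightarrow> card (ksub V r) \<le> card V ^ r"
  by (simp add: card_ksub choose_le_power)

text \<open>This plays the role of the usual notion of being the centre of a large sunflower.\<close>
definition kernel :: "nat \<Rightarrow> 'a set set \<Rightarrow> 'a set \<Rightarrow> bool" where
  "kernel s E T \<longleftrightarrow> (\<forall>U. finite U \<and> card U \<le> s \<longrightarrow> (\<exists>e\<in>E. T \<subseteq> e \<and> (e - T) \<inter> U = {}))"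

lemma kernel_mono: "kernel s E T \<Longrightarrow> E \<subseteq> E' \<Longrightarrow> kernel s E' T"
  unfolding kernel_def by (meson subsetD)

lemma kernelE:
  assumes "kernel s E T" "finite U" "card U \<le> s"
  obtains e where "e \<in> E" "T \<subseteq> e" "(e - T) \<inter> U = {}"
  using assms unfolding kernel_def by blast

lemma not_kernelE:
  assumes "\<not> kernel s E T"
  obtains U where "finite U" "card U \<le> s" "\<forall>e\<in>E. T \<subseteq> e \<longrightarrow> (e - T) \<inter> U \<noteq> {}"
  using assms unfolding kernel_def by meson

lemma kernel_self: "e \<in> E \<Longrightarrow> kernel s E e"
  unfolding kernel_def by (intro allI impI bexI[of _ e]) auto

section \<open>Pigeonhole, peeling and averaging over colourings\<close>

lemma card_fibres:
  assumes "finite D" "finite K" "f ` D \<subseteq> K"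
  shows "card D = (\<Sum>y\<in>K. card {e\<in>D. f e = y})"
  using sum.group[OF assms, of "\<lambda>_. 1::nat"] by simp

lemma pigeonhole_fibre:
  assumes "finite D" "finite K" "f ` D \<subseteq> K" "K \<noteq> {}"
  shows "\<exists>y\<in>K. card D \<le> card K * card {e\<in>D. f e = y}"
proof (rule ccontr)
  assume "\<not> ?thesis"
  then have "\<And>y. y \<in> K \<Longrightarrow> card K * card {e\<in>D. f e = y} < card D" by (meson not_le)
  then have "(\<Sum>y\<in>K. card K * card {e\<in>D. f e = y}) < (\<Sum>y\<in>K. card D)"
    using assms by (intro sum_strict_mono) auto
  then have "card K * (\<Sum>y\<in>K. card {e\<in>D. f e = y}) < card K * card D"
    by (simp add: sum_distrib_left)
  then show False
    unfolding card_fibres[OF assms(1-3), symmetric] by simp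
qed

text \<open>Bad elements of \<open>E\<close> are removed one at a time until \<open>G\<close> is left; \<open>l\<close> records the
  reason of each removal.\<close>
definition peeled ::
  "('i \<Rightarrow> 'e set \<Rightarrow> 'e \<Rightarrow> bool) \<Rightarrow> 'i set \<Rightarrow> 'e set \<Rightarrow> 'e set \<Rightarrow> ('e \<Rightarrow> 'i) \<Rightarrow> bool" where
  "peeled bad I E G l \<longleftrightarrow> G \<subseteq> E \<and> (\<forall>e\<in>G. \<forall>i\<in>I. \<not> bad i G e) \<and> (\<forall>e\<in>E - G. l e \<in> I) \<and>
     (\<forall>D\<subseteq>E - G. D \<noteq> {} \<longrightarrow> (\<exists>e\<in>D. bad (l e) D e))"

lemma peeledD:
  assumes "peeled bad I E G l"
  shows "G \<subseteq> E" "e \<in> G \<Longrightarrow> i \<in> I \<Longrightarrow> \<not> bad i G e" "e \<in> E \<Longrightarrow> e \<notin> G \<Longrightarrow> l e \<in> I"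
    "D \<subseteq> E - G \<Longrightarrow> D \<noteq> {} \<Longrightarrow> \<exists>e\<in>D. bad (l e) D e"
  using assms unfolding peeled_def by simp_all

text \<open>The element of \<open>D\<close> that is removed first was bad relative to everything
  present at that moment, a superset of \<open>D\<close>, and \<open>anti\<close> passes badness
  down to \<open>D\<close>. Since this holds for every subfamily \<open>D\<close> of the removed
  elements, these can be regrouped freely afterwards.\<close>

lemma peel:
  fixes bad :: "'i \<Rightarrow> 'e set \<Rightarrow> 'e \<Rightarrow> bool"
  assumes "finite E" and anti: "\<And>i D D' e. D \<subseteq> D' \<Longrightarrow> bad i D' e \<Longrightarrow> bad i D e"
  shows "\<exists>G l. peeled bad I E G l"
  using \<open>finite E\<close>
proof (induction E rule: finite_psubset_induct)
  case (psubset E)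
  show ?case
  proof (cases "\<forall>e\<in>E. \<forall>i\<in>I. \<not> bad i E e")
    case True
    then have "peeled bad I E E undefined" unfolding peeled_def by simp
    then show ?thesis by blast
  next
    case False
    then obtain e i where ei: "e \<in> E" "i \<in> I" "bad i E e" by blast
    have "E - {e} \<subset> E" using ei(1) by blast
    from psubset.IH[OF this] obtain G l where G: "peeled bad I (E - {e}) G l" by blast
    have "\<exists>x\<in>D. bad ((l(e:=i)) x) D x" if D: "D \<subseteq> E - G" "D \<noteq> {}" for D
    proof (cases "e \<in> D")
      case True
      have "D \<subseteq> E" using D by blast
      from anti[OF this ei(3)] show ?thesis using True by (intro bexI[of _ e]) simp_all
    next
      case False
      then have "D \<subseteq> E - {e} - G" using D by blast
      from peeledD(4)[OF G this D(2)] obtain x where "x \<in> D" "bad (l x) D x" by blast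
      moreover have "x \<noteq> e" using False \<open>x \<in> D\<close> by blast
      ultimately show ?thesis by (intro bexI[of _ x]) simp_all
    qed
    moreover have "\<forall>x\<in>E-G. (l(e:=i)) x \<in> I" using peeledD(3)[OF G] ei(2) by simp
    moreover have "G \<subseteq> E" using peeledD(1)[OF G] by blast
    ultimately have "peeled bad I E G (l(e:=i))"
      using peeledD(2)[OF G] unfolding peeled_def by simp
    then show ?thesis by blast
  qed
qed

lemma card_filter_sum: "finite A \<Longrightarrow> card {x\<in>A. P x} = (\<Sum>x\<in>A. if P x then 1 else 0)"
  by (simp flip: sum.inter_filter)

text \<open>A uniformly random colouring with \<open>Q\<close> colours agrees with
  \<open>g t\<close> on the at most \<open>p\<close> vertices of \<open>P t\<close> with probability
  at least \<open>1 / Q ^ p\<close>; the expected number of correct \<open>t\<close> gives the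
  bound. It serves to make hypergraphs \<open>r\<close>-partite and, with \<open>Q = 2\<close>, to
  separate centres from the other vertices.\<close>

lemma colouring_exists:
  fixes g :: "'t \<Rightarrow> 'a \<Rightarrow> nat"
  assumes V: "finite V" and T: "finite T" and Q: "Q > 0"
    and P: "\<And>t. t \<in> T \<Longrightarrow> P t \<subseteq> V \<and> card (P t) \<le> p"
    and g: "\<And>t v. t \<in> T \<Longrightarrow> v \<in> P t \<Longrightarrow> g t v < Q"
  shows "\<exists>\<chi>. card T \<le> Q ^ p * card {t\<in>T. \<forall>v\<in>P t. \<chi> v = g t v}"
proof (rule ccontr)
  assume "\<not> ?thesis"
  then have lt: "\<And>\<chi>. Q ^ p * card {t\<in>T. \<forall>v\<in>P t. \<chi> v = g t v} < card T" by (simp add: not_le)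
  define \<Omega> where "\<Omega> = (PiE V (\<lambda>_. {..<Q}))"
  have fin: "finite \<Omega>" unfolding \<Omega>_def using V by (intro finite_PiE) auto
  have card\<Omega>: "card \<Omega> = Q ^ card V" unfolding \<Omega>_def using V by (simp add: card_PiE)
  have ne: "\<Omega> \<noteq> {}" using card\<Omega> Q by auto
  have each: "Q ^ card V \<le> Q ^ p * card {\<chi>\<in>\<Omega>. \<forall>v\<in>P t. \<chi> v = g t v}" if t: "t \<in> T" for t
  proof -
    have "{\<chi>\<in>\<Omega>. \<forall>v\<in>P t. \<chi> v = g t v} = PiE V (\<lambda>v. if v \<in> P t then {g t v} else {..<Q})"
      using P[OF t] g[OF t] unfolding \<Omega>_def by (fastforce simp: PiE_iff split: if_splits)
    then have "card {\<chi>\<in>\<Omega>. \<forall>v\<in>P t. \<chi> v = g t v} = (\<Prod>v\<in>V. if v \<in> P t then 1 else Q)"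
      using V by (simp add: card_PiE if_distrib cong: if_cong)
    also have "\<dots> = Q ^ card (V - P t)"
      using V by (simp add: prod.If_cases flip: Diff_eq)
    also have "card (V - P t) = card V - card (P t)"
      using P[OF t] finite_subset[OF _ V] by (simp add: card_Diff_subset)
    finally have *: "card {\<chi>\<in>\<Omega>. \<forall>v\<in>P t. \<chi> v = g t v} = Q ^ (card V - card (P t))" .
    have "card V \<le> p + (card V - card (P t))" using P[OF t] by linarith
    then show ?thesis unfolding * power_add[symmetric] using Q by (intro power_increasing) auto
  qed
  \<comment> \<open>Pairs of a colouring and an element coloured correctly by it are counted in both
    orders.\<close>
  have "(\<Sum>\<chi>\<in>\<Omega>. Q ^ p * card {t\<in>T. \<forall>v\<in>P t. \<chi> v = g t v}) < (\<Sum>\<chi>\<in>\<Omega>. card T)"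
    using fin ne lt by (intro sum_strict_mono) auto
  also have "\<dots> = Q ^ card V * card T" by (simp add: card\<Omega>)
  also have "\<dots> = (\<Sum>t\<in>T. Q ^ card V)" by simp
  also have "\<dots> \<le> (\<Sum>t\<in>T. Q ^ p * card {\<chi>\<in>\<Omega>. \<forall>v\<in>P t. \<chi> v = g t v})"
    using each by (rule sum_mono)
  also have "\<dots> = Q ^ p * (\<Sum>t\<in>T. \<Sum>\<chi>\<in>\<Omega>. if \<forall>v\<in>P t. \<chi> v = g t v then 1 else 0)"
    unfolding card_filter_sum[OF fin] sum_distrib_left ..
  also have "\<dots> = Q ^ p * (\<Sum>\<chi>\<in>\<Omega>. \<Sum>t\<in>T. if \<forall>v\<in>P t. \<chi> v = g t v then 1 else 0)"
    by (subst sum.swap) (rule refl)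
  also have "\<dots> = (\<Sum>\<chi>\<in>\<Omega>. Q ^ p * card {t\<in>T. \<forall>v\<in>P t. \<chi> v = g t v})"
    unfolding card_filter_sum[OF T] sum_distrib_left ..
  finally show False by simp
qed

section \<open>Homogeneous families and Fueredi's theorem\<close>

definition part :: "('a \<Rightarrow> nat) \<Rightarrow> 'a set \<Rightarrow> nat set \<Rightarrow> 'a set" where
  "part \<chi> e S = {v\<in>e. \<chi> v \<in> S}"

text \<open>\<open>J\<close> is the common intersection structure of the edges; the colouring identifies the subsets of
  different edges with each other.\<close>
definition homog :: "('a \<Rightarrow> nat) \<Rightarrow> nat \<Rightarrow> nat \<Rightarrow> 'a set set \<Rightarrow> nat set set \<Rightarrow> bool" where
  "homog \<chi> r s H J \<longleftrightarrow> J \<subseteq> Pow {..<r} \<and> (\<forall>e\<in>H. bij_betw \<chi> e {..<r}) \<and>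
     (\<forall>e\<in>H. \<forall>S\<in>J. kernel s H (part \<chi> e S)) \<and> (\<forall>e\<in>H. \<forall>e'\<in>H. \<chi> ` (e \<inter> e') \<in> J)"

lemma part_subset: "part \<chi> e S \<subseteq> e"
  by (auto simp: part_def)

lemma part_eq_Int:
  assumes "bij_betw \<chi> e {..<r}" "\<chi> ` (e \<inter> e') = S"
  shows "part \<chi> e S = e \<inter> e'"
proof
  show "part \<chi> e S \<subseteq> e \<inter> e'"
  proof
    fix v assume "v \<in> part \<chi> e S"
    then have v: "v \<in> e" "\<chi> v \<in> \<chi> ` (e \<inter> e')" using assms by (auto simp: part_def)
    then obtain w where w: "w \<in> e \<inter> e'" "\<chi> w = \<chi> v" by force
    then have "w = v" using assms(1) v(1) by (auto simp: bij_betw_def dest: inj_onD)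
    then show "v \<in> e \<inter> e'" using w by simp
  qed
qed (use assms in \<open>auto simp: part_def\<close>)

text \<open>Induction on the number of patterns still allowed as intersections. Edges with a
  non-kernel part are peeled off; if few edges survive, one pattern \<open>S\<close> is responsible
  for a fixed share of the removals. Among these, the edges with the same \<open>S\<close>-part
  \<open>T\<close> are all hit outside \<open>T\<close> by at most \<open>s\<close> vertices, so a
  popular vertex can be fixed for each \<open>T\<close>. Edges sharing \<open>T\<close> then share
  one more vertex, and \<open>S\<close> no longer occurs as an intersection.\<close>

lemma furedi_aux:
  assumes "finite H" "\<And>e. e \<in> H \<Longrightarrow> bij_betw \<chi> e {..<r}" "J0 \<subseteq> Pow {..<r}"
    "\<And>e e'. e \<in> H \<Longrightarrow> e' \<in> H \<Longrightarrow> \<chi> ` (e \<inter> e') \<in> J0"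
  shows "\<exists>G J. G \<subseteq> H \<and> homog \<chi> r s G J \<and> card H \<le> ((2 ^ r + 1) * (s + 1)) ^ card J0 * card G"
  using assms
proof (induction "card J0" arbitrary: J0 H rule: less_induct)
  case less
  have finJ: "finite J0" using less.prems(3) by (rule finite_subset) simp
  have cardJ: "card J0 \<le> 2 ^ r" using card_mono[OF _ less.prems(3)] by (simp add: card_Pow)
  have anti: "\<not> kernel s D' (part \<chi> e S) \<Longrightarrow> \<not> kernel s D (part \<chi> e S)" if "D \<subseteq> D'" for D D' e S
    using that kernel_mono by blast
  have "\<exists>G l. peeled (\<lambda>S D e. \<not> kernel s D (part \<chi> e S)) J0 H G l"
    by (rule peel[OF less.prems(1)]) (rule anti)
  then obtain G l where pe: "peeled (\<lambda>S D e. \<not> kernel s D (part \<chi> e S)) J0 H G l"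
    by blast
  note GH = peeledD(1)[OF pe] and G0 = peeledD(2)[OF pe] and l = peeledD(3)[OF pe] and her = peeledD(4)[OF pe]
  note G = GH G0[unfolded not_not]
  have homG: "homog \<chi> r s G J0"
    unfolding homog_def
  proof (intro conjI ballI)
    fix e e' assume "e \<in> G" "e' \<in> G"
    then show "\<chi> ` (e \<inter> e') \<in> J0" using less.prems(4) GH by blast
  qed (use G less.prems in blast)+
  show ?case
  proof (cases "H = {}")
    case True
    then show ?thesis using homG G(1) by (intro exI[of _ G] exI[of _ J0]) auto
  next
    case False
    then have "J0 \<noteq> {}" using less.prems(4) by blast
    then have J1: "1 \<le> card J0" using finJ by (simp add: Suc_leI card_gt_0_iff)
    \<comment> \<open>\<open>None\<close> marks the surviving edges, so one pigeonhole over at most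
      \<open>2 ^ r + 1\<close> outcomes decides between success and a single guilty pattern.\<close>
    define l' where "l' e = (if e \<in> G then None else Some (l e))" for e
    define K where "K = insert None (Some ` J0)"
    have "card K \<le> 2 ^ r + 1" unfolding K_def using cardJ finJ
      by (simp add: card_insert_if card_image)
    moreover obtain y where y: "y \<in> K" "card H \<le> card K * card {e\<in>H. l' e = y}"
      using pigeonhole_fibre[of H K l'] less.prems(1) finJ l unfolding K_def l'_def by auto
    ultimately have y2: "card H \<le> (2 ^ r + 1) * card {e\<in>H. l' e = y}"
      by (meson le_trans mult_le_mono1)
    show ?thesis
    proof (cases y)
      case None
      then have "{e\<in>H. l' e = y} = G" using G(1) by (auto simp: l'_def split: if_splits)
      with y2 have "card H \<le> (2 ^ r + 1) * card G" by simp
      also have "\<dots> \<le> ((2 ^ r + 1) * (s + 1)) ^ 1 * card G" by simp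
      also have "\<dots> \<le> ((2 ^ r + 1) * (s + 1)) ^ card J0 * card G"
        using J1 by (intro mult_le_mono1 power_increasing) auto
      finally show ?thesis using homG G(1) by blast
    next
      case (Some S)
      define D where "D = {e\<in>H - G. l e = S}"
      have D: "{e\<in>H. l' e = y} = D" using Some by (auto simp: l'_def D_def split: if_splits)
      have DH: "D \<subseteq> H - G" by (auto simp: D_def)
      have finD: "finite D" using less.prems(1) by (simp add: D_def)
      have S: "S \<in> J0" using y(1) Some by (auto simp: K_def)
      \<comment> \<open>All removed edges with the same \<open>S\<close>-part \<open>T\<close> form
        a subfamily of the removed edges, so by the hereditary clause \<open>T\<close> is not a
        kernel even of this group.\<close>
      have "\<exists>u. card {e\<in>D. part \<chi> e S = T} \<le> (s + 1) * card {e\<in>D. part \<chi> e S = T \<and> u \<in> e - T}" for T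
      proof (cases "{e\<in>D. part \<chi> e S = T} = {}")
        case True
        show ?thesis unfolding True by simp
      next
        case ne: False
        let ?DT = "{e\<in>D. part \<chi> e S = T}"
        have "\<not> kernel s ?DT T"
          using her[of ?DT] ne DH by (auto simp: D_def)
        then obtain U where U: "finite U" "card U \<le> s" "\<forall>e\<in>?DT. T \<subseteq> e \<longrightarrow> (e - T) \<inter> U \<noteq> {}"
          by (rule not_kernelE)
        have hit: "(e - T) \<inter> U \<noteq> {}" if "e \<in> ?DT" for e
          using U(3)[rule_format, OF that] that part_subset[of \<chi> e S] by simp
        define h where "h e = (SOME u. u \<in> (e - T) \<inter> U)" for e
        have h: "h e \<in> (e - T) \<inter> U" if "e \<in> ?DT" for e
          using hit[OF that] unfolding h_def by (rule some_in_eq[THEN iffD2])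
        have "U \<noteq> {}" using ne hit by (metis Int_empty_right ex_in_conv)
        moreover have "h ` ?DT \<subseteq> U" using h by (meson IntD2 image_subsetI)
        moreover have "finite ?DT" using finD by simp
        ultimately obtain u where u: "card ?DT \<le> card U * card {e\<in>?DT. h e = u}"
          using pigeonhole_fibre[of ?DT U h] U(1) by meson
        note u
        also have "\<dots> \<le> (s + 1) * card {e\<in>D. part \<chi> e S = T \<and> u \<in> e - T}"
          using U(2) h finD by (intro mult_le_mono card_mono) auto
        finally show ?thesis by blast
      qed
      then have "\<forall>T. \<exists>u. card {e\<in>D. part \<chi> e S = T} \<le> (s + 1) * card {e\<in>D. part \<chi> e S = T \<and> u \<in> e - T}" ..
      from choice[OF this] obtain u where
        u: "\<forall>T. card {e\<in>D. part \<chi> e S = T} \<le> (s + 1) * card {e\<in>D. part \<chi> e S = T \<and> u T \<in> e - T}"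
        by (elim exE)
      define H' where "H' = {e\<in>D. u (part \<chi> e S) \<in> e - part \<chi> e S}"
      have H'H: "H' \<subseteq> H" using DH by (auto simp: H'_def)
      have eq: "{e\<in>D. part \<chi> e S = T \<and> u T \<in> e - T} = {e\<in>H'. part \<chi> e S = T}" for T
        by (auto simp: H'_def)
      let ?K = "(\<lambda>e. part \<chi> e S) ` D"
      have "card D = (\<Sum>T\<in>?K. card {e\<in>D. part \<chi> e S = T})"
        using finD by (intro card_fibres) auto
      also have "\<dots> \<le> (\<Sum>T\<in>?K. (s + 1) * card {e\<in>D. part \<chi> e S = T \<and> u T \<in> e - T})"
        by (rule sum_mono) (rule u[rule_format])
      also have "\<dots> = (s + 1) * (\<Sum>T\<in>?K. card {e\<in>H'. part \<chi> e S = T})"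
        unfolding sum_distrib_left eq ..
      also have "(\<Sum>T\<in>?K. card {e\<in>H'. part \<chi> e S = T}) = card H'"
        using finD by (intro card_fibres[symmetric]) (auto simp: H'_def)
      finally have cD: "card D \<le> (s + 1) * card H'" .
      \<comment> \<open>An intersection with pattern \<open>S\<close> would be the common part
        \<open>T\<close> of both edges, yet both contain \<open>u T\<close> outside
        \<open>T\<close>.\<close>
      have noS: "\<chi> ` (e \<inter> e') \<noteq> S" if "e \<in> H'" "e' \<in> H'" for e e'
      proof
        assume "\<chi> ` (e \<inter> e') = S"
        then have "part \<chi> e S = e \<inter> e'" "part \<chi> e' S = e \<inter> e'"
          using part_eq_Int[of \<chi> e r e'] part_eq_Int[of \<chi> e' r e] that H'H less.prems(2)
          by (simp_all add: Int_commute subset_iff)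
        then show False using that by (auto simp: H'_def)
      qed
      have less': "card (J0 - {S}) < card J0" using S finJ by (intro card_Diff1_less)
      obtain G' J where G': "G' \<subseteq> H'" "homog \<chi> r s G' J"
        "card H' \<le> ((2 ^ r + 1) * (s + 1)) ^ card (J0 - {S}) * card G'"
      proof -
        have "\<exists>G J. G \<subseteq> H' \<and> homog \<chi> r s G J \<and>
            card H' \<le> ((2 ^ r + 1) * (s + 1)) ^ card (J0 - {S}) * card G"
        proof (rule less.hyps[OF less'])
          show "finite H'" using H'H less.prems(1) by (rule finite_subset)
          show "bij_betw \<chi> e {..<r}" if "e \<in> H'" for e using that H'H less.prems(2) by blast
          show "J0 - {S} \<subseteq> Pow {..<r}" using less.prems(3) by blast
          show "\<chi> ` (e \<inter> e') \<in> J0 - {S}" if "e \<in> H'" "e' \<in> H'" for e e'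
            using that H'H less.prems(4) noS by blast
        qed
        then show thesis using that by blast
      qed
      have "card H \<le> (2 ^ r + 1) * card D" using y2 D by simp
      also have "\<dots> \<le> (2 ^ r + 1) * ((s + 1) * card H')" using cD by (rule mult_le_mono2)
      also have "\<dots> \<le> (2 ^ r + 1) * ((s + 1) * (((2 ^ r + 1) * (s + 1)) ^ card (J0 - {S}) * card G'))"
        using G'(3) by (intro mult_le_mono2)
      also have "\<dots> = ((2 ^ r + 1) * (s + 1)) ^ Suc (card (J0 - {S})) * card G'"
        by (simp only: power_Suc mult_ac)
      also have "Suc (card (J0 - {S})) = card J0" using card_Suc_Diff1[OF finJ S] .
      finally show ?thesis using G' H'H by blast
    qed
  qed
qed

section \<open>Homogeneous families and paths\<close>

lemma double_count:
  assumes "finite A" "finite B" "\<And>x. x \<in> A \<Longrightarrow> c \<le> card {y\<in>B. R x y}"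
    "\<And>y. y \<in> B \<Longrightarrow> card {x\<in>A. R x y} \<le> d"
  shows "card A * c \<le> d * card B"
proof -
  have "card A * c = (\<Sum>x\<in>A. c)" by simp
  also have "\<dots> \<le> (\<Sum>x\<in>A. card {y\<in>B. R x y})" using assms(3) by (rule sum_mono)
  also have "\<dots> = (\<Sum>y\<in>B. card {x\<in>A. R x y})"
    unfolding card_filter_sum[OF assms(1)] card_filter_sum[OF assms(2)] by (rule sum.swap)
  also have "\<dots> \<le> (\<Sum>y\<in>B. d)" using assms(4) by (rule sum_mono)
  finally show ?thesis by (simp add: mult.commute)
qed

lemma ksubD: "e \<in> ksub V r \<Longrightarrow> e \<subseteq> V" "e \<in> ksub V r \<Longrightarrow> card e = r"
  by (simp_all add: ksub_def)

lemma furedi: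
  assumes "finite H" "\<And>e. e \<in> H \<Longrightarrow> bij_betw \<chi> e {..<r}"
  shows "\<exists>G J. G \<subseteq> H \<and> homog \<chi> r s G J \<and> card H \<le> ((2 ^ r + 1) * (s + 1)) ^ (2 ^ r) * card G"
proof -
  have "\<chi> ` (e \<inter> e') \<in> Pow {..<r}" if "e \<in> H" "e' \<in> H" for e e'
    using assms(2)[OF that(1)] unfolding bij_betw_def by blast
  then show ?thesis
    using furedi_aux[OF assms, of "Pow {..<r}" s] by (simp add: card_Pow)
qed

text \<open>The factor \<open>r ^ r\<close> comes from the random colouring and \<open>r * 2 ^ r\<close> from fixing the positions
  of \<open>x e\<close> and \<open>S e\<close> in \<open>e\<close> below.\<close>
definition fur :: "nat \<Rightarrow> nat \<Rightarrow> nat" where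
  "fur r s = r ^ r * ((r * 2 ^ r) * ((2 ^ r + 1) * (s + 1)) ^ (2 ^ r))"

text \<open>The marked vertex \<open>x e\<close> and the marked set \<open>S e\<close> vary with the
  edge. A pigeonhole over their colours turns them into one position \<open>x0\<close> and one
  pattern \<open>S0\<close>, so that statements about marked parts of edges become statements about
  \<open>J\<close>.\<close>

lemma homog_subfamily:
  assumes V: "finite V" and H: "H \<subseteq> ksub V r" and r: "r \<ge> 1"
    and xS: "\<And>e. e \<in> H \<Longrightarrow> x e \<in> e" "\<And>e. e \<in> H \<Longrightarrow> S e \<subseteq> e"
  shows "\<exists>\<chi> G J x0 S0. G \<subseteq> H \<and> homog \<chi> r s G J \<and> x0 < r \<and> S0 \<subseteq> {..<r} \<and>
     (\<forall>e\<in>G. \<chi> (x e) = x0 \<and> part \<chi> e S0 = S e) \<and> card H \<le> fur r s * card G"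
proof -
  have finH: "finite H" using H V finite_ksub finite_subset by blast
  have fine: "finite e" "card e = r" if "e \<in> H" for e
    using that H V ksubD by (metis finite_subset subsetD)+
  have "\<exists>h. bij_betw h e {..<r}" if "e \<in> H" for e
    using ex_bij_betw_finite_nat[OF fine(1)[OF that]] fine(2)[OF that] by (simp add: atLeast0LessThan)
  then obtain g where g: "\<And>e. e \<in> H \<Longrightarrow> bij_betw (g e) e {..<r}" by metis
  have "\<exists>\<chi>. card H \<le> r ^ r * card {e\<in>H. \<forall>v\<in>e. \<chi> v = g e v}"
  proof (rule colouring_exists[OF V finH])
    show "e \<subseteq> V \<and> card e \<le> r" if "e \<in> H" for e using that H ksubD by fastforce
    show "g e v < r" if "e \<in> H" "v \<in> e" for e v using bij_betwE[OF g[OF that(1)]] that(2) by simp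
  qed (use r in simp)
  then obtain \<chi> where chi: "card H \<le> r ^ r * card {e\<in>H. \<forall>v\<in>e. \<chi> v = g e v}" by blast
  define H1 where "H1 = {e\<in>H. \<forall>v\<in>e. \<chi> v = g e v}"
  have bij1: "bij_betw \<chi> e {..<r}" if "e \<in> H1" for e
    using that g[of e] bij_betw_cong[of e \<chi> "g e" "{..<r}"] by (simp add: H1_def)
  define p where "p e = (\<chi> (x e), \<chi> ` S e)" for e
  have pim: "p ` H1 \<subseteq> {..<r} \<times> Pow {..<r}"
  proof (clarify, intro conjI SigmaI)
    fix a b e assume "(a, b) = p e" "e \<in> H1"
    moreover have "x e \<in> e" "S e \<subseteq> e" "e \<in> H" using xS \<open>e \<in> H1\<close> by (auto simp: H1_def)
    ultimately show "a \<in> {..<r}" "b \<in> Pow {..<r}"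
      using bij1[OF \<open>e \<in> H1\<close>] unfolding p_def bij_betw_def by auto
  qed
  have "({..<r} \<times> Pow {..<r}) \<noteq> {}" using r by (auto simp: lessThan_empty_iff)
  then obtain y where y: "y \<in> {..<r} \<times> Pow {..<r}" "card H1 \<le> card ({..<r} \<times> Pow {..<r}) * card {e\<in>H1. p e = y}"
    using pigeonhole_fibre[OF _ _ pim] finH by (auto simp: H1_def)
  obtain x0 S0 where xS0: "y = (x0, S0)" by (cases y)
  define H2 where "H2 = {e\<in>H1. p e = y}"
  have finH2: "finite H2" using finH by (simp add: H2_def H1_def)
  obtain G J where G: "G \<subseteq> H2" "homog \<chi> r s G J" "card H2 \<le> ((2 ^ r + 1) * (s + 1)) ^ (2 ^ r) * card G"
    using furedi[OF finH2, of \<chi> r s] bij1 by (auto simp: H2_def)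
  have pS: "part \<chi> e S0 = S e" if "e \<in> G" for e
  proof
    have e: "e \<in> H1" "e \<in> H" "S0 = \<chi> ` S e" "S e \<subseteq> e"
      using that G(1) xS(2) xS0 unfolding H2_def p_def H1_def by blast+
    show "S e \<subseteq> part \<chi> e S0" using e(3,4) by (auto simp: part_def)
    show "part \<chi> e S0 \<subseteq> S e"
    proof
      fix v assume "v \<in> part \<chi> e S0"
      then obtain w where w: "v \<in> e" "w \<in> S e" "\<chi> v = \<chi> w" using e by (auto simp: part_def)
      then show "v \<in> S e" using bij1[OF e(1)] e(4) by (metis bij_betw_inv_into_left subsetD)
    qed
  qed
  have "card H \<le> r ^ r * card H1" using chi by (simp add: H1_def)
  also have "\<dots> \<le> r ^ r * ((r * 2 ^ r) * card H2)"
    using y(2) by (intro mult_le_mono2) (simp add: H2_def card_cartesian_product card_Pow)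
  also have "\<dots> \<le> r ^ r * ((r * 2 ^ r) * (((2 ^ r + 1) * (s + 1)) ^ (2 ^ r) * card G))"
    using G(3) by (intro mult_le_mono2)
  also have "\<dots> = fur r s * card G" by (simp only: fur_def mult.assoc)
  finally have "card H \<le> fur r s * card G" .
  moreover have "G \<subseteq> H" using G(1) by (auto simp: H2_def H1_def)
  moreover have "\<forall>e\<in>G. \<chi> (x e) = x0 \<and> part \<chi> e S0 = S e"
    using pS G(1) xS0 by (auto simp: H2_def p_def)
  ultimately show ?thesis using G(2) y(1) xS0 by (intro exI[of _ \<chi>] exI[of _ G] exI[of _ J] exI[of _ x0] exI[of _ S0]) auto
qed

lemma homogD:
  assumes "homog \<chi> r s H J"
  shows "J \<subseteq> Pow {..<r}" "e \<in> H \<Longrightarrow> bij_betw \<chi> e {..<r}" "e \<in> H \<Longrightarrow> S \<in> J \<Longrightarrow> kernel s H (part \<chi> e S)"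
    "e \<in> H \<Longrightarrow> e' \<in> H \<Longrightarrow> \<chi> ` (e \<inter> e') \<in> J"
  using assms unfolding homog_def by simp_all

lemma finite_bij: "bij_betw \<chi> e {..<r::nat} \<Longrightarrow> finite e"
  using bij_betw_finite by blast

lemma image_part: "bij_betw \<chi> e {..<r::nat} \<Longrightarrow> S \<subseteq> {..<r} \<Longrightarrow> \<chi> ` part \<chi> e S = S"
proof -
  assume b: "bij_betw \<chi> e {..<r}" and S: "S \<subseteq> {..<r}"
  have "y \<in> \<chi> ` part \<chi> e S" if "y \<in> S" for y
  proof -
    have "y \<in> \<chi> ` e" using that S bij_betw_imp_surj_on[OF b] by blast
    then obtain v where "v \<in> e" "y = \<chi> v" by blast
    then show ?thesis using that by (auto simp: part_def)
  qed
  then show ?thesis by (auto simp: part_def)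
qed

lemma card_part: "bij_betw \<chi> e {..<r::nat} \<Longrightarrow> S \<subseteq> {..<r} \<Longrightarrow> card (part \<chi> e S) = card S"
  by (metis bij_betw_def card_image image_part inj_on_subset part_subset)

text \<open>Containment suffices because both parts have \<open>card S\<close> elements. Hence an
  edge found through a kernel has that kernel at the same positions.\<close>

lemma part_eqI:
  assumes "bij_betw \<chi> e {..<r::nat}" "bij_betw \<chi> e' {..<r}" "S \<subseteq> {..<r}" "part \<chi> e S \<subseteq> e'"
  shows "part \<chi> e' S = part \<chi> e S"
proof -
  have "part \<chi> e S \<subseteq> part \<chi> e' S" using assms(4) by (auto simp: part_def)
  moreover have "finite (part \<chi> e' S)" using finite_bij[OF assms(2)] part_subset finite_subset by metis
  ultimately show ?thesis using card_part[OF assms(1,3)] card_part[OF assms(2,3)] by (metis card_subset_eq)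
qed

lemma homog_top: "homog \<chi> r s H J \<Longrightarrow> H \<noteq> {} \<Longrightarrow> {..<r} \<in> J"
proof -
  assume h: "homog \<chi> r s H J" "H \<noteq> {}"
  then obtain e where "e \<in> H" by blast
  then show ?thesis using homogD(2)[OF h(1), of e] homogD(4)[OF h(1), of e e] by (simp add: bij_betw_def)
qed

lemma homog_eq:
  assumes h: "homog \<chi> r s H J" and e: "e \<in> H" "e' \<in> H" and "\<chi> ` (e \<inter> e') = {..<r}"
  shows "e = e'"
proof -
  have "part \<chi> e {..<r} = e" if "e \<in> H" for e
    using homogD(2)[OF h that] unfolding part_def bij_betw_def by auto
  moreover have "part \<chi> e {..<r} = e \<inter> e'" "part \<chi> e' {..<r} = e' \<inter> e"
    using part_eq_Int[OF homogD(2)[OF h e(1)] assms(4)] part_eq_Int[OF homogD(2)[OF h e(2)], of e "{..<r}"] assms(4)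
    by (simp_all add: Int_commute)
  ultimately show ?thesis using e by (metis Int_commute)
qed

text \<open>Two parts of one edge \<open>e\<close> are extended to edges \<open>e1\<close> and
  \<open>e2\<close> whose new vertices avoid \<open>e\<close>, respectively \<open>e\<close> and
  \<open>e1\<close>; then \<open>e1\<close> and \<open>e2\<close> meet exactly in the part of
  \<open>S1 \<inter> S2\<close>. The set to be avoided has at most \<open>2 * r\<close>
  vertices.\<close>

lemma homog_Int:
  assumes h: "homog \<chi> r s H J" and ne: "H \<noteq> {}" and s: "2 * r \<le> s" and S: "S1 \<in> J" "S2 \<in> J"
  shows "S1 \<inter> S2 \<in> J"
proof -
  obtain e where e: "e \<in> H" using ne by blast
  have ce: "finite e" "card e = r" if "e \<in> H" for e
    using homogD(2)[OF h that] finite_bij bij_betw_same_card by fastforce+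
  obtain e1 where e1: "e1 \<in> H" "part \<chi> e S1 \<subseteq> e1" "(e1 - part \<chi> e S1) \<inter> e = {}"
    by (rule kernelE[OF homogD(3)[OF h e S(1)], of e]) (use ce[OF e] s in auto)
  have fu: "finite (e \<union> e1)" using ce e e1(1) by simp
  have cu: "card (e \<union> e1) \<le> s" using card_Un_le[of e e1] ce[OF e] ce[OF e1(1)] s by linarith
  obtain e2 where e2: "e2 \<in> H" "part \<chi> e S2 \<subseteq> e2" "(e2 - part \<chi> e S2) \<inter> (e \<union> e1) = {}"
    by (rule kernelE[OF homogD(3)[OF h e S(2)] fu cu])
  have sub: "part \<chi> e S1 \<subseteq> e" "part \<chi> e S2 \<subseteq> e" by (rule part_subset)+
  have "e1 \<inter> e2 = part \<chi> e S1 \<inter> part \<chi> e S2"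
    using e1(2,3) e2(2,3) sub by (auto simp: set_eq_iff subset_iff)
  also have "\<dots> = part \<chi> e (S1 \<inter> S2)" by (auto simp: part_def)
  finally have "\<chi> ` (e1 \<inter> e2) = S1 \<inter> S2"
    using image_part[OF homogD(2)[OF h e]] homogD(1)[OF h] S by (metis PowD Int_lower1 subset_trans subsetD)
  then show ?thesis using homogD(4)[OF h e1(1) e2(1)] by simp
qed

section \<open>Paths as sequences of blocks\<close>

definition path_in :: "'a set set \<Rightarrow> nat \<Rightarrow> nat \<Rightarrow> nat \<Rightarrow> (nat \<Rightarrow> 'a set) \<Rightarrow> bool" where
  "path_in E m a b Bl \<longleftrightarrow> (\<forall>i\<le>m. finite (Bl i) \<and> card (Bl i) = (if even i then a else b)) \<and>
     (\<forall>i\<le>m. \<forall>j\<le>m. i \<noteq> j \<longrightarrow> Bl i \<inter> Bl j = {}) \<and> (\<forall>i<m. Bl i \<union> Bl (Suc i) \<in> E)"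

definition has_path :: "'a set set \<Rightarrow> nat \<Rightarrow> nat \<Rightarrow> nat \<Rightarrow> bool" where
  "has_path E m a b \<longleftrightarrow> (\<exists>Bl. path_in E m a b Bl)"

lemma path_in_mono: "path_in E m a b Bl \<Longrightarrow> E \<subseteq> E' \<Longrightarrow> path_in E' m a b Bl"
  unfolding path_in_def by (simp add: subset_iff)

lemma has_path_mono: "has_path E m a b \<Longrightarrow> E \<subseteq> E' \<Longrightarrow> has_path E' m a b"
  unfolding has_path_def using path_in_mono by blast

lemma path_in_prefix: "path_in E m a b Bl \<Longrightarrow> m' \<le> m \<Longrightarrow> path_in E m' a b Bl"
  unfolding path_in_def by simp

lemma has_path_prefix: "has_path E m a b \<Longrightarrow> m' \<le> m \<Longrightarrow> has_path E m' a b"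
  unfolding has_path_def using path_in_prefix by blast

lemma path_in_Suc:
  assumes p: "path_in E m a b Bl" and B: "finite B" "card B = (if even (Suc m) then a else b)"
    and d: "B \<inter> (\<Union>i\<le>m. Bl i) = {}" and e: "Bl m \<union> B \<in> E"
  shows "path_in E (Suc m) a b (Bl(Suc m := B))"
proof -
  have d': "B \<inter> Bl i = {}" "Bl i \<inter> B = {}" if "i \<le> m" for i using d that by auto
  show ?thesis
    using p B d' e unfolding path_in_def by (auto simp: le_Suc_eq less_Suc_eq)
qed

text \<open>A new block in front shifts all parities, which is why \<open>a\<close> and
  \<open>b\<close> change places in the conclusion.\<close>

lemma path_in_Cons:
  assumes p: "path_in E m a b Bl" and B: "finite B" "card B = b"
    and d: "B \<inter> (\<Union>i\<le>m. Bl i) = {}" and e: "B \<union> Bl 0 \<in> E"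
  shows "path_in E (Suc m) b a (case_nat B Bl)"
proof -
  have d': "B \<inter> Bl i = {}" "Bl i \<inter> B = {}" if "i \<le> m" for i using d that by auto
  show ?thesis
    unfolding path_in_def
  proof (intro conjI allI impI)
    fix i assume "i \<le> Suc m"
    then show "finite (case_nat B Bl i)" "card (case_nat B Bl i) = (if even i then b else a)"
      using p B by (auto simp: path_in_def split: nat.split)
  next
    fix i j assume "i \<le> Suc m" "j \<le> Suc m" "i \<noteq> j"
    then show "case_nat B Bl i \<inter> case_nat B Bl j = {}"
      using p d' by (auto simp: path_in_def split: nat.split)
  next
    fix i assume "i < Suc m"
    then show "case_nat B Bl i \<union> case_nat B Bl (Suc i) \<in> E"
      using p e by (auto simp: path_in_def split: nat.split)
  qed
qed

lemma path_in_rev: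
  assumes p: "path_in E m a b Bl" and m: "odd m"
  shows "path_in E m b a (\<lambda>i. Bl (m - i))"
  unfolding path_in_def
proof (intro conjI allI impI)
  fix i assume "i \<le> m"
  then show "finite (Bl (m - i))" "card (Bl (m - i)) = (if even i then b else a)"
    using p m by (auto simp: path_in_def)
next
  fix i j assume "i \<le> m" "j \<le> m" "i \<noteq> j"
  then have "m - i \<le> m" "m - j \<le> m" "m - i \<noteq> m - j" by auto
  then show "Bl (m - i) \<inter> Bl (m - j) = {}" using p unfolding path_in_def by blast
next
  fix i assume "i < m"
  then have "m - i = Suc (m - Suc i)" "m - Suc i < m" by auto
  then show "Bl (m - i) \<union> Bl (m - Suc i) \<in> E" using p unfolding path_in_def by (metis Un_commute)
qed

lemma has_path_rev: "odd m \<Longrightarrow> has_path E m a b \<longleftrightarrow> has_path E m b a"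
  unfolding has_path_def using path_in_rev by blast

lemma path_in_Union:
  assumes "path_in E m a b Bl"
  shows "finite (\<Union>i\<le>m. Bl i)" "card (\<Union>i\<le>m. Bl i) \<le> (m + 1) * (a + b)"
proof -
  show "finite (\<Union>i\<le>m. Bl i)" using assms by (auto simp: path_in_def)
  have "card (\<Union>i\<le>m. Bl i) \<le> (\<Sum>i\<le>m. card (Bl i))" by (rule card_UN_le) simp
  also have "\<dots> \<le> (\<Sum>i\<le>m. a + b)" using assms by (intro sum_mono) (auto simp: path_in_def)
  finally show "card (\<Union>i\<le>m. Bl i) \<le> (m + 1) * (a + b)" by simp
qed

text \<open>The last block is alternately an \<open>A\<close>-part and a \<open>B\<close>-part,
  hence always a kernel, and can be completed to an edge by fresh vertices; by
  \<open>part_eqI\<close> these form the complementary part. The bound on \<open>s\<close> leaves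
  room for all vertices of the path.\<close>

lemma homog_path:
  assumes h: "homog \<chi> r s H J" and ne: "H \<noteq> {}" and AB: "A \<in> J" "B \<in> J" "A \<inter> B = {}" "A \<union> B = {..<r}"
    and c: "card A = a" "card B = b" and s: "(m + 1) * (a + b) \<le> s"
  shows "has_path H m a b"
proof -
  have sub: "A \<subseteq> {..<r}" "B \<subseteq> {..<r}" using AB by auto
  have fin: "finite e" "part \<chi> e A \<union> part \<chi> e B = e" "part \<chi> e A \<inter> part \<chi> e B = {}"
    "finite (part \<chi> e A)" "finite (part \<chi> e B)" "card (part \<chi> e A) = a" "card (part \<chi> e B) = b" if "e \<in> H" for e
  proof -
    note b = homogD(2)[OF h that]
    show "finite e" using finite_bij[OF b] .
    then show "finite (part \<chi> e A)" "finite (part \<chi> e B)" by (simp_all add: part_def)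
    show "card (part \<chi> e A) = a" "card (part \<chi> e B) = b" using card_part[OF b] sub c by simp_all
    have "\<chi> v \<in> A \<union> B" if "v \<in> e" for v using bij_betwE[OF b] that AB(4) by simp
    then show "part \<chi> e A \<union> part \<chi> e B = e" by (auto simp: part_def)
    show "part \<chi> e A \<inter> part \<chi> e B = {}" using AB(3) by (auto simp: part_def)
  qed
  have "m' \<le> m \<Longrightarrow> \<exists>Bl. \<exists>e\<in>H. path_in H m' a b Bl \<and> Bl m' = part \<chi> e (if even m' then A else B)" for m'
  proof (induction m')
    case 0
    obtain e where "e \<in> H" using ne by blast
    then have "path_in H 0 a b (\<lambda>_. part \<chi> e A)" using fin by (simp add: path_in_def)
    then show ?case using \<open>e \<in> H\<close> by (intro exI[of _ "\<lambda>_. part \<chi> e A"] bexI[of _ e]) simp_all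
  next
    case (Suc m')
    then obtain Bl e where Bl: "e \<in> H" "path_in H m' a b Bl" "Bl m' = part \<chi> e (if even m' then A else B)"
      by auto
    define S S' where "S = (if even m' then A else B)" and "S' = (if even m' then B else A)"
    have S: "S \<in> J" "S \<subseteq> {..<r}" using AB sub by (auto simp: S_def)
    have cS: "finite (part \<chi> e' S')" "card (part \<chi> e' S') = (if even (Suc m') then a else b)"
      "part \<chi> e' S \<union> part \<chi> e' S' = e'" "part \<chi> e' S \<inter> part \<chi> e' S' = {}" if "e' \<in> H" for e'
      using fin[OF that] by (simp_all add: S_def S'_def Un_commute Int_commute)
    have "(m' + 1) * (a + b) \<le> (m + 1) * (a + b)" using Suc.prems by (intro mult_le_mono1) simp
    then have cU: "card (\<Union>i\<le>m'. Bl i) \<le> s" using path_in_Union(2)[OF Bl(2)] s by linarith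
    obtain e' where e': "e' \<in> H" "part \<chi> e S \<subseteq> e'" "(e' - part \<chi> e S) \<inter> (\<Union>i\<le>m'. Bl i) = {}"
      by (rule kernelE[OF homogD(3)[OF h Bl(1) S(1)] path_in_Union(1)[OF Bl(2)] cU])
    have eq: "part \<chi> e' S = part \<chi> e S"
      by (rule part_eqI[OF homogD(2)[OF h Bl(1)] homogD(2)[OF h e'(1)] S(2) e'(2)])
    have "part \<chi> e' S' \<subseteq> e' - part \<chi> e S" using cS(3,4)[OF e'(1)] eq by auto
    then have "part \<chi> e' S' \<inter> (\<Union>i\<le>m'. Bl i) = {}" using e'(3) by auto
    moreover have "Bl m' \<union> part \<chi> e' S' \<in> H" using cS(3)[OF e'(1)] e'(1) eq Bl(3) by (simp add: S_def)
    ultimately have "path_in H (Suc m') a b (Bl(Suc m' := part \<chi> e' S'))"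
      using path_in_Suc[OF Bl(2) cS(1,2)[OF e'(1)]] by blast
    moreover have "(Bl(Suc m' := part \<chi> e' S')) (Suc m') = part \<chi> e' (if even (Suc m') then A else B)"
      by (simp add: S'_def)
    ultimately show ?case using e'(1) by blast
  qed
  then show ?thesis unfolding has_path_def by blast
qed

text \<open>Let \<open>Q\<close> consist of the positions whose singleton complement is missing from
  \<open>J\<close>. Covering forces the complement of every pair in \<open>Q\<close> into
  \<open>J\<close>, so by intersection the complement of \<open>C\<close> lies in \<open>J\<close>
  unless \<open>C\<close> meets \<open>Q\<close> in exactly one point. It remains to distribute
  \<open>Q\<close> over blocks of sizes \<open>a\<close> and \<open>b\<close> without leaving just
  one point of \<open>Q\<close> in either.\<close>

lemma pattern_split:
  fixes J :: "nat set set"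
  assumes ab: "b < a" "1 \<le> b" "r = a + b" and J: "{..<r} \<in> J"
    and int: "\<And>S1 S2. S1 \<in> J \<Longrightarrow> S2 \<in> J \<Longrightarrow> S1 \<inter> S2 \<in> J"
    and cov: "\<And>g. g \<subseteq> {..<r} \<Longrightarrow> card g = r - 2 \<Longrightarrow> \<exists>S\<in>J. g \<subseteq> S \<and> S \<subset> {..<r}"
    and x: "x < r" "{..<r} - {x} \<notin> J" and S: "S \<notin> J" "x \<in> S" "S \<subseteq> {..<r}" "2 \<le> b \<or> card S = 1"
  shows "\<exists>A\<in>J. \<exists>B\<in>J. A \<inter> B = {} \<and> A \<union> B = {..<r} \<and> card A = a \<and> card B = b"
proof -
  define R where "R = {..<r}"
  have R: "finite R" "card R = r" by (simp_all add: R_def)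
  define Q where "Q = {i\<in>R. R - {i} \<notin> J}"
  have Q: "Q \<subseteq> R" "finite Q" "x \<in> Q" using x R by (auto simp: Q_def R_def)
  \<comment> \<open>The proper pattern provided by \<open>cov\<close> cannot omit only one of
    \<open>i\<close> and \<open>j\<close>, because both lie in \<open>Q\<close>.\<close>
  have pairs: "R - {i, j} \<in> J" if ij: "i \<in> Q" "j \<in> Q" "i \<noteq> j" for i j
  proof -
    have "card (R - {i, j}) = r - 2" using ij Q R by (subst card_Diff_subset) auto
    then obtain T where T: "T \<in> J" "R - {i, j} \<subseteq> T" "T \<subset> R" using cov[of "R - {i, j}"] by (auto simp: R_def)
    have "T \<noteq> R - {i}" "T \<noteq> R - {j}" using ij T(1) by (auto simp: Q_def)
    then have "T = R - {i, j}" using T(2,3) by auto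
    then show ?thesis using T(1) by simp
  qed
  have rem: "T - D \<in> J" if "finite D" "D \<subseteq> R - Q" "T \<in> J" "T \<subseteq> R" for D T
    using that
  proof (induction D arbitrary: T rule: finite_induct)
    case (insert d D)
    have "R - {d} \<in> J" using insert.prems by (auto simp: Q_def)
    then have "T \<inter> (R - {d}) \<in> J" using insert.prems int by blast
    moreover have "T \<inter> (R - {d}) = T - {d}" using insert.prems by blast
    ultimately have "T - {d} \<in> J" by simp
    then have "T - {d} - D \<in> J" using insert.IH[of "T - {d}"] insert.prems by blast
    moreover have "T - {d} - D = T - insert d D" by blast
    ultimately show ?case by simp
  qed simp
  have remQ: "R - D \<in> J" if D: "D \<subseteq> Q" "card D \<noteq> 1" for D
  proof (cases "D = {}")
    case True
    then show ?thesis using J by (simp add: R_def)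
  next
    case False
    then obtain d where d: "d \<in> D" by blast
    have fD: "finite D" using D Q finite_subset by blast
    have "D - {d} \<noteq> {}"
    proof
      assume "D - {d} = {}"
      then have "D = {d}" using d by blast
      then show False using D(2) by simp
    qed
    moreover have "finite (D - {d})" using fD by simp
    moreover have "R - insert d D' \<in> J" if "finite D'" "D' \<noteq> {}" "D' \<subseteq> Q - {d}" for D'
      using that
    proof (induction D' rule: finite_ne_induct)
      case (singleton y)
      then show ?case using pairs[of d y] d D by auto
    next
      case (insert y F)
      have "R - insert d F \<in> J" "R - {d, y} \<in> J" using insert pairs[of d y] d D by auto
      then have "(R - insert d F) \<inter> (R - {d, y}) \<in> J" by (rule int)
      moreover have "(R - insert d F) \<inter> (R - {d, y}) = R - insert d (insert y F)" by blast
      ultimately show ?case by simp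
    qed
    moreover have "D - {d} \<subseteq> Q - {d}" using D by blast
    ultimately have "R - insert d (D - {d}) \<in> J" by blast
    then show ?thesis using d by (simp add: insert_absorb)
  qed
  have key: "R - C \<in> J" if "C \<subseteq> R" "card (C \<inter> Q) \<noteq> 1" for C
  proof -
    have "R - (C \<inter> Q) - (C - Q) \<in> J"
      using that R finite_subset by (intro rem remQ) auto
    moreover have "R - (C \<inter> Q) - (C - Q) = R - C" by blast
    ultimately show ?thesis by simp
  qed
  \<comment> \<open>If \<open>Q\<close> were \<open>{x}\<close>, the complement of \<open>S\<close>
    would miss \<open>Q\<close>, and \<open>S\<close> would belong to \<open>J\<close>.\<close>
  have q2: "card Q \<noteq> 1"
  proof
    assume "card Q = 1"
    then have "Q = {x}" using Q(3) by (metis card_1_singletonE singletonD)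
    then have "(R - S) \<inter> Q = {}" using S(2) by auto
    then have "card ((R - S) \<inter> Q) \<noteq> 1" by simp
    then have "R - (R - S) \<in> J" using key[of "R - S"] by blast
    moreover have "R - (R - S) = S" using S(3) by (auto simp: R_def)
    ultimately show False using S(1) by simp
  qed
  have split: ?thesis if A: "A \<subseteq> R" "card A = a" "card (A \<inter> Q) \<noteq> 1" "card ((R - A) \<inter> Q) \<noteq> 1" for A
  proof (intro bexI conjI)
    show "R - A \<in> J" using key[of A] A by blast
    have "R - (R - A) \<in> J" using key[of "R - A"] A by blast
    moreover have "R - (R - A) = A" using A(1) by blast
    ultimately show "A \<in> J" by simp
    show "A \<inter> (R - A) = {}" by blast
    show "A \<union> (R - A) = {..<r}" using A(1) by (auto simp: R_def)
    show "card (R - A) = b" using A R ab finite_subset[OF A(1)] by (simp add: card_Diff_subset)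
  qed (rule A(2))
  \<comment> \<open>A small \<open>Q\<close> fits into the \<open>a\<close>-block. Otherwise, for
    \<open>b \<ge> 2\<close>, the \<open>b\<close>-block is filled from \<open>Q\<close> and at
    least \<open>a + 1 - b \<ge> 2\<close> points of \<open>Q\<close> remain for the other block;
    this is where \<open>b < a\<close> matters.\<close>
  show ?thesis
  proof (cases "card Q \<le> a")
    case True
    then obtain A where A: "Q \<subseteq> A" "A \<subseteq> R" "card A = a"
      using exists_subset_between[of Q a R] Q R ab by auto
    have "A \<inter> Q = Q" "(R - A) \<inter> Q = {}" using A by auto
    then show ?thesis using split[OF A(2,3)] q2 by simp
  next
    case False
    show ?thesis
    proof (cases "2 \<le> b")
      case True
      obtain B where B: "B \<subseteq> Q" "card B = b"
        using obtain_subset_with_card_n[of b Q] False ab by (metis le_trans less_imp_le nat_le_linear)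
      have fB: "finite B" using B(1) Q(2) by (rule finite_subset)
      have "(R - (R - B)) \<inter> Q = B" "(R - B) \<inter> Q = Q - B" using B Q by auto
      moreover have "card (Q - B) = card Q - b" using B fB by (simp add: card_Diff_subset)
      moreover have "card (R - B) = a" using B Q R fB ab by (simp add: card_Diff_subset)
      ultimately show ?thesis using split[of "R - B"] B False True ab by auto
    next
      \<comment> \<open>For \<open>b = 1\<close> every position lies in \<open>Q\<close>. The
        complement of \<open>S = {x}\<close> then has \<open>a \<ge> 2\<close> points in
        \<open>Q\<close>, so \<open>S\<close> would belong to \<open>J\<close>.\<close>
      case False': False
      then have b1: "b = 1" "card S = 1" using ab S(4) by auto
      then have Sx: "S = {x}" using S(2) by (metis card_1_singletonE singletonD)
      have "card R \<le> card Q" using False R ab b1 by simp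
      then have "Q = R" using Q R by (metis card_seteq)
      then have "card ((R - S) \<inter> Q) = a"
        using Sx S(3) R ab b1 by (simp add: R_def Int_absorb2 card_Diff_subset)
      then have "R - (R - S) \<in> J" using key[of "R - S"] ab b1 by auto
      moreover have "R - (R - S) = S" using S(3) by (auto simp: R_def)
      ultimately show ?thesis using S(1) by simp
    qed
  qed
qed

section \<open>Families without long paths\<close>

lemma finite_ksub_subset: "finite V \<Longrightarrow> E \<subseteq> ksub V r \<Longrightarrow> finite E"
  using finite_ksub finite_subset by blast

lemma ksub_edge:
  assumes "finite V" "E \<subseteq> ksub V r" "e \<in> E"
  shows "finite e" "card e = r" "e \<subseteq> V"
proof -
  have "e \<in> ksub V r" using assms by blast
  then show "card e = r" "e \<subseteq> V" by (simp_all add: ksub_def)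
  then show "finite e" using assms(1) finite_subset by blast
qed

text \<open>If some \<open>(r-2)\<close>-pattern is not covered by a proper pattern of \<open>J\<close>, an edge is
  determined by its part in that pattern.\<close>
lemma homog_small:
  assumes V: "finite V" and G: "G \<subseteq> ksub V r" and h: "homog \<chi> r s G J"
    and g: "g \<subseteq> {..<r}" "card g = t" "\<And>S. S \<in> J \<Longrightarrow> g \<subseteq> S \<Longrightarrow> \<not> S \<subset> {..<r}"
  shows "card G \<le> card V ^ t"
proof -
  have "inj_on (\<lambda>e. part \<chi> e g) G"
  proof (rule inj_onI)
    fix e e' assume e: "e \<in> G" "e' \<in> G" "part \<chi> e g = part \<chi> e' g"
    have "g = \<chi> ` part \<chi> e g" using image_part[OF homogD(2)[OF h e(1)] g(1)] by simp
    also have "\<dots> \<subseteq> \<chi> ` (e \<inter> e')" using e(3) part_subset[of \<chi> e g] part_subset[of \<chi> e' g] by blast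
    finally have "g \<subseteq> \<chi> ` (e \<inter> e')" .
    moreover have "\<chi> ` (e \<inter> e') \<in> J" by (rule homogD(4)[OF h e(1,2)])
    ultimately have "\<chi> ` (e \<inter> e') = {..<r}" using g(3) homogD(1)[OF h] by blast
    then show "e = e'" by (rule homog_eq[OF h e(1,2)])
  qed
  moreover have "(\<lambda>e. part \<chi> e g) ` G \<subseteq> ksub V t"
  proof
    fix T assume "T \<in> (\<lambda>e. part \<chi> e g) ` G"
    then obtain e where e: "e \<in> G" "T = part \<chi> e g" by blast
    have "T \<subseteq> V" using e part_subset[of \<chi> e g] ksub_edge(3)[OF V G e(1)] by blast
    then show "T \<in> ksub V t" using card_part[OF homogD(2)[OF h e(1)] g(1)] e g(2) by (simp add: ksub_def)
  qed
  ultimately have "card G \<le> card (ksub V t)" using V by (intro card_inj_on_le) auto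
  also have "\<dots> \<le> card V ^ t" using V by (rule card_ksub_le)
  finally show ?thesis .
qed

text \<open>The set \<open>e - {x e}\<close> plays the role of an own subset of \<open>e\<close>.\<close>
lemma few_exceptions:
  assumes ab: "b < a" "1 \<le> b" "r = a + b" and s: "2 * r \<le> s" "(m + 1) * r \<le> s"
    and V: "finite V" and D: "D \<subseteq> ksub V r" and np: "\<not> has_path D m a b"
    and xS: "\<And>e. e \<in> D \<Longrightarrow> x e \<in> S e" "\<And>e. e \<in> D \<Longrightarrow> S e \<subseteq> e" "\<And>e. e \<in> D \<Longrightarrow> 2 \<le> b \<or> card (S e) = 1"
    and own: "\<And>e. e \<in> D \<Longrightarrow> \<not> kernel s D (e - {x e})"
    and her: "\<And>D'. D' \<subseteq> D \<Longrightarrow> D' \<noteq> {} \<Longrightarrow> \<exists>e\<in>D'. \<not> kernel s D' (S e)"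
  shows "card D \<le> fur r s * card V ^ (r - 2)"
proof -
  have r1: "1 \<le> r" using ab by simp
  have xe: "\<And>e. e \<in> D \<Longrightarrow> x e \<in> e" using xS by blast
  obtain \<chi> G J x0 S0 where G: "G \<subseteq> D" "homog \<chi> r s G J" "x0 < r" "S0 \<subseteq> {..<r}"
    "\<forall>e\<in>G. \<chi> (x e) = x0 \<and> part \<chi> e S0 = S e" "card D \<le> fur r s * card G"
    using homog_subfamily[OF V D r1, where x=x and S=S and s=s, OF xe xS(2)] by auto
  have "card G \<le> card V ^ (r - 2)"
  proof (cases "G = {}")
    case False
    have GV: "G \<subseteq> ksub V r" using G(1) D by blast
    have ownJ: "{..<r} - {x0} \<notin> J"
    proof
      assume J: "{..<r} - {x0} \<in> J"
      obtain e where e: "e \<in> G" using False by blast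
      have b: "bij_betw \<chi> e {..<r}" by (rule homogD(2)[OF G(2) e])
      have "part \<chi> e ({..<r} - {x0}) = e - {x e}"
      proof (rule set_eqI)
        fix v
        have "x e \<in> e" "\<chi> (x e) = x0" using e G(1,5) xe by blast+
        then show "v \<in> part \<chi> e ({..<r} - {x0}) \<longleftrightarrow> v \<in> e - {x e}"
          using b bij_betwE[OF b] unfolding part_def bij_betw_def inj_on_def by auto
      qed
      then have "kernel s G (e - {x e})" using homogD(3)[OF G(2) e J] by simp
      then show False using kernel_mono[OF _ G(1)] own e G(1) by blast
    qed
    \<comment> \<open>The hereditary hypothesis is applied to \<open>G\<close> itself: the marked
      set of some edge of \<open>G\<close> is not a kernel of \<open>G\<close>, although all marked
      sets occupy the positions \<open>S0\<close>.\<close>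
    have SJ: "S0 \<notin> J"
    proof
      assume J: "S0 \<in> J"
      obtain e where e: "e \<in> G" "\<not> kernel s G (S e)" using her[OF G(1) False] by blast
      then show False using homogD(3)[OF G(2) e(1) J] G(5) by simp
    qed
    obtain e0 where e0: "e0 \<in> G" using False by blast
    have b0: "bij_betw \<chi> e0 {..<r}" by (rule homogD(2)[OF G(2) e0])
    have "x e0 \<in> part \<chi> e0 S0" "\<chi> (x e0) = x0" using G(1,5) e0 xS(1)[of e0] by auto
    then have x0S: "x0 \<in> S0" by (simp add: part_def)
    have cS0: "2 \<le> b \<or> card S0 = 1"
      using card_part[OF b0 G(4)] xS(3)[of e0] G(1,5) e0 by auto
    \<comment> \<open>With more than \<open>card V ^ (r - 2)\<close> edges in \<open>G\<close>, no
      \<open>(r-2)\<close>-pattern can determine the edge. Hence all these patterns are covered, and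
      a split of the positions gives a path.\<close>
    show ?thesis
    proof (rule ccontr)
      assume big: "\<not> card G \<le> card V ^ (r - 2)"
      have cov: "\<exists>S\<in>J. g \<subseteq> S \<and> S \<subset> {..<r}" if "g \<subseteq> {..<r}" "card g = r - 2" for g
        using homog_small[OF V GV G(2) that] big by blast
      obtain A B where AB: "A \<in> J" "B \<in> J" "A \<inter> B = {}" "A \<union> B = {..<r}" "card A = a" "card B = b"
        using pattern_split[OF ab homog_top[OF G(2) False] homog_Int[OF G(2) False s(1)] cov G(3) ownJ SJ x0S G(4) cS0]
        by blast
      have "has_path G m a b"
        using homog_path[OF G(2) False AB, of m] s(2) ab(3) by simp
      then show False using np has_path_mono[OF _ G(1)] by blast
    qed
  qed simp
  then have "fur r s * card G \<le> fur r s * card V ^ (r - 2)" by (rule mult_le_mono2)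
  then show ?thesis using G(6) by linarith
qed

text \<open>If \<open>J\<close> contained the complement of every position, it would contain every
  pattern, in particular \<open>{..<a}\<close> and its complement, and a path would arise. A
  position \<open>y\<close> with missing complement gives own subsets: an edge of \<open>G\<close>
  is determined by its vertices of the other colours.\<close>

lemma own_subsets:
  assumes ab: "1 \<le> a" "1 \<le> b" "r = a + b" and s: "2 * r \<le> s" "(m + 1) * r \<le> s"
    and V: "finite V" and E: "E \<subseteq> ksub V r" and np: "\<not> has_path E m a b"
  shows "\<exists>Es x. Es \<subseteq> E \<and> (\<forall>e\<in>Es. x e \<in> e) \<and> inj_on (\<lambda>e. e - {x e}) Es \<and> card E \<le> fur r s * card Es"
proof -
  have r1: "1 \<le> r" using ab by simp
  have ne: "e \<noteq> {}" if "e \<in> E" for e using ksub_edge[OF V E that] r1 by auto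
  then have xe: "\<And>e. e \<in> E \<Longrightarrow> (SOME v. v \<in> e) \<in> e" by (simp add: some_in_eq)
  obtain \<chi> G J where G: "G \<subseteq> E" "homog \<chi> r s G J" "card E \<le> fur r s * card G"
    using homog_subfamily[OF V E r1, where x="\<lambda>e. SOME v. v \<in> e" and S="\<lambda>e. e" and s=s, OF xe] by auto
  show ?thesis
  proof (cases "G = {}")
    case True
    then show ?thesis using G by (intro exI[of _ G]) auto
  next
    case False
    have "\<exists>y<r. {..<r} - {y} \<notin> J"
    proof (rule ccontr)
      assume "\<not> ?thesis"
      then have all: "\<And>y. y < r \<Longrightarrow> {..<r} - {y} \<in> J" by blast
      have rem: "{..<r} - C \<in> J" if "finite C" "C \<subseteq> {..<r}" for C
        using that
      proof (induction C rule: finite_induct)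
        case empty
        then show ?case using homog_top[OF G(2) False] by simp
      next
        case (insert y C)
        have "({..<r} - C) \<inter> ({..<r} - {y}) \<in> J"
          using insert by (intro homog_Int[OF G(2) False s(1)] all) auto
        moreover have "({..<r} - C) \<inter> ({..<r} - {y}) = {..<r} - insert y C" by blast
        ultimately show ?case by simp
      qed
      have "{..<r} - {a..<r} \<in> J" "{..<r} - {..<a} \<in> J" using ab by (intro rem; auto)+
      moreover have "{..<r} - {a..<r} = {..<a}" "{..<r} - {..<a} = {a..<r}" using ab by auto
      ultimately have AB: "{..<a} \<in> J" "{a..<r} \<in> J" by simp_all
      have "has_path G m a b"
        by (rule homog_path[OF G(2) False AB]) (use ab s in auto)
      then show False using np has_path_mono[OF _ G(1)] by blast
    qed
    then obtain y where y: "y < r" "{..<r} - {y} \<notin> J" by blast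
    have "\<exists>v. v \<in> e \<and> \<chi> v = y" if "e \<in> G" for e
    proof -
      have "y \<in> \<chi> ` e" using homogD(2)[OF G(2) that] y(1) by (simp add: bij_betw_def)
      then show ?thesis by blast
    qed
    then obtain x where x: "\<And>e. e \<in> G \<Longrightarrow> x e \<in> e \<and> \<chi> (x e) = y" by metis
    have "inj_on (\<lambda>e. e - {x e}) G"
    proof (rule inj_onI)
      fix e e' assume e: "e \<in> G" "e' \<in> G" "e - {x e} = e' - {x e'}"
      have b: "bij_betw \<chi> e {..<r}" by (rule homogD(2)[OF G(2) e(1)])
      have "\<chi> ` (e - {x e}) = {..<r} - {y}"
        using b x[OF e(1)] unfolding bij_betw_def by (simp add: inj_on_image_set_diff[of \<chi> e])
      moreover have "e - {x e} \<subseteq> e \<inter> e'" using e(3) by blast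
      ultimately have "{..<r} - {y} \<subseteq> \<chi> ` (e \<inter> e')" by blast
      moreover have J: "\<chi> ` (e \<inter> e') \<in> J" by (rule homogD(4)[OF G(2) e(1,2)])
      moreover have "\<chi> ` (e \<inter> e') \<subseteq> {..<r}" using J homogD(1)[OF G(2)] by blast
      moreover have "\<chi> ` (e \<inter> e') \<noteq> {..<r} - {y}" using J y(2) by metis
      ultimately have "\<chi> ` (e \<inter> e') = {..<r}" by blast
      then show "e = e'" by (rule homog_eq[OF G(2) e(1,2)])
    qed
    then show ?thesis using G x by blast
  qed
qed

lemma path_free_size:
  assumes ab: "1 \<le> a" "1 \<le> b" "r = a + b" and s: "2 * r \<le> s" "(m + 1) * r \<le> s"
    and V: "finite V" and E: "E \<subseteq> ksub V r" and np: "\<not> has_path E m a b"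
    and K: "finite K" "\<And>e v. e \<in> E \<Longrightarrow> v \<in> e \<Longrightarrow> e - {v} \<in> K"
  shows "card E \<le> fur r s * card K"
proof -
  obtain Es x where Es: "Es \<subseteq> E" "\<forall>e\<in>Es. x e \<in> e" "inj_on (\<lambda>e. e - {x e}) Es" "card E \<le> fur r s * card Es"
    using own_subsets[OF ab s V E np] by blast
  have "card Es \<le> card K" using Es K by (intro card_inj_on_le[OF Es(3)]) auto
  then have "fur r s * card Es \<le> fur r s * card K" by (rule mult_le_mono2)
  then show ?thesis using Es(4) by linarith
qed

lemma ksub_remove:
  assumes "finite V" "e \<in> ksub V r" "v \<in> e"
  shows "e - {v} \<in> ksub V (r - 1)"
  using assms finite_subset[of e V] by (auto simp: ksub_def)

lemma path_free_size_power:
  assumes "1 \<le> a" "1 \<le> b" "r = a + b" "2 * r \<le> s" "(m + 1) * r \<le> s"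
    "finite V" "E \<subseteq> ksub V r" "\<not> has_path E m a b"
  shows "card E \<le> fur r s * card V ^ (r - 1)"
proof -
  have "card E \<le> fur r s * card (ksub V (r - 1))"
  proof (rule path_free_size[OF assms])
    show "e - {v} \<in> ksub V (r - 1)" if "e \<in> E" "v \<in> e" for e v
      using ksub_remove[of V e r v] assms that by blast
  qed (use assms in simp)
  also have "\<dots> \<le> fur r s * card V ^ (r - 1)" using assms by (intro mult_le_mono2 card_ksub_le)
  finally show ?thesis .
qed

text \<open>Fewer than \<open>s\<close> edges through \<open>f\<close> would bring fewer than
  \<open>s\<close> further vertices, but a kernel has an edge through \<open>f\<close> that avoids
  any such set.\<close>

lemma kernel_degree:
  assumes E: "finite E" "\<And>e. e \<in> E \<Longrightarrow> finite e \<and> card e = Suc (card f)" and f: "finite f" "kernel s E f"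
  shows "s \<le> card {e\<in>E. f \<subseteq> e}"
proof (rule ccontr)
  assume less: "\<not> ?thesis"
  define U where "U = (\<Union>e\<in>{e\<in>E. f \<subseteq> e}. e - f)"
  have "card U \<le> (\<Sum>e\<in>{e\<in>E. f \<subseteq> e}. card (e - f))" unfolding U_def using E by (intro card_UN_le) auto
  also have "\<dots> = (\<Sum>e\<in>{e\<in>E. f \<subseteq> e}. 1)" using E f by (intro sum.cong) (auto simp: card_Diff_subset)
  finally have "card U \<le> s" using less by simp
  moreover have "finite U" unfolding U_def using E by (intro finite_UN_I) auto
  ultimately obtain e where e: "e \<in> E" "f \<subseteq> e" "(e - f) \<inter> U = {}" using kernelE[OF f(2)] by metis
  have "e - f \<subseteq> U" using e unfolding U_def by blast
  then have "e \<subseteq> f" using e(3) by blast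
  then show False using e E(2)[OF e(1)] by (metis n_not_Suc_n subset_antisym)
qed

lemma card_subsets_of_edge: "finite e \<Longrightarrow> finite A \<Longrightarrow> card {f\<in>A. f \<subseteq> e \<and> card f = t} \<le> card e choose t"
  using n_subsets[of e t] card_mono[of "{f. f \<subseteq> e \<and> card f = t}" "{f\<in>A. f \<subseteq> e \<and> card f = t}"] by auto

text \<open>All own subsets of these edges are kernels, each contained in at least \<open>s\<close>
  edges of \<open>H\<close>, so there are only \<open>O(card V ^ (r - 1) / s)\<close> of them. Here
  \<open>s0\<close> need only suffice for building paths and determines the constants, while
  \<open>s\<close> can be taken as large as desired.\<close>

lemma few_full_edges:
  assumes ab: "1 \<le> a" "1 \<le> b" "r = a + b" and s0: "2 * r \<le> s0" "(m + 1) * r \<le> s0"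
    and V: "finite V" and H: "H \<subseteq> ksub V r" and np: "\<not> has_path H m a b"
  shows "card {e\<in>H. \<forall>v\<in>e. kernel s H (e - {v})} * s \<le> fur r s0 * (r * (fur r s0 * card V ^ (r - 1)))"
proof -
  let ?F = "{e\<in>H. \<forall>v\<in>e. kernel s H (e - {v})}" and ?K = "{f\<in>ksub V (r - 1). kernel s H f}"
  note finH = finite_ksub_subset[OF V H]
  have "card ?F \<le> fur r s0 * card ?K"
  proof (rule path_free_size[OF ab s0 V])
    show "?F \<subseteq> ksub V r" using H by blast
    show "\<not> has_path ?F m a b" using np has_path_mono[of ?F m a b H] by blast
    show "finite ?K" using V by simp
    show "e - {v} \<in> ?K" if "e \<in> ?F" "v \<in> e" for e v using that ksub_remove[OF V, of e r v] H by blast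
  qed
  then have "card ?F * s \<le> fur r s0 * card ?K * s" by (rule mult_le_mono1)
  also have "\<dots> = fur r s0 * (card ?K * s)" by (rule mult.assoc)
  also have "card ?K * s \<le> r * card H"
  proof (rule double_count[where R="\<lambda>f e. f \<subseteq> e"])
    show "s \<le> card {e\<in>H. f \<subseteq> e}" if "f \<in> ?K" for f
    proof (rule kernel_degree[OF finH])
      show "finite f" using that V finite_subset by (auto simp: ksub_def)
      show "kernel s H f" using that by simp
      show "finite e \<and> card e = Suc (card f)" if "e \<in> H" for e
        using ksub_edge[OF V H that] \<open>f \<in> ?K\<close> ab by (auto simp: ksub_def)
    qed
    show "card {f\<in>?K. f \<subseteq> e} \<le> r" if "e \<in> H" for e
    proof -
      note e = ksub_edge[OF V H that]
      have "{f\<in>?K. f \<subseteq> e} = {f\<in>?K. f \<subseteq> e \<and> card f = r - 1}" by (auto simp: ksub_def)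
      then have "card {f\<in>?K. f \<subseteq> e} \<le> r choose (r - 1)"
        using card_subsets_of_edge[OF e(1), of ?K "r - 1"] V e(2) by simp
      also have "\<dots> = r" using ab binomial_symmetric[of 1 r] by simp
      finally show ?thesis .
    qed
  qed (use V finH in auto)
  also have "card H \<le> fur r s0 * card V ^ (r - 1)" by (rule path_free_size_power[OF ab s0 V H np])
  finally show ?thesis by (simp add: mult_le_mono2)
qed

section \<open>Cleaning and greedy paths\<close>

text \<open>By the exchange clause a trace \<open>e - X\<close> either keeps all its edges of
  \<open>G0\<close> or loses all of them. The restriction \<open>2 \<le> b \<or> card S = 1\<close>
  mirrors the hypothesis of \<open>pattern_split\<close>: for \<open>b = 1\<close> only singletons
  can be shown to be kernels.\<close>

definition cleaned :: "'a set \<Rightarrow> nat \<Rightarrow> nat \<Rightarrow> 'a set set \<Rightarrow> 'a set set \<Rightarrow> bool" where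
  "cleaned X s b G0 G \<longleftrightarrow> G \<subseteq> G0 \<and> (\<forall>e\<in>G. \<forall>e'\<in>G0. e' - X = e - X \<longrightarrow> e' \<in> G) \<and>
     (\<forall>e\<in>G. \<forall>S. e \<inter> X \<subseteq> S \<longrightarrow> S \<subseteq> e \<longrightarrow> 2 \<le> b \<or> card S = 1 \<longrightarrow> kernel s G S)"

lemma cleanedD:
  assumes "cleaned X s b G0 G"
  shows "G \<subseteq> G0" "e \<in> G \<Longrightarrow> e' \<in> G0 \<Longrightarrow> e' - X = e - X \<Longrightarrow> e' \<in> G"
    "e \<in> G \<Longrightarrow> e \<inter> X \<subseteq> S \<Longrightarrow> S \<subseteq> e \<Longrightarrow> 2 \<le> b \<or> card S = 1 \<Longrightarrow> kernel s G S"
proof -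
  have "\<forall>e\<in>G. \<forall>e'\<in>G0. e' - X = e - X \<longrightarrow> e' \<in> G"
    "\<forall>e\<in>G. \<forall>S. e \<inter> X \<subseteq> S \<longrightarrow> S \<subseteq> e \<longrightarrow> 2 \<le> b \<or> card S = 1 \<longrightarrow> kernel s G S"
    using assms unfolding cleaned_def by simp_all
  note * = this[rule_format]
  show "e \<in> G \<Longrightarrow> e' \<in> G0 \<Longrightarrow> e' - X = e - X \<Longrightarrow> e' \<in> G" by (rule *(1))
  show "e \<in> G \<Longrightarrow> e \<inter> X \<subseteq> S \<Longrightarrow> S \<subseteq> e \<Longrightarrow> 2 \<le> b \<or> card S = 1 \<Longrightarrow> kernel s G S" by (rule *(2))
qed (use assms in \<open>simp add: cleaned_def\<close>)

text \<open>An edge is bad if a sibling with the same trace outside \<open>X\<close> is gone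
  (\<open>None\<close>), or if some \<open>S\<close> through its centre is not a kernel
  (\<open>Some S\<close>). Removals of the first kind occur only after another loss in the same
  trace. So every lost trace contains an edge removed for the second reason, and
  \<open>few_exceptions\<close> bounds the number of those.\<close>

lemma clean:
  assumes ab: "b < a" "1 \<le> b" "r = a + b" and s: "2 * r \<le> s" "(m + 1) * r \<le> s"
    and V: "finite V" and G0: "G0 \<subseteq> ksub V r" and np: "\<not> has_path G0 m a b"
    and X: "\<And>e. e \<in> G0 \<Longrightarrow> \<exists>v. e \<inter> X = {v}"
    and own: "\<And>e. e \<in> G0 \<Longrightarrow> \<not> kernel s G0 (e - X)"
  shows "\<exists>G. cleaned X s b G0 G \<and> card ((\<lambda>e. e - X) ` G0 - (\<lambda>e. e - X) ` G) \<le> fur r s * card V ^ (r - 2)"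
proof -
  note finG0 = finite_ksub_subset[OF V G0]
  define bad where "bad l D e = (case l of
      None \<Rightarrow> \<exists>e'\<in>G0. e' - X = e - X \<and> e' \<notin> D
    | Some S \<Rightarrow> e \<inter> X \<subseteq> S \<and> S \<subseteq> e \<and> (2 \<le> b \<or> card S = 1) \<and> \<not> kernel s D S)" for l D e
  have anti: "bad i D e" if "D \<subseteq> D'" "bad i D' e" for i D D' e
    using that kernel_mono[OF _ that(1)] unfolding bad_def by (auto split: option.splits)
  have "\<exists>G l. peeled bad UNIV G0 G l"
    by (rule peel[OF finG0]) (rule anti)
  then obtain G l where pe: "peeled bad UNIV G0 G l" by blast
  note G = peeledD(1)[OF pe] and good = peeledD(2)[OF pe, OF _ UNIV_I] and her = peeledD(4)[OF pe]
  define D where "D = {e\<in>G0 - G. l e \<noteq> None}"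
  have Dsub: "D \<subseteq> G0 - G" "D \<subseteq> G0" by (auto simp: D_def)
  obtain x where x: "\<And>e. e \<in> G0 \<Longrightarrow> e \<inter> X = {x e}" using X by metis
  have lD: "bad (l e) D' e \<Longrightarrow> e \<inter> X \<subseteq> the (l e) \<and> the (l e) \<subseteq> e \<and> (2 \<le> b \<or> card (the (l e)) = 1) \<and> \<not> kernel s D' (the (l e))"
    if "e \<in> D" for e D'
    using that unfolding D_def bad_def by auto
  have l1: "bad (l e) {e} e" if "e \<in> D" for e
    using her[of "{e}"] that Dsub by blast
  have cD: "card D \<le> fur r s * card V ^ (r - 2)"
  proof (rule few_exceptions[OF ab s V, where x=x and S="\<lambda>e. the (l e)"])
    show "D \<subseteq> ksub V r" using Dsub G0 by blast
    show "\<not> has_path D m a b" using np has_path_mono[OF _ Dsub(2)] by blast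
    fix e assume e: "e \<in> D"
    then have xe: "e \<inter> X = {x e}" using x Dsub by blast
    show "x e \<in> the (l e)" "the (l e) \<subseteq> e" "2 \<le> b \<or> card (the (l e)) = 1"
      using lD[OF e l1[OF e]] xe by auto
    have "e - {x e} = e - X" using xe by blast
    moreover have "\<not> kernel s G0 (e - X)" using own e Dsub(2) by blast
    ultimately show "\<not> kernel s D (e - {x e})" using kernel_mono[OF _ Dsub(2)] by metis
  next
    fix D' assume D': "D' \<subseteq> D" "D' \<noteq> {}"
    then obtain e where "e \<in> D'" "bad (l e) D' e" using her[of D'] Dsub by blast
    then show "\<exists>e\<in>D'. \<not> kernel s D' (the (l e))" using lD[of e D'] D'(1) by blast
  qed
  have "(\<lambda>e. e - X) ` G0 - (\<lambda>e. e - X) ` G \<subseteq> (\<lambda>e. e - X) ` D"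
  proof
    fix f assume f: "f \<in> (\<lambda>e. e - X) ` G0 - (\<lambda>e. e - X) ` G"
    let ?D = "{e\<in>G0. e - X = f}"
    have "?D \<subseteq> G0 - G" "?D \<noteq> {}" using f by auto
    then obtain e where e: "e \<in> ?D" "bad (l e) ?D e" using her[of ?D] by blast
    \<comment> \<open>All siblings of \<open>e\<close> are present in \<open>?D\<close>, so a
      missing sibling cannot be the reason.\<close>
    have "l e \<noteq> None"
    proof
      assume "l e = None"
      then obtain e' where "e' \<in> G0" "e' - X = e - X" "e' \<notin> ?D" using e(2) by (auto simp: bad_def)
      then show False using e(1) by simp
    qed
    then have "e \<in> D" using e \<open>?D \<subseteq> G0 - G\<close> by (auto simp: D_def)
    then show "f \<in> (\<lambda>e. e - X) ` D" using e(1) by blast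
  qed
  then have "card ((\<lambda>e. e - X) ` G0 - (\<lambda>e. e - X) ` G) \<le> card D"
    by (rule surj_card_le[rotated]) (use finG0 D_def in simp)
  then have c: "card ((\<lambda>e. e - X) ` G0 - (\<lambda>e. e - X) ` G) \<le> fur r s * card V ^ (r - 2)"
    using cD by linarith
  have "\<forall>e\<in>G. \<forall>e'\<in>G0. e' - X = e - X \<longrightarrow> e' \<in> G"
    using good[of _ None] unfolding bad_def by auto
  moreover have "kernel s G S" if "e \<in> G" "e \<inter> X \<subseteq> S" "S \<subseteq> e" "2 \<le> b \<or> card S = 1" for e S
    using good[OF that(1), of "Some S"] that unfolding bad_def by auto
  ultimately have "cleaned X s b G0 G" using G unfolding cleaned_def by simp
  then show ?thesis using c by blast
qed

text \<open>When a path is continued, the sets of size \<open>b\<close> occur as odd blocks and those of size \<open>a + 1\<close> as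
  even blocks together with the next centre.\<close>
definition clean_fam :: "'a set set \<Rightarrow> 'a set \<Rightarrow> nat \<Rightarrow> nat \<Rightarrow> nat \<Rightarrow> nat \<Rightarrow> bool" where
  "clean_fam G X \<kappa> s a b \<longleftrightarrow> (\<forall>e\<in>G. finite e \<and> card e = a + b \<and> (\<exists>v. e \<inter> X = {v})) \<and>
     (\<forall>e\<in>G. \<forall>W. finite W \<and> card W < \<kappa> \<longrightarrow> (\<exists>v\<in>X - W. insert v (e - X) \<in> G)) \<and>
     (\<forall>e\<in>G. \<forall>S. e \<inter> X \<subseteq> S \<longrightarrow> S \<subseteq> e \<longrightarrow> card S = b \<or> card S = a + 1 \<longrightarrow> kernel s G S)"

lemma clean_famD:
  assumes "clean_fam G X \<kappa> s a b" "e \<in> G"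
  shows "finite e" "card e = a + b" "\<exists>v. e \<inter> X = {v}"
    "finite W \<Longrightarrow> card W < \<kappa> \<Longrightarrow> \<exists>v\<in>X - W. insert v (e - X) \<in> G"
    "e \<inter> X \<subseteq> S \<Longrightarrow> S \<subseteq> e \<Longrightarrow> card S = b \<or> card S = a + 1 \<Longrightarrow> kernel s G S"
proof -
  show "kernel s G S" if "e \<inter> X \<subseteq> S" "S \<subseteq> e" "card S = b \<or> card S = a + 1"
  proof -
    have "\<forall>e\<in>G. \<forall>S. e \<inter> X \<subseteq> S \<longrightarrow> S \<subseteq> e \<longrightarrow> card S = b \<or> card S = a + 1 \<longrightarrow> kernel s G S"
      using assms(1) unfolding clean_fam_def by (elim conjE)
    from this[rule_format, OF assms(2) that] show ?thesis .
  qed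
qed (use assms in \<open>simp_all add: clean_fam_def\<close>)

text \<open>The odd block \<open>Bl m\<close> holds the centre of its edge, so it is a kernel of
  size \<open>b\<close>. The new edge has only one vertex in \<open>X\<close>, the same centre,
  hence the fresh block has none.\<close>

lemma walk_A:
  assumes G: "clean_fam G X \<kappa> s a b" "G \<subseteq> E" and p: "path_in E m a b Bl" "odd m"
    and e: "e \<in> G" "Bl m \<subseteq> e" "e \<inter> X \<subseteq> Bl m" and U: "finite U" "card U + (m + 1) * (a + b) \<le> s"
  shows "\<exists>A. path_in E (Suc m) a b (Bl(Suc m := A)) \<and> Bl m \<union> A \<in> G \<and> A \<inter> X = {} \<and> A \<inter> U = {}"
proof -
  have Bm: "finite (Bl m)" "card (Bl m) = b" using p by (auto simp: path_in_def)
  have ker: "kernel s G (Bl m)" using G e Bm unfolding clean_fam_def by blast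
  let ?W = "(\<Union>i\<le>m. Bl i) \<union> U"
  have "card ?W \<le> s" using card_Un_le[of "\<Union>i\<le>m. Bl i" U] path_in_Union(2)[OF p(1)] U(2) by linarith
  moreover have "finite ?W" using path_in_Union(1)[OF p(1)] U(1) by simp
  ultimately obtain e' where e': "e' \<in> G" "Bl m \<subseteq> e'" "(e' - Bl m) \<inter> ?W = {}" using kernelE[OF ker] by metis
  define A where "A = e' - Bl m"
  have fe': "finite e'" "card e' = a + b" using G(1) e'(1) by (auto simp: clean_fam_def)
  have un: "Bl m \<union> A = e'" using e'(2) by (auto simp: A_def)
  have "path_in E (Suc m) a b (Bl(Suc m := A))"
  proof (rule path_in_Suc[OF p(1)])
    show "finite A" "card A = (if even (Suc m) then a else b)"
      using fe' Bm e'(2) p(2) by (simp_all add: A_def card_Diff_subset)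
    show "A \<inter> (\<Union>i\<le>m. Bl i) = {}" using e'(3) unfolding A_def by blast
    show "Bl m \<union> A \<in> E" using un e'(1) G(2) by blast
  qed
  moreover have "A \<inter> X = {}"
  proof -
    obtain v w where vw: "e \<inter> X = {v}" "e' \<inter> X = {w}"
      using clean_famD(3)[OF G(1) e(1)] clean_famD(3)[OF G(1) e'(1)] by metis
    have "v \<in> X" "v \<in> Bl m" using vw(1) e(3) by auto
    moreover from this have "v = w" using vw(2) e'(2) by (metis IntI singletonD subsetD)
    ultimately show ?thesis using vw(2) unfolding A_def by auto
  qed
  moreover have "A \<inter> U = {}" using e'(3) unfolding A_def by blast
  ultimately show ?thesis using un e'(1) by blast
qed

lemma walk_B:
  assumes G: "clean_fam G X \<kappa> s a b" "G \<subseteq> E" and p: "path_in E m a b Bl" "even m"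
    and e: "e \<in> G" "Bl m \<subseteq> e" "Bl m \<inter> X = {}" and U: "finite U" "card U + (m + 1) * (a + b) \<le> s" "U \<inter> X = {}"
    and k: "card ((\<Union>i\<le>m. Bl i) \<inter> X) < \<kappa>"
  shows "\<exists>B v. path_in E (Suc m) a b (Bl(Suc m := B)) \<and> Bl m \<union> B \<in> G \<and> B \<inter> X = {v} \<and> B \<inter> U = {}"
proof -
  have Am: "finite (Bl m)" "card (Bl m) = a" using p by (auto simp: path_in_def)
  let ?P = "\<Union>i\<le>m. Bl i"
  have fP: "finite (?P \<inter> X)" using path_in_Union(1)[OF p(1)] by simp
  obtain v where v: "v \<in> X - (?P \<inter> X)" "insert v (e - X) \<in> G"
    using G(1) e(1) fP k unfolding clean_fam_def by meson
  let ?e = "insert v (e - X)" and ?S = "insert v (Bl m)"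
  have eX: "?e \<inter> X = {v}" using v by auto
  have "card ?S = a + 1" using Am v e(3) by auto
  moreover have "?e \<inter> X \<subseteq> ?S" "?S \<subseteq> ?e" using eX e by auto
  ultimately have ker: "kernel s G ?S" using G(1) v(2) unfolding clean_fam_def by blast
  let ?W = "?P \<union> U"
  have "card ?W \<le> s" using card_Un_le[of ?P U] path_in_Union(2)[OF p(1)] U(2) by linarith
  moreover have "finite ?W" using path_in_Union(1)[OF p(1)] U(1) by simp
  ultimately obtain e' where e': "e' \<in> G" "?S \<subseteq> e'" "(e' - ?S) \<inter> ?W = {}" using kernelE[OF ker] by metis
  define B where "B = e' - Bl m"
  have fe': "finite e'" "card e' = a + b" using G(1) e'(1) by (auto simp: clean_fam_def)
  have un: "Bl m \<union> B = e'" using e'(2) by (auto simp: B_def)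
  have vB: "v \<notin> ?P" "v \<notin> U" "v \<in> X" using v(1) U(3) by auto
  have BW: "B \<subseteq> insert v (e' - ?S)" unfolding B_def by blast
  have "path_in E (Suc m) a b (Bl(Suc m := B))"
  proof (rule path_in_Suc[OF p(1)])
    show "finite B" "card B = (if even (Suc m) then a else b)"
      using fe' Am e'(2) p(2) by (simp_all add: B_def card_Diff_subset)
    show "B \<inter> ?P = {}" using e'(3) BW vB(1) by blast
    show "Bl m \<union> B \<in> E" using un e'(1) G(2) by blast
  qed
  moreover have "B \<inter> X = {v}"
  proof -
    obtain w where w: "e' \<inter> X = {w}" using clean_famD(3)[OF G(1) e'(1)] by metis
    have "v \<in> e'" using e'(2) by simp
    then have "w = v" using w vB(3) by (metis IntI singletonD)
    moreover have "v \<in> B" using vB(3) \<open>v \<in> e'\<close> e(3) unfolding B_def by auto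
    ultimately show ?thesis using w unfolding B_def by auto
  qed
  moreover have "B \<inter> U = {}" using e'(3) BW vB(2) by blast
  ultimately show ?thesis using un e'(1) by blast
qed

lemma UN_atMost_Suc_upd: "(\<Union>i\<le>Suc m. (Bl(Suc m := B)) i) = (\<Union>i\<le>m. Bl i) \<union> B"
  by (auto simp: le_Suc_eq)

lemma walk_AB:
  assumes G: "clean_fam G X \<kappa> s a b" "G \<subseteq> E" and p: "path_in E m a b Bl" "odd m"
    and e: "e \<in> G" "Bl m \<subseteq> e" "e \<inter> X \<subseteq> Bl m" and U: "finite U" "card U + (m + 2) * (a + b) \<le> s" "U \<inter> X = {}"
    and k: "card ((\<Union>i\<le>m. Bl i) \<inter> X) < \<kappa>"
  shows "\<exists>Bl' e'. path_in E (m + 2) a b Bl' \<and> (\<forall>i\<le>m. Bl' i = Bl i) \<and> e' \<in> G \<and> Bl' (m + 2) \<subseteq> e' \<and>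
     e' \<inter> X \<subseteq> Bl' (m + 2) \<and> card ((\<Union>i\<le>m + 2. Bl' i) \<inter> X) \<le> card ((\<Union>i\<le>m. Bl i) \<inter> X) + 1 \<and>
     ((\<Union>i\<le>m + 2. Bl' i) \<inter> U \<subseteq> (\<Union>i\<le>m. Bl i))"
proof -
  have "card U + (m + 1) * (a + b) \<le> s" using U(2) by simp
  then obtain A where A: "path_in E (Suc m) a b (Bl(Suc m := A))" "Bl m \<union> A \<in> G" "A \<inter> X = {}" "A \<inter> U = {}"
    using walk_A[OF G p e U(1)] by blast
  let ?B1 = "Bl(Suc m := A)"
  have P1: "(\<Union>i\<le>Suc m. ?B1 i) = (\<Union>i\<le>m. Bl i) \<union> A" by (rule UN_atMost_Suc_upd)
  have X1: "(\<Union>i\<le>Suc m. ?B1 i) \<inter> X = (\<Union>i\<le>m. Bl i) \<inter> X" unfolding P1 using A(3) by blast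
  obtain B v where B: "path_in E (Suc (Suc m)) a b (?B1(Suc (Suc m) := B))" "?B1 (Suc m) \<union> B \<in> G" "B \<inter> X = {v}" "B \<inter> U = {}"
    using walk_B[OF G A(1) _ A(2), of U] p(2) A(3) U k X1 by auto
  let ?B2 = "?B1(Suc (Suc m) := B)"
  have P2: "(\<Union>i\<le>Suc (Suc m). ?B2 i) = (\<Union>i\<le>m. Bl i) \<union> A \<union> B" unfolding UN_atMost_Suc_upd P1 ..
  have "(\<Union>i\<le>Suc (Suc m). ?B2 i) \<inter> X = (\<Union>i\<le>m. Bl i) \<inter> X \<union> {v}"
    unfolding P2 using A(3) B(3) by blast
  then have c: "card ((\<Union>i\<le>Suc (Suc m). ?B2 i) \<inter> X) \<le> card ((\<Union>i\<le>m. Bl i) \<inter> X) + 1"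
    using card_Un_le[of "(\<Union>i\<le>m. Bl i) \<inter> X" "{v}"] by simp
  have "(\<Union>i\<le>Suc (Suc m). ?B2 i) \<inter> U \<subseteq> (\<Union>i\<le>m. Bl i)" unfolding P2 using A(4) B(4) by blast
  moreover have "(A \<union> B) \<inter> X \<subseteq> B" using A(3) by blast
  ultimately show ?thesis using B(1,2) c
    by (intro exI[of _ ?B2] exI[of _ "A \<union> B"]) (simp add: numeral_2_eq_2)
qed

text \<open>Each of the \<open>j\<close> double steps consumes one new centre, and a last step adds
  a block without centre. Avoiding \<open>U\<close> and keeping the old blocks allows a block
  reserved in \<open>U\<close> to be put in front of the finished path.\<close>

lemma walk:
  assumes G: "clean_fam G X \<kappa> s a b" "G \<subseteq> E" and p: "path_in E m a b Bl" "odd m"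
    and e: "e \<in> G" "Bl m \<subseteq> e" "e \<inter> X \<subseteq> Bl m" and U: "finite U" "card U + (m + 2 * j + 1) * (a + b) \<le> s" "U \<inter> X = {}"
    and k: "card ((\<Union>i\<le>m. Bl i) \<inter> X) + j \<le> \<kappa>"
  shows "\<exists>Bl'. path_in E (m + 2 * j + 1) a b Bl' \<and> (\<forall>i\<le>m. Bl' i = Bl i) \<and>
     card ((\<Union>i\<le>m + 2 * j + 1. Bl' i) \<inter> X) \<le> card ((\<Union>i\<le>m. Bl i) \<inter> X) + j \<and>
     ((\<Union>i\<le>m + 2 * j + 1. Bl' i) \<inter> U \<subseteq> (\<Union>i\<le>m. Bl i))"
  using p e U k
proof (induction j arbitrary: m Bl e)
  case 0
  then obtain A where A: "path_in E (Suc m) a b (Bl(Suc m := A))" "A \<inter> X = {}" "A \<inter> U = {}"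
    using walk_A[OF G, of m Bl e U] by auto
  let ?B = "Bl(Suc m := A)"
  have P: "(\<Union>i\<le>Suc m. ?B i) = (\<Union>i\<le>m. Bl i) \<union> A" by (rule UN_atMost_Suc_upd)
  have X1: "(\<Union>i\<le>Suc m. ?B i) \<inter> X = (\<Union>i\<le>m. Bl i) \<inter> X"
    and U1: "(\<Union>i\<le>Suc m. ?B i) \<inter> U \<subseteq> (\<Union>i\<le>m. Bl i)"
    unfolding P using A(2,3) by blast+
  have eq: "m + 2 * 0 + 1 = Suc m" by simp
  have agr: "\<forall>i\<le>m. ?B i = Bl i" by simp
  show ?case unfolding eq
    by (rule exI[of _ ?B], intro conjI, rule A(1), rule agr, unfold X1, simp, rule U1)
next
  case (Suc j)
  have "card U + (m + 2) * (a + b) \<le> card U + (m + 2 * Suc j + 1) * (a + b)" by (intro add_left_mono mult_le_mono1) simp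
  then have s': "card U + (m + 2) * (a + b) \<le> s" using Suc.prems(7) by linarith
  obtain Bl1 e1 where 1: "path_in E (m + 2) a b Bl1" "\<forall>i\<le>m. Bl1 i = Bl i" "e1 \<in> G" "Bl1 (m + 2) \<subseteq> e1"
     "e1 \<inter> X \<subseteq> Bl1 (m + 2)" "card ((\<Union>i\<le>m + 2. Bl1 i) \<inter> X) \<le> card ((\<Union>i\<le>m. Bl i) \<inter> X) + 1"
     "(\<Union>i\<le>m + 2. Bl1 i) \<inter> U \<subseteq> (\<Union>i\<le>m. Bl i)"
    using walk_AB[OF G Suc.prems(1-6) s' Suc.prems(8)] Suc.prems(9) by auto
  have o: "odd (m + 2)" using Suc.prems(2) by simp
  have m2: "m + 2 + 2 * j + 1 = m + 2 * Suc j + 1" by simp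
  have s2: "card U + (m + 2 + 2 * j + 1) * (a + b) \<le> s" unfolding m2 by (rule Suc.prems(7))
  have k2: "card ((\<Union>i\<le>m + 2. Bl1 i) \<inter> X) + j \<le> \<kappa>" using 1(6) Suc.prems(9) by linarith
  obtain Bl2 where 2: "path_in E (m + 2 + 2 * j + 1) a b Bl2" "\<forall>i\<le>m + 2. Bl2 i = Bl1 i"
     "card ((\<Union>i\<le>m + 2 + 2 * j + 1. Bl2 i) \<inter> X) \<le> card ((\<Union>i\<le>m + 2. Bl1 i) \<inter> X) + j"
     "(\<Union>i\<le>m + 2 + 2 * j + 1. Bl2 i) \<inter> U \<subseteq> (\<Union>i\<le>m + 2. Bl1 i)"
    using Suc.IH[OF 1(1) o 1(3,4,5) Suc.prems(6) s2 Suc.prems(8) k2] by blast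
  have "\<forall>i\<le>m. Bl2 i = Bl i" using 1(2) 2(2) by simp
  moreover have "(\<Union>i\<le>m + 2 + 2 * j + 1. Bl2 i) \<inter> U \<subseteq> (\<Union>i\<le>m. Bl i)"
  proof -
    have "(\<Union>i\<le>m + 2 + 2 * j + 1. Bl2 i) \<inter> U \<subseteq> (\<Union>i\<le>m + 2. Bl1 i) \<inter> U"
      by (intro Int_greatest 2(4) Int_lower2)
    then show ?thesis using 1(7) by (rule subset_trans)
  qed
  ultimately show ?case using 2(1,3) 1(6) unfolding m2 by (intro exI[of _ Bl2]) simp
qed

lemma clean_famI:
  assumes V: "finite V" and G: "G \<subseteq> ksub V (a + b)" and X: "\<And>e. e \<in> G \<Longrightarrow> \<exists>v. e \<inter> X = {v}"
    and N: "\<And>e. e \<in> G \<Longrightarrow> \<exists>N\<subseteq>X. \<kappa> \<le> card N \<and> (\<forall>v\<in>N. insert v (e - X) \<in> G)"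
    and ker: "\<And>e S. e \<in> G \<Longrightarrow> e \<inter> X \<subseteq> S \<Longrightarrow> S \<subseteq> e \<Longrightarrow> 2 \<le> b' \<or> card S = 1 \<Longrightarrow> kernel s G S"
    and b: "2 \<le> b' \<or> b = 1"
  shows "clean_fam G X \<kappa> s a b"
  unfolding clean_fam_def
proof (intro conjI ballI allI impI)
  fix e assume e: "e \<in> G"
  note ed = ksub_edge[OF V G e]
  show "finite e" "card e = a + b" by (rule ed)+
  show "\<exists>v. e \<inter> X = {v}" by (rule X[OF e])
  show "\<exists>v\<in>X - W. insert v (e - X) \<in> G" if W: "finite W \<and> card W < \<kappa>" for W
  proof -
    obtain N where N: "N \<subseteq> X" "\<kappa> \<le> card N" "\<forall>v\<in>N. insert v (e - X) \<in> G" using N[OF e] by blast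
    have "\<not> N \<subseteq> W" using card_mono[of W N] W N(2) by auto
    then show ?thesis using N by blast
  qed
  show "kernel s G S" if "e \<inter> X \<subseteq> S" "S \<subseteq> e" "card S = b \<or> card S = a + 1" for S
  proof (cases "2 \<le> b' \<or> card S = 1")
    case True
    then show ?thesis using ker e that by blast
  next
    case False
    \<comment> \<open>Here \<open>b = 1\<close> and \<open>card S \<noteq> 1\<close>, so
      \<open>card S = a + 1\<close> is the full size of an edge.\<close>
    then have "card S = card e" using that(3) b ed by auto
    then have "S = e" using that(2) ed(1) by (simp add: card_subset_eq)
    then show ?thesis using kernel_self[OF e] by simp
  qed
qed

text \<open>A centre serves two consecutive edges. The first step attaches a centre to
  \<open>A\<close>; the other \<open>\<kappa> - 1\<close> double steps and the closing block give
  \<open>1 + 2 * (\<kappa> - 1) + 1\<close> edges in all.\<close>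

lemma walk_start:
  assumes G: "clean_fam G X \<kappa> s a b" "G \<subseteq> E" and k: "1 \<le> \<kappa>" and s: "(2 * \<kappa> + 1) * (a + b) \<le> s"
    and A: "A \<subseteq> e" "A \<inter> X = {}" "finite A" "card A = a" and e: "e \<in> G"
  shows "\<exists>Bl. path_in E (2 * \<kappa>) a b Bl \<and> Bl 0 = A \<and> card ((\<Union>i\<le>2 * \<kappa>. Bl i) \<inter> X) \<le> \<kappa>"
proof -
  have bound: "l * (a + b) \<le> s" if "l \<le> 2 * \<kappa> + 1" for l
    using mult_le_mono1[OF that, of "a + b"] s by linarith
  have p0: "path_in E 0 a b (\<lambda>_. A)" using A by (simp add: path_in_def)
  have ss: "card ({}::'a set) + (0 + 1) * (a + b) \<le> s" using bound[of 1] by simp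
  have X0: "card ((\<Union>i\<le>0::nat. A) \<inter> X) < \<kappa>" using A(2) k by simp
  obtain B v where B: "path_in E (Suc 0) a b ((\<lambda>_. A)(Suc 0 := B))" "A \<union> B \<in> G" "B \<inter> X = {v}"
    using walk_B[OF G p0 _ e A(1,2) finite.emptyI ss _ X0] by auto
  let ?B = "(\<lambda>_. A)(Suc 0 := B)"
  have uX: "(\<Union>i\<le>Suc 0. ?B i) \<inter> X = {v}" using A(2) B(3) by (auto simp: le_Suc_eq)
  then have c1: "card ((\<Union>i\<le>Suc 0. ?B i) \<inter> X) + (\<kappa> - 1) \<le> \<kappa>" using k by simp
  have s3: "card ({}::'a set) + (Suc 0 + 2 * (\<kappa> - 1) + 1) * (a + b) \<le> s"
    using bound[of "Suc 0 + 2 * (\<kappa> - 1) + 1"] k by simp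
  have AX': "(A \<union> B) \<inter> X \<subseteq> B" using A(2) by blast
  obtain Bl where Bl: "path_in E (Suc 0 + 2 * (\<kappa> - 1) + 1) a b Bl" "\<forall>i\<le>Suc 0. Bl i = ?B i"
    "card ((\<Union>i\<le>Suc 0 + 2 * (\<kappa> - 1) + 1. Bl i) \<inter> X) \<le> card ((\<Union>i\<le>Suc 0. ?B i) \<inter> X) + (\<kappa> - 1)"
    using walk[OF G B(1) _ B(2) _ _ _ s3 _ c1] AX' by auto
  have m: "Suc 0 + 2 * (\<kappa> - 1) + 1 = 2 * \<kappa>" using k by simp
  have "Bl 0 = A" using Bl(2) by simp
  then show ?thesis using Bl(1,3) c1 unfolding m by (intro exI[of _ Bl]) linarith
qed

text \<open>A path with at most \<open>2 * k\<close> edges has at most \<open>2 * k + 1\<close>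
  blocks; the surplus in \<open>2 * k + 5\<close> absorbs the vertices of an additional edge to be
  avoided.\<close>

lemma size_bounds:
  fixes k r s :: nat
  assumes "(2 * k + 5) * r \<le> s"
  shows "2 * r \<le> s" "(2 * k + 1) * r \<le> s" "(2 * k - 1 + 1) * r \<le> s"
proof -
  have "l * r \<le> s" if "l \<le> 2 * k + 5" for l
    using mult_le_mono1[OF that, of r] assms by linarith
  note * = this
  show "2 * r \<le> s" "(2 * k + 1) * r \<le> s" "(2 * k - 1 + 1) * r \<le> s" by (rule *, simp)+
qed

text \<open>The sizes \<open>a'\<close> and \<open>b'\<close> are left open because the centres lie
  in \<open>b\<close>-blocks in some walks, and in \<open>a\<close>-blocks when an edge avoiding all
  centres is to be attached.\<close>

definition star_cleaned ::
  "'a set set \<Rightarrow> 'a set \<Rightarrow> ('a set \<Rightarrow> 'a set) \<Rightarrow> nat \<Rightarrow> nat \<Rightarrow> nat \<Rightarrow> nat \<Rightarrow> 'a set set \<Rightarrow> 'a set set \<Rightarrow> bool" where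
  "star_cleaned H X N \<kappa> s r b F G \<longleftrightarrow> G \<subseteq> H \<and> (\<forall>f\<in>F. \<forall>v\<in>N f. insert v f \<in> G) \<and>
     (\<forall>a' b'. a' + b' = r \<longrightarrow> 2 \<le> b \<or> b' = 1 \<longrightarrow> clean_fam G X \<kappa> s a' b')"

lemma star_cleanedD:
  assumes "star_cleaned H X N \<kappa> s r b F G"
  shows "G \<subseteq> H" "f \<in> F \<Longrightarrow> v \<in> N f \<Longrightarrow> insert v f \<in> G"
    "a' + b' = r \<Longrightarrow> 2 \<le> b \<or> b' = 1 \<Longrightarrow> clean_fam G X \<kappa> s a' b'"
  using assms unfolding star_cleaned_def by auto

text \<open>The pairs of \<open>F\<close> and \<open>N\<close> become the family of all
  \<open>insert v f\<close>. Its traces outside \<open>X\<close> are exactly the members of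
  \<open>F\<close>, as \<open>\<kappa> \<ge> 1\<close>, so the loss in \<open>clean\<close> is a
  loss of members of \<open>F\<close>, and by the exchange clause a surviving \<open>f\<close> keeps
  the whole of \<open>N f\<close>.\<close>

lemma clean_star:
  assumes ab: "b < a" "1 \<le> b" "r = a + b" and s: "2 * r \<le> s" "(m + 1) * r \<le> s"
    and V: "finite V" and H: "H \<subseteq> ksub V r" and np: "\<not> has_path H m a b"
    and F: "\<And>f. f \<in> F \<Longrightarrow> f \<inter> X = {}" "\<And>f. f \<in> F \<Longrightarrow> N f \<subseteq> X" "\<And>f. f \<in> F \<Longrightarrow> card (N f) = \<kappa>" "1 \<le> \<kappa>"
    and FH: "\<And>f v. f \<in> F \<Longrightarrow> v \<in> N f \<Longrightarrow> insert v f \<in> H" and own: "\<And>f. f \<in> F \<Longrightarrow> \<not> kernel s H f"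
  shows "\<exists>F' G. F' \<subseteq> F \<and> card (F - F') \<le> fur r s * card V ^ (r - 2) \<and> star_cleaned H X N \<kappa> s r b F' G"
proof -
  define G0 where "G0 = (\<Union>f\<in>F. (\<lambda>v. insert v f) ` N f)"
  have G0: "insert v f \<in> H" "insert v f \<inter> X = {v}" "insert v f - X = f" "insert v f \<in> G0" if "f \<in> F" "v \<in> N f" for f v
    using FH[OF that] F(1,2)[OF that(1)] that by (auto simp: G0_def)
  have G0E: "\<exists>f\<in>F. \<exists>v\<in>N f. e = insert v f" if "e \<in> G0" for e using that unfolding G0_def by auto
  have G0H: "G0 \<subseteq> H"
  proof
    fix e assume "e \<in> G0"
    from G0E[OF this] obtain f v where "f \<in> F" "v \<in> N f" "e = insert v f" by metis
    then show "e \<in> H" using G0(1) by simp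
  qed
  have G0V: "G0 \<subseteq> ksub V r" using G0H H by blast
  have X0: "\<exists>v. e \<inter> X = {v}" if "e \<in> G0" for e using G0E[OF that] G0(2) by metis
  have own0: "\<not> kernel s G0 (e - X)" if e0: "e \<in> G0" for e
  proof -
    obtain f v where "f \<in> F" "v \<in> N f" "e = insert v f" using G0E[OF e0] by metis
    then have "\<not> kernel s H (e - X)" using G0(3) own by simp
    then show ?thesis using kernel_mono[OF _ G0H] by blast
  qed
  have np0: "\<not> has_path G0 m a b" using np has_path_mono[OF _ G0H] by blast
  obtain G where cl: "cleaned X s b G0 G"
    and cG: "card ((\<lambda>e. e - X) ` G0 - (\<lambda>e. e - X) ` G) \<le> fur r s * card V ^ (r - 2)"
    using clean[OF ab s V G0V np0 X0 own0] by blast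
  note G = cleanedD[OF cl]
  have GV: "G \<subseteq> ksub V r" using G(1) G0V by blast
  have G0F: "(\<lambda>e. e - X) ` G0 = F"
  proof
    show "(\<lambda>e. e - X) ` G0 \<subseteq> F"
    proof
      fix f assume "f \<in> (\<lambda>e. e - X) ` G0"
      then obtain e where "e \<in> G0" "f = e - X" by blast
      moreover obtain g v where "g \<in> F" "v \<in> N g" "e = insert v g" using G0E[OF \<open>e \<in> G0\<close>] by metis
      ultimately show "f \<in> F" using G0(3) by simp
    qed
    show "F \<subseteq> (\<lambda>e. e - X) ` G0"
    proof
      fix f assume f: "f \<in> F"
      have "N f \<noteq> {}" using F(3)[OF f] F(4) by auto
      then obtain v where v: "v \<in> N f" by blast
      then show "f \<in> (\<lambda>e. e - X) ` G0" using G0(3,4)[OF f v] by (metis image_eqI)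
    qed
  qed
  define F' where "F' = (\<lambda>e. e - X) ` G"
  have F'F: "F' \<subseteq> F" using G(1) G0F unfolding F'_def by blast
  have full: "insert v f \<in> G" if f: "f \<in> F'" and v: "v \<in> N f" for f v
  proof -
    obtain e where e: "e \<in> G" "f = e - X" using f unfolding F'_def by blast
    have "f \<in> F" using f F'F by blast
    then show ?thesis using G(2)[OF e(1) G0(4)] G0(3) v e(2) by metis
  qed
  have cf: "clean_fam G X \<kappa> s a' b'" if ab': "a' + b' = r" "2 \<le> b \<or> b' = 1" for a' b'
  proof (rule clean_famI[OF V _ _ _ _ ab'(2)])
    show "G \<subseteq> ksub V (a' + b')" using GV ab' by simp
    show "\<exists>v. e \<inter> X = {v}" if "e \<in> G" for e using that X0 G(1) by blast
    show "kernel s G S" if "e \<in> G" "e \<inter> X \<subseteq> S" "S \<subseteq> e" "2 \<le> b \<or> card S = 1" for e S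
      using G(3) that by blast
    fix e assume e: "e \<in> G"
    then have f: "e - X \<in> F'" by (simp add: F'_def)
    then have "e - X \<in> F" using F'F by blast
    then show "\<exists>N\<subseteq>X. \<kappa> \<le> card N \<and> (\<forall>v\<in>N. insert v (e - X) \<in> G)"
      using F(2,3) full[OF f] by (intro exI[of _ "N (e - X)"]) simp
  qed
  have "card (F - F') \<le> fur r s * card V ^ (r - 2)" using cG unfolding G0F F'_def .
  moreover have "star_cleaned H X N \<kappa> s r b F' G" using G(1) G0H full cf by (auto simp: star_cleaned_def)
  ultimately show ?thesis using F'F by blast
qed

section \<open>Sets with too many centres\<close>

definition nb :: "'a set set \<Rightarrow> ('a set \<Rightarrow> 'a) \<Rightarrow> 'a set \<Rightarrow> 'a set" where
  "nb E c f = {v. v \<notin> f \<and> insert v f \<in> E \<and> c (insert v f) = v}"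

text \<open>For a suitable two-colouring, a fixed share of the rich \<open>f\<close> lies in one
  colour class and \<open>k\<close> chosen centres of each in the other. If any of these
  \<open>f\<close> survived cleaning, \<open>k\<close> centres with two edges each would give a path
  with \<open>2 * k\<close> edges. So they are all among the \<open>O(n ^ (r - 2))\<close>
  losses.\<close>

lemma few_rich:
  assumes ab: "b < a" "1 \<le> b" "r = a + b" and k: "1 \<le> k" and s: "(2 * k + 5) * r \<le> s"
    and V: "finite V" and H: "H \<subseteq> ksub V r" and np: "\<not> has_path H (2 * k) a b"
    and E: "E \<subseteq> H" and own: "\<And>e. e \<in> E \<Longrightarrow> \<not> kernel s H (e - {c e})"
  shows "card {f\<in>ksub V (r - 1). k \<le> card (nb E c f)} \<le> 2 ^ (r - 1 + k) * (fur r s * card V ^ (r - 2))"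
proof -
  let ?F = "{f\<in>ksub V (r - 1). k \<le> card (nb E c f)}"
  note s2 = size_bounds[OF s]
  have "\<exists>N. N \<subseteq> nb E c f \<and> card N = k" if "f \<in> ?F" for f
    using obtain_subset_with_card_n[of k "nb E c f"] that by (metis (mono_tags, lifting) mem_Collect_eq)
  then obtain N where N: "\<And>f. f \<in> ?F \<Longrightarrow> N f \<subseteq> nb E c f \<and> card (N f) = k" by metis
  have f: "f \<subseteq> V" "finite f" "card f = r - 1" "N f \<subseteq> V" "N f \<inter> f = {}" if "f \<in> ?F" for f
  proof -
    show "f \<subseteq> V" "card f = r - 1" using that by (simp_all add: ksub_def)
    then show "finite f" using V finite_subset by blast
    show "N f \<inter> f = {}" using N[OF that] by (auto simp: nb_def)
    show "N f \<subseteq> V"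
    proof
      fix v assume "v \<in> N f"
      then have "insert v f \<in> H" using N[OF that] E by (auto simp: nb_def)
      then show "v \<in> V" using ksub_edge(3)[OF V H] by blast
    qed
  qed
  have "\<exists>\<chi>. card ?F \<le> 2 ^ (r - 1 + k) * card {f\<in>?F. \<forall>v\<in>f \<union> N f. \<chi> v = (if v \<in> f then 0 else 1::nat)}"
  proof (rule colouring_exists[OF V])
    show "f \<union> N f \<subseteq> V \<and> card (f \<union> N f) \<le> r - 1 + k" if "f \<in> ?F" for f
      using f[OF that] N[OF that] card_Un_le[of f "N f"] by auto
  qed (use V in auto)
  then obtain \<chi> where chi: "card ?F \<le> 2 ^ (r - 1 + k) * card {f\<in>?F. \<forall>v\<in>f \<union> N f. \<chi> v = (if v \<in> f then 0 else 1::nat)}"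
    by blast
  define F' where "F' = {f\<in>?F. \<forall>v\<in>f \<union> N f. \<chi> v = (if v \<in> f then 0 else 1::nat)}"
  define X where "X = {v. \<chi> v = 1}"
  have F'F: "f \<in> ?F" if "f \<in> F'" for f using that by (simp add: F'_def)
  have fX: "f \<inter> X = {}" "N f \<subseteq> X" if "f \<in> F'" for f
    using that f(5)[OF F'F[OF that]] unfolding F'_def X_def by auto
  have cN: "card (N f) = k" if "f \<in> F'" for f using N[OF F'F[OF that]] by simp
  have FH: "insert v f \<in> E \<and> c (insert v f) = v \<and> v \<notin> f" if "f \<in> F'" "v \<in> N f" for f v
    using N[OF F'F[OF that(1)]] that(2) by (auto simp: nb_def)
  have ownF: "\<not> kernel s H f" if f: "f \<in> F'" for f
  proof -
    have "N f \<noteq> {}" using cN[OF f] k by auto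
    then obtain v where "v \<in> N f" by blast
    then show ?thesis using own[of "insert v f"] FH[OF f, of v] by simp
  qed
  have FH': "insert v f \<in> H" if "f \<in> F'" "v \<in> N f" for f v using FH[OF that] E by blast
  have "\<exists>F'' G. F'' \<subseteq> F' \<and> card (F' - F'') \<le> fur r s * card V ^ (r - 2) \<and> star_cleaned H X N k s r b F'' G"
    by (rule clean_star[OF ab s2(1,2) V H np fX cN k FH' ownF])
  then obtain F'' G where F'': "F'' \<subseteq> F'" and cF: "card (F' - F'') \<le> fur r s * card V ^ (r - 2)"
    and sc: "star_cleaned H X N k s r b F'' G"
    by (elim exE conjE)
  have "2 \<le> b \<or> b = 1" using ab(2) by linarith
  then have cf: "clean_fam G X k s a b" by (rule star_cleanedD(3)[OF sc ab(3)[symmetric]])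
  have "F'' = {}"
  proof (rule ccontr)
    assume "F'' \<noteq> {}"
    then obtain f where fF: "f \<in> F''" by blast
    then have fF': "f \<in> F'" using F'' by blast
    have "N f \<noteq> {}" using cN[OF fF'] k by auto
    then obtain w where w: "w \<in> N f" by blast
    let ?e = "insert w f"
    have e: "?e \<in> G" by (rule star_cleanedD(2)[OF sc fF w])
    have "a \<le> card f" using f(3)[OF F'F[OF fF']] ab by simp
    then obtain A where A: "A \<subseteq> f" "card A = a" "finite A"
      by (rule obtain_subset_with_card_n)
    have "A \<subseteq> ?e" "A \<inter> X = {}" using A(1) fX(1)[OF fF'] by blast+
    then have "\<exists>Bl. path_in H (2 * k) a b Bl"
      using walk_start[OF cf star_cleanedD(1)[OF sc] k s2(2)[unfolded ab(3)] _ _ A(3,2) e] by blast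
    then show False using np unfolding has_path_def by simp
  qed
  then have "card F' \<le> fur r s * card V ^ (r - 2)" using cF by simp
  then have "2 ^ (r - 1 + k) * card F' \<le> 2 ^ (r - 1 + k) * (fur r s * card V ^ (r - 2))" by (rule mult_le_mono2)
  then show ?thesis using chi unfolding F'_def by linarith
qed

section \<open>The asymptotic bound\<close>

text \<open>The witness that \<open>f\<close> is not a kernel is a set of at most \<open>s\<close>
  vertices hitting every edge through \<open>f\<close> outside \<open>f\<close>, so it contains all
  centres of \<open>f\<close>.\<close>

lemma card_nb_le:
  assumes own: "\<And>e. e \<in> E \<Longrightarrow> \<not> kernel s H (e - {c e})" and E: "E \<subseteq> H"
  shows "card (nb E c f) \<le> s"
proof (cases "nb E c f = {}")
  case False
  then obtain v where v: "v \<notin> f" "insert v f \<in> E" "c (insert v f) = v" by (auto simp: nb_def)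
  then have "\<not> kernel s H f" using own[of "insert v f"] by simp
  then obtain U where U: "finite U" "card U \<le> s" "\<forall>e\<in>H. f \<subseteq> e \<longrightarrow> (e - f) \<inter> U \<noteq> {}"
    by (rule not_kernelE)
  have "nb E c f \<subseteq> U"
  proof
    fix w assume "w \<in> nb E c f"
    then have w: "w \<notin> f" "insert w f \<in> H" using E by (auto simp: nb_def)
    have "(insert w f - f) \<inter> U \<noteq> {}" using U(3)[rule_format, OF w(2)] by blast
    then show "w \<in> U" by blast
  qed
  then show ?thesis using U card_mono by (metis le_trans)
qed simp

text \<open>Each edge is counted at \<open>e - {c e}\<close>, so the numbers of centres sum to
  \<open>card E\<close>. Compared with \<open>k - 1\<close> for every \<open>f\<close>, a poor set
  saves at least one and a rich set costs at most \<open>s\<close>. With the savings kept on the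
  left, near equality bounds the number of poor sets.\<close>

lemma card_nb_count:
  assumes V: "finite V" and H: "H \<subseteq> ksub V r" and E: "E \<subseteq> H"
    and c: "\<And>e. e \<in> E \<Longrightarrow> c e \<in> e" and own: "\<And>e. e \<in> E \<Longrightarrow> \<not> kernel s H (e - {c e})"
  shows "card E + card {f\<in>ksub V (r - 1). card (nb E c f) < k - 1}
    \<le> (k - 1) * (card V choose (r - 1)) + s * card {f\<in>ksub V (r - 1). k \<le> card (nb E c f)}"
proof -
  let ?K = "ksub V (r - 1)"
  have finK: "finite ?K" using V by simp
  have finE: "finite E" using finite_ksub_subset[OF V H] E finite_subset by blast
  have im: "(\<lambda>e. e - {c e}) ` E \<subseteq> ?K"
    using ksub_remove[OF V, of _ r] c E H by blast
  have fib: "card {e\<in>E. e - {c e} = f} = card (nb E c f)" for f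
  proof (rule bij_betw_same_card[of c], rule bij_betwI[where g="\<lambda>v. insert v f"])
    show "c \<in> {e\<in>E. e - {c e} = f} \<rightarrow> nb E c f"
    proof
      fix e assume e: "e \<in> {e\<in>E. e - {c e} = f}"
      then have "insert (c e) f = e" using c by auto
      then show "c e \<in> nb E c f" using e by (auto simp: nb_def)
    qed
    show "(\<lambda>v. insert v f) \<in> nb E c f \<rightarrow> {e\<in>E. e - {c e} = f}" by (auto simp: nb_def)
    show "insert (c e) f = e" if "e \<in> {e\<in>E. e - {c e} = f}" for e using that c by auto
    show "c (insert v f) = v" if "v \<in> nb E c f" for v using that by (simp add: nb_def)
  qed
  have e1: "card E = (\<Sum>f\<in>?K. card (nb E c f))"
    using card_fibres[OF finE finK im] unfolding fib .
  have e2: "(k - 1) * (card V choose (r - 1)) = (\<Sum>f\<in>?K. k - 1)" using V by (simp add: card_ksub)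
  have "(\<Sum>f\<in>?K. card (nb E c f) + (if card (nb E c f) < k - 1 then 1 else 0))
      \<le> (\<Sum>f\<in>?K. (k - 1) + s * (if k \<le> card (nb E c f) then 1 else 0))"
  proof (rule sum_mono)
    fix f
    have "card (nb E c f) \<le> s" by (rule card_nb_le[OF own E])
    then show "card (nb E c f) + (if card (nb E c f) < k - 1 then 1 else 0) \<le> (k - 1) + s * (if k \<le> card (nb E c f) then 1 else 0)"
      by auto
  qed
  then show ?thesis
    unfolding e1 e2 card_filter_sum[OF finK] sum.distrib sum_distrib_left .
qed

definition centred :: "nat \<Rightarrow> 'a set set \<Rightarrow> 'a set set \<Rightarrow> ('a set \<Rightarrow> 'a) \<Rightarrow> bool" where
  "centred s H E c \<longleftrightarrow> E \<subseteq> H \<and> (\<forall>e\<in>E. c e \<in> e \<and> \<not> kernel s H (e - {c e}))"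

definition almost_regular ::
  "real \<Rightarrow> nat \<Rightarrow> nat \<Rightarrow> 'a set \<Rightarrow> 'a set set \<Rightarrow> 'a set set \<Rightarrow> ('a set \<Rightarrow> 'a) \<Rightarrow> bool" where
  "almost_regular \<epsilon> k r V H E c \<longleftrightarrow>
     real (card H) + real (card {f\<in>ksub V (r - 1). card (nb E c f) < k - 1})
       \<le> real ((k - 1) * (card V choose (r - 1))) + \<epsilon> * real (card V) ^ (r - 1) \<and>
     real (card {f\<in>ksub V (r - 1). k \<le> card (nb E c f)}) \<le> \<epsilon> * real (card V) ^ (r - 1)"

text \<open>An edge without a possible centre has only kernels as \<open>(r-1)\<close>-subsets, and
  \<open>few_full_edges\<close> makes such edges rare. The remaining ones receive centres and are
  counted by \<open>card_nb_count\<close>.\<close>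

lemma path_free_structure:
  fixes a b r k :: nat and \<epsilon> :: real
  assumes ab: "b < a" "1 \<le> b" "r = a + b" and k: "1 \<le> k" and eps: "0 < \<epsilon>"
  shows "\<exists>s n0. (2 * k + 5) * r \<le> s \<and> (\<forall>(V::'a set) H. finite V \<longrightarrow> n0 \<le> card V \<longrightarrow> H \<subseteq> ksub V r \<longrightarrow> \<not> has_path H (2 * k) a b \<longrightarrow>
     (\<exists>E c. centred s H E c \<and> almost_regular \<epsilon> k r V H E c))"
proof -
  define s0 where "s0 = (2 * k + 5) * r"
  define A where "A = fur r s0 * (r * fur r s0)"
  \<comment> \<open>\<open>s\<close> is chosen so that at most
    \<open>\<epsilon> / 2 * n ^ (r - 1)\<close> edges lack a centre. Only then \<open>n0\<close> is
    chosen, because one factor \<open>n\<close> has to absorb the cost \<open>s\<close> of each rich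
    set.\<close>
  obtain s1 :: nat where s1: "2 * real A / \<epsilon> < real s1" using reals_Archimedean2 by blast
  define s where "s = max s0 (s1 + 1)"
  have s: "s0 \<le> s" "0 < s" "2 * real A / \<epsilon> < real s" using s1 by (auto simp: s_def)
  define B where "B = 2 ^ (r - 1 + k) * fur r s"
  obtain n0 :: nat where n0: "2 * (real s * real B) / \<epsilon> < real n0" using reals_Archimedean2 by blast
  note s2 = size_bounds(1,2)[OF eq_refl[OF s0_def[symmetric]]]
  have main: "\<exists>E c. centred s H E c \<and> almost_regular \<epsilon> k r V H E c"
    if V: "finite V" and n: "n0 \<le> card V" and H: "H \<subseteq> ksub V r" and np: "\<not> has_path H (2 * k) a b"
    for V :: "'a set" and H
  proof -
    let ?n = "real (card V)"
    define Fu where "Fu = {e\<in>H. \<forall>v\<in>e. kernel s H (e - {v})}"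
    define E where "E = H - Fu"
    have "\<exists>v. v \<in> e \<and> \<not> kernel s H (e - {v})" if "e \<in> E" for e using that by (auto simp: E_def Fu_def)
    then obtain c where c: "\<And>e. e \<in> E \<Longrightarrow> c e \<in> e \<and> \<not> kernel s H (e - {c e})" by metis
    have EH: "E \<subseteq> H" by (auto simp: E_def)
    have finH: "finite H" by (rule finite_ksub_subset[OF V H])
    have a1: "1 \<le> a" using ab by simp
    have "card Fu * s \<le> fur r s0 * (r * (fur r s0 * card V ^ (r - 1)))"
      unfolding Fu_def by (rule few_full_edges[OF a1 ab(2,3) s2 V H np])
    then have "card Fu * s \<le> A * card V ^ (r - 1)" by (simp add: A_def mult_ac)
    then have "real (card Fu * s) \<le> real (A * card V ^ (r - 1))" by (rule of_nat_mono)
    then have f1: "real (card Fu) * real s \<le> real A * ?n ^ (r - 1)" by simp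
    have "real A \<le> \<epsilon> / 2 * real s" using s(3) eps by (simp add: field_simps)
    then have "real A * ?n ^ (r - 1) \<le> \<epsilon> / 2 * real s * ?n ^ (r - 1)" by (intro mult_right_mono) auto
    then have "real (card Fu) * real s \<le> (\<epsilon> / 2 * ?n ^ (r - 1)) * real s" using f1 by (simp add: mult_ac)
    then have Fu: "real (card Fu) \<le> \<epsilon> / 2 * ?n ^ (r - 1)" using s(2) by simp
    let ?rich = "{f\<in>ksub V (r - 1). k \<le> card (nb E c f)}"
    have sk: "(2 * k + 5) * r \<le> s" using s(1) by (simp add: s0_def)
    have "card ?rich \<le> 2 ^ (r - 1 + k) * (fur r s * card V ^ (r - 2))"
      by (rule few_rich[OF ab k sk V H np EH]) (use c in blast)
    then have "card ?rich \<le> B * card V ^ (r - 2)" by (simp add: B_def mult_ac)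
    then have "real (s * card ?rich) \<le> real (s * (B * card V ^ (r - 2)))" by (intro of_nat_mono mult_le_mono2)
    then have r1: "real s * real (card ?rich) \<le> real s * real B * ?n ^ (r - 2)" by (simp add: mult_ac)
    have "2 * (real s * real B) / \<epsilon> \<le> ?n" using n0 n by linarith
    then have "real s * real B \<le> \<epsilon> / 2 * ?n" using eps by (simp add: field_simps)
    then have "real s * real B * ?n ^ (r - 2) \<le> \<epsilon> / 2 * ?n * ?n ^ (r - 2)" by (intro mult_right_mono) auto
    also have "\<dots> = \<epsilon> / 2 * ?n ^ (Suc (r - 2))" by simp
    also have "Suc (r - 2) = r - 1" using ab by simp
    finally have r2: "real s * real (card ?rich) \<le> \<epsilon> / 2 * ?n ^ (r - 1)" using r1 by linarith
    have "real (card ?rich) \<le> real s * real (card ?rich)" using s(2) by (simp add: mult_le_cancel_right1)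
    moreover have nn: "0 \<le> \<epsilon> * ?n ^ (r - 1)" using eps by simp
    ultimately have rich: "real (card ?rich) \<le> \<epsilon> * ?n ^ (r - 1)" using r2 by linarith
    have "card E + card {f\<in>ksub V (r - 1). card (nb E c f) < k - 1}
        \<le> (k - 1) * (card V choose (r - 1)) + s * card ?rich"
      by (rule card_nb_count[OF V H EH]) (use c in blast)+
    then have "real (card E + card {f\<in>ksub V (r - 1). card (nb E c f) < k - 1})
        \<le> real ((k - 1) * (card V choose (r - 1)) + s * card ?rich)" by (rule of_nat_mono)
    then have cE: "real (card E) + real (card {f\<in>ksub V (r - 1). card (nb E c f) < k - 1})
        \<le> real ((k - 1) * (card V choose (r - 1))) + \<epsilon> / 2 * ?n ^ (r - 1)" using r2 by simp
    have "card H = card E + card Fu"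
      unfolding E_def using finH by (subst card_Diff_subset) (auto simp: Fu_def card_mono)
    then have "real (card H) + real (card {f\<in>ksub V (r - 1). card (nb E c f) < k - 1})
        \<le> real ((k - 1) * (card V choose (r - 1))) + \<epsilon> * ?n ^ (r - 1)" using cE Fu by simp
    moreover have "centred s H E c" using c EH by (simp add: centred_def)
    ultimately show ?thesis using rich unfolding almost_regular_def by (intro exI[of _ E] exI[of _ c] conjI)
  qed
  show ?thesis
  proof (rule exI[of _ s], rule exI[of _ n0], intro conjI allI impI)
    show "(2 * k + 5) * r \<le> s" using s(1) by (simp add: s0_def)
  qed (rule main)
qed

section \<open>Copies of the path, the star construction and the asymptotics of
  \<open>ex\<close>\<close>

lemma is_rgraph_ksub: "is_rgraph r H \<longleftrightarrow> finite (verts H) \<and> edges H \<subseteq> ksub (verts H) r"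
  by (auto simp: is_rgraph_def ksub_def)

lemma contains_ab_path:
  assumes H: "is_rgraph r H" and m: "1 \<le> m"
  shows "contains_copy H (ab_path m a b) \<longleftrightarrow> has_path (edges H) m a b"
proof
  assume "contains_copy H (ab_path m a b)"
  then obtain f where f: "inj_on f (\<Union>i\<le>m. block a b i)"
    "\<And>i. i < m \<Longrightarrow> f ` (block a b i \<union> block a b (Suc i)) \<in> edges H"
    unfolding contains_copy_def ab_path_def by auto
  have "path_in (edges H) m a b (\<lambda>i. f ` block a b i)"
    unfolding path_in_def
  proof (intro conjI allI impI)
    fix i assume "i \<le> m"
    then have inj: "inj_on f (block a b i)" using f(1) by (meson UN_upper atMost_iff inj_on_subset)
    show "finite (f ` block a b i)" by (simp add: block_def)
    show "card (f ` block a b i) = (if even i then a else b)"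
      unfolding card_image[OF inj] by (simp add: block_def)
  next
    fix i j assume ij: "i \<le> m" "j \<le> m" "i \<noteq> j"
    have "f ` block a b i \<inter> f ` block a b j = f ` (block a b i \<inter> block a b j)"
      by (rule inj_on_image_Int[OF f(1), symmetric]) (use ij in blast)+
    also have "block a b i \<inter> block a b j = {}" using ij by (auto simp: block_def)
    finally show "f ` block a b i \<inter> f ` block a b j = {}" by simp
  next
    fix i assume "i < m"
    then show "f ` block a b i \<union> f ` block a b (Suc i) \<in> edges H" using f(2)[of i] by (simp add: image_Un)
  qed
  then show "has_path (edges H) m a b" unfolding has_path_def by blast
next
  assume "has_path (edges H) m a b"
  then obtain Bl where Bl: "path_in (edges H) m a b Bl" unfolding has_path_def by blast
  have B: "\<And>i. i \<le> m \<Longrightarrow> finite (Bl i)" "\<And>i. i \<le> m \<Longrightarrow> card (Bl i) = (if even i then a else b)"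
    "\<And>i j. i \<le> m \<Longrightarrow> j \<le> m \<Longrightarrow> i \<noteq> j \<Longrightarrow> Bl i \<inter> Bl j = {}" "\<And>i. i < m \<Longrightarrow> Bl i \<union> Bl (Suc i) \<in> edges H"
    using Bl unfolding path_in_def by simp_all
  have "\<exists>h. bij_betw h {..<(if even i then a else b)} (Bl i)" if "i \<le> m" for i
    using ex_bij_betw_nat_finite[OF B(1)[OF that]] B(2)[OF that] by (simp add: atLeast0LessThan)
  then obtain h where h: "\<And>i. i \<le> m \<Longrightarrow> bij_betw (h i) {..<(if even i then a else b)} (Bl i)" by metis
  define f where "f p = h (fst p) (snd p)" for p
  have img: "f ` block a b i = Bl i" if "i \<le> m" for i
  proof -
    have "f ` block a b i = h i ` {..<(if even i then a else b)}" unfolding block_def f_def by force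
    then show ?thesis using h[OF that] by (simp add: bij_betw_def)
  qed
  have inj: "inj_on f (\<Union>i\<le>m. block a b i)"
  proof (rule inj_onI)
    fix p q assume pq: "p \<in> (\<Union>i\<le>m. block a b i)" "q \<in> (\<Union>i\<le>m. block a b i)" "f p = f q"
    obtain i j where ij: "i \<le> m" "p \<in> block a b i" "j \<le> m" "q \<in> block a b j" using pq by blast
    have "f p \<in> Bl i" "f p \<in> Bl j" using ij img pq(3) by (metis image_eqI)+
    then have "i = j" using B(3)[OF ij(1,3)] by blast
    then have "fst p = i" "fst q = i" "snd p < (if even i then a else b)" "snd q < (if even i then a else b)"
      using ij by (auto simp: block_def)
    moreover from this have "snd p = snd q"
      using h[OF ij(1)] pq(3) unfolding f_def bij_betw_def inj_on_def by simp
    ultimately show "p = q" by (simp add: prod_eq_iff)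
  qed
  have sub: "Bl i \<subseteq> verts H" if "i \<le> m" for i
  proof (cases "i < m")
    case True
    then show ?thesis using B(4)[OF True] H unfolding is_rgraph_def by blast
  next
    case False
    \<comment> \<open>The last block is not the first half of any edge; since
      \<open>m \<ge> 1\<close>, it is the second half of the edge with index
      \<open>m - 1\<close>.\<close>
    then have "m - 1 < m" "Suc (m - 1) = i" using that m by auto
    then show ?thesis using B(4)[of "m - 1"] H unfolding is_rgraph_def by auto
  qed
  have "f ` (\<Union>i\<le>m. block a b i) \<subseteq> verts H" using sub img by (auto simp: image_UN)
  moreover have "\<forall>e\<in>(\<lambda>i. block a b i \<union> block a b (Suc i)) ` {..<m}. f ` e \<in> edges H"
    using B(4) img by (auto simp: image_Un)
  ultimately show "contains_copy H (ab_path m a b)"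
    using inj unfolding contains_copy_def ab_path_def by (intro exI[of _ f]) simp
qed

lemma free_rgraphs_ab_path:
  assumes "1 \<le> m"
  shows "H \<in> free_rgraphs r n (ab_path m a b) \<longleftrightarrow>
    finite (verts H) \<and> edges H \<subseteq> ksub (verts H) r \<and> card (verts H) = n \<and> \<not> has_path (edges H) m a b"
  using contains_ab_path[OF _ assms] by (auto simp: free_rgraphs_def is_rgraph_ksub)

lemma ab_path_edges_ne: "1 \<le> m \<Longrightarrow> edges (ab_path m a b) \<noteq> {}"
  by (auto simp: ab_path_def lessThan_empty_iff)

lemma ex_attained:
  assumes "1 \<le> m"
  shows "\<exists>H\<in>free_rgraphs r n (ab_path m a b). card (edges H) = ex r n (ab_path m a b)"
proof -
  have "ex r n (ab_path m a b) \<in> (\<lambda>H. card (edges H)) ` free_rgraphs r n (ab_path m a b)"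
    unfolding ex_def using free_rgraphs_nonempty[OF ab_path_edges_ne[OF assms]] finite_ex_set
    by (intro Max_in) auto
  then show ?thesis by fastforce
qed

lemma ex_ge: "H \<in> free_rgraphs r n F \<Longrightarrow> card (edges H) \<le> ex r n F"
  unfolding ex_def using finite_ex_set by (intro Max_ge) auto

text \<open>The edges with even index \<open>0, 2, ..., 2 * k - 2\<close> form a matching of size
  \<open>k\<close>, and each needs a vertex of its own among the \<open>k - 1\<close>
  centres.\<close>

lemma Psi_path_free: "\<not> has_path (edges (Psi (k - 1) n r)) (2 * k - 1) a b" if k: "1 \<le> k"
proof
  assume "has_path (edges (Psi (k - 1) n r)) (2 * k - 1) a b"
  then obtain Bl where Bl: "path_in (edges (Psi (k - 1) n r)) (2 * k - 1) a b Bl" unfolding has_path_def by blast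
  have "\<exists>x. x \<in> (Bl (2 * i) \<union> Bl (Suc (2 * i))) \<inter> {1..k - 1}" if "i < k" for i
  proof -
    have "2 * i < 2 * k - 1" using that by simp
    then have "Bl (2 * i) \<union> Bl (Suc (2 * i)) \<in> edges (Psi (k - 1) n r)" using Bl unfolding path_in_def by blast
    then show ?thesis unfolding Psi_def by auto
  qed
  then obtain x where x: "\<And>i. i < k \<Longrightarrow> x i \<in> (Bl (2 * i) \<union> Bl (Suc (2 * i))) \<inter> {1..k - 1}" by metis
  have "inj_on x {..<k}"
  proof (rule inj_onI, rule ccontr)
    fix i j assume ij: "i \<in> {..<k}" "j \<in> {..<k}" "x i = x j" "i \<noteq> j"
    obtain p where p: "p = 2 * i \<or> p = Suc (2 * i)" "x i \<in> Bl p" using x[of i] ij by blast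
    obtain q where q: "q = 2 * j \<or> q = Suc (2 * j)" "x j \<in> Bl q" using x[of j] ij by blast
    have "p \<noteq> q" using p(1) q(1) ij(4) by presburger
    moreover have "p \<le> 2 * k - 1" "q \<le> 2 * k - 1" using p(1) q(1) ij by auto
    ultimately have "Bl p \<inter> Bl q = {}" using Bl unfolding path_in_def by blast
    then show False using p(2) q(2) ij(3) by auto
  qed
  moreover have "x ` {..<k} \<subseteq> {1..k - 1}" using x by blast
  ultimately have "card {..<k} \<le> card {1..k - 1}" by (intro card_inj_on_le) auto
  then show False using k by simp
qed

lemma Psi_free:
  assumes k: "2 \<le> k" and m: "2 * k - 1 \<le> m"
  shows "Psi (k - 1) n r \<in> free_rgraphs r n (ab_path m a b)"
proof -
  have "\<not> has_path (edges (Psi (k - 1) n r)) m a b"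
    using Psi_path_free[of k n r a b] has_path_prefix[OF _ m] k by auto
  then show ?thesis using k m by (subst free_rgraphs_ab_path) (auto simp: Psi_def ksub_def)
qed

lemma choose_diff_le: "(n choose Suc t) \<le> ((n - c) choose Suc t) + c * n ^ t"
proof (induction c)
  case (Suc c)
  show ?case
  proof (cases "c < n")
    case True
    then obtain p where p: "n - c = Suc p" "p = n - Suc c" by (metis Suc_diff_Suc)
    have "(p choose t) \<le> p ^ t" by (rule choose_le_power)
    also have "\<dots> \<le> n ^ t" using p by (intro power_mono) auto
    finally have "(n - c choose Suc t) \<le> (p choose Suc t) + n ^ t" unfolding p(1) by simp
    then show ?thesis using Suc.IH p(2) by simp
  next
    case False
    then have "n - Suc c = n - c" by simp
    then show ?thesis using Suc.IH by simp
  qed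
qed simp

text \<open>Only edges with exactly one vertex in \<open>{1..c}\<close> are counted; the remaining
  ones are of lower order.\<close>

lemma card_Psi_ge:
  assumes "r = Suc t" "c \<le> n"
  shows "c * ((n - c) choose t) \<le> card (edges (Psi c n r))"
proof -
  let ?g = "\<lambda>(i, g). insert i g"
  have "inj_on ?g ({1..c} \<times> ksub {c + 1..n} t)"
  proof (rule inj_onI, clarify)
    fix i g j h assume *: "i \<in> {1..c}" "g \<in> ksub {c + 1..n} t" "j \<in> {1..c}" "h \<in> ksub {c + 1..n} t" "insert i g = insert j h"
    have "insert i g \<inter> {1..c} = {i}" "insert j h \<inter> {1..c} = {j}" "insert i g - {1..c} = g" "insert j h - {1..c} = h"
      using *(1-4) by (auto simp: ksub_def)
    then show "i = j \<and> g = h" using *(5) by (metis singleton_inject)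
  qed
  moreover have "?g ` ({1..c} \<times> ksub {c + 1..n} t) \<subseteq> edges (Psi c n r)"
  proof (clarify)
    fix i g assume *: "i \<in> {1..c}" "g \<in> ksub {c + 1..n} t"
    then have "finite g" using finite_subset by (auto simp: ksub_def)
    moreover have "i \<notin> g" using * by (auto simp: ksub_def)
    ultimately have "card (insert i g) = r" using * assms by (simp add: ksub_def)
    then show "insert i g \<in> edges (Psi c n r)" using * assms(2) by (auto simp: Psi_def ksub_def)
  qed
  moreover have "finite (edges (Psi c n r))" by (simp add: Psi_def)
  ultimately have "card ({1..c} \<times> ksub {c + 1..n} t) \<le> card (edges (Psi c n r))"
    by (rule card_inj_on_le)
  then show ?thesis by (simp add: card_cartesian_product card_ksub)
qed

lemma eventually_power_le:
  fixes C \<epsilon> :: real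
  assumes "0 < \<epsilon>"
  shows "\<exists>n0. \<forall>n\<ge>n0. C * real n ^ t \<le> \<epsilon> * real n ^ Suc t"
proof -
  obtain n0 :: nat where n0: "C / \<epsilon> < real n0" using reals_Archimedean2 by blast
  have "C * real n ^ t \<le> \<epsilon> * real n ^ Suc t" if "n0 \<le> n" for n
  proof -
    have "C / \<epsilon> \<le> real n" using n0 that by linarith
    then have "C \<le> \<epsilon> * real n" using assms by (simp add: field_simps)
    then have "C * real n ^ t \<le> \<epsilon> * real n * real n ^ t" by (intro mult_right_mono) auto
    then show ?thesis by simp
  qed
  then show ?thesis by blast
qed

lemma card_Psi_asymp:
  assumes "r = Suc (Suc t)" "c \<le> n"
  shows "c * (n choose (r - 1)) \<le> card (edges (Psi c n r)) + c * c * n ^ (r - 2)"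
proof -
  have "c * (n choose Suc t) \<le> c * (((n - c) choose Suc t) + c * n ^ t)"
    by (intro mult_le_mono2 choose_diff_le)
  also have "\<dots> = c * ((n - c) choose Suc t) + c * c * n ^ t" by (simp add: algebra_simps)
  finally show ?thesis using card_Psi_ge[OF assms] assms(1) by simp
qed

text \<open>Both lengths are treated at once: the upper bound uses only that no path with
  \<open>2 * k\<close> edges exists, and the star of the lower bound already avoids the path with
  \<open>2 * k - 1\<close> edges.\<close>

lemma ex_asymp:
  assumes ab: "b < a" "1 \<le> b" "r = a + b" and k: "2 \<le> k" and m: "2 * k - 1 \<le> m" "m \<le> 2 * k"
  shows "(\<lambda>n. real (ex r n (ab_path m a b)) - (real k - 1) * real (n choose (r - 1)))
          \<in> o(\<lambda>n. real n ^ (r - 1))"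
proof (rule landau_o.smallI)
  fix \<epsilon> :: real assume eps: "0 < \<epsilon>"
  have k1: "1 \<le> k" and m1: "1 \<le> m" using k m by simp_all
  have "r = Suc (Suc (r - 2))" using ab by simp
  then obtain t where t: "r = Suc (Suc t)" by blast
  have rk: "real (k - 1) = real k - 1" using k by simp
  obtain n0 where n0: "\<And>(V::nat set) H. finite V \<Longrightarrow> n0 \<le> card V \<Longrightarrow> H \<subseteq> ksub V r \<Longrightarrow> \<not> has_path H (2 * k) a b \<Longrightarrow>
      real (card H) \<le> (real k - 1) * real (card V choose (r - 1)) + \<epsilon> * real (card V) ^ (r - 1)"
  proof -
    obtain s n0 where *: "\<forall>(V::nat set) H. finite V \<longrightarrow> n0 \<le> card V \<longrightarrow> H \<subseteq> ksub V r \<longrightarrow> \<not> has_path H (2 * k) a b \<longrightarrow>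
     (\<exists>E c. centred s H E c \<and> almost_regular \<epsilon> k r V H E c)"
      using path_free_structure[OF ab k1 eps, where 'a=nat] by (elim exE conjE)
    show thesis
    proof (rule that[of n0])
      fix V :: "nat set" and H assume "finite V" "n0 \<le> card V" "H \<subseteq> ksub V r" "\<not> has_path H (2 * k) a b"
      from *[rule_format, OF this] obtain E :: "nat set set" and c where "almost_regular \<epsilon> k r V H E c"
        by (elim exE conjE)
      then have "real (card H) + real (card {f\<in>ksub V (r - 1). card (nb E c f) < k - 1})
          \<le> real ((k - 1) * (card V choose (r - 1))) + \<epsilon> * real (card V) ^ (r - 1)"
        by (simp only: almost_regular_def)
      then show "real (card H) \<le> (real k - 1) * real (card V choose (r - 1)) + \<epsilon> * real (card V) ^ (r - 1)"
        using rk by simp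
    qed
  qed
  obtain n1 where n1: "\<And>n. n1 \<le> n \<Longrightarrow> real ((k - 1) * (k - 1)) * real n ^ t \<le> \<epsilon> * real n ^ Suc t"
    using eventually_power_le[OF eps] by blast
  show "\<forall>\<^sub>F n in sequentially. norm (real (ex r n (ab_path m a b)) - (real k - 1) * real (n choose (r - 1)))
      \<le> \<epsilon> * norm (real n ^ (r - 1))"
    unfolding eventually_sequentially
  proof (intro exI allI impI)
    fix n assume n: "max (max n0 n1) k \<le> n"
    obtain H where H: "H \<in> free_rgraphs r n (ab_path m a b)" "card (edges H) = ex r n (ab_path m a b)"
      using ex_attained[OF m1] by blast
    then have H': "finite (verts H)" "edges H \<subseteq> ksub (verts H) r" "card (verts H) = n" "\<not> has_path (edges H) (2 * k) a b"
      using free_rgraphs_ab_path[OF m1] has_path_prefix[OF _ m(2)] by blast+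
    have up: "real (ex r n (ab_path m a b)) \<le> (real k - 1) * real (n choose (r - 1)) + \<epsilon> * real n ^ (r - 1)"
      using n0[OF H'(1) _ H'(2,4)] H'(3) H(2) n by simp
    have kn: "k - 1 \<le> n" using n by linarith
    have "(k - 1) * (n choose (r - 1)) \<le> card (edges (Psi (k - 1) n r)) + (k - 1) * (k - 1) * n ^ (r - 2)"
      by (rule card_Psi_asymp[OF t kn])
    also have "card (edges (Psi (k - 1) n r)) \<le> ex r n (ab_path m a b)"
      by (rule ex_ge[OF Psi_free[OF k m(1)]])
    finally have "real ((k - 1) * (n choose (r - 1))) \<le> real (ex r n (ab_path m a b) + (k - 1) * (k - 1) * n ^ (r - 2))"
      by (intro of_nat_mono) simp
    moreover have "real ((k - 1) * (k - 1)) * real n ^ (r - 2) \<le> \<epsilon> * real n ^ (r - 1)" using n1[of n] n t by simp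
    ultimately have "(real k - 1) * real (n choose (r - 1)) \<le> real (ex r n (ab_path m a b)) + \<epsilon> * real n ^ (r - 1)"
      using rk by simp
    then show "norm (real (ex r n (ab_path m a b)) - (real k - 1) * real (n choose (r - 1))) \<le> \<epsilon> * norm (real n ^ (r - 1))"
      using up by simp
  qed
qed

lemma free_rgraphs_rev: "odd m \<Longrightarrow> free_rgraphs r n (ab_path m a b) = free_rgraphs r n (ab_path m b a)"
proof (intro set_eqI)
  fix H assume "odd m"
  then have "1 \<le> m" by (cases m) auto
  then show "H \<in> free_rgraphs r n (ab_path m a b) \<longleftrightarrow> H \<in> free_rgraphs r n (ab_path m b a)"
    using has_path_rev[OF \<open>odd m\<close>, of "edges H" a b] by (simp add: free_rgraphs_ab_path)
qed

lemma ex_rev: "odd m \<Longrightarrow> ex r n (ab_path m a b) = ex r n (ab_path m b a)"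
  unfolding ex_def using free_rgraphs_rev by metis

section \<open>Stability\<close>

lemma two_stars_path:
  assumes G: "clean_fam G X (k - 1) s a b" "G \<subseteq> H" and k: "2 \<le> k" and s: "(2 * k + 5) * (a + b) \<le> s"
    and f: "f1 \<inter> X = {}" "f2 \<inter> X = {}" and N: "N1 \<subseteq> X" "N2 \<subseteq> X" "card N1 = k - 1" "card N2 = k - 1" "N1 \<noteq> N2"
    and fG: "\<And>v. v \<in> N1 \<Longrightarrow> insert v f1 \<in> G" "\<And>v. v \<in> N2 \<Longrightarrow> insert v f2 \<in> G"
    and A: "A \<subseteq> f1" "A \<subseteq> f2" "card A = a" "finite A"
  shows "has_path H (2 * k - 1) a b"
proof -
  have k1: "1 \<le> k - 1" using k by simp
  then have "N1 \<noteq> {}" using N(3) by auto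
  then obtain w where w: "w \<in> N1" by blast
  have fin: "finite N1" "finite N2" using N(3,4) k by (auto intro: card_ge_0_finite)
  have bound: "l * (a + b) \<le> s" if "l \<le> 2 * k + 5" for l
    using mult_le_mono1[OF that, of "a + b"] s by linarith
  have AX: "A \<inter> X = {}" using A(1) f(1) by blast
  have Ae: "A \<subseteq> insert w f1" using A(1) by blast
  have m: "2 * (k - 1) = 2 * k - 2" by simp
  obtain Bl where p: "path_in H (2 * k - 2) a b Bl" and Bl0: "Bl 0 = A"
    and cP: "card ((\<Union>i\<le>2 * k - 2. Bl i) \<inter> X) \<le> k - 1"
    using walk_start[OF G k1 _ Ae AX A(4,3) fG(1)[OF w]] bound[of "2 * (k - 1) + 1"] unfolding m by auto
  let ?P = "\<Union>i\<le>2 * k - 2. Bl i"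
  note finP = path_in_Union[OF p]
  have "k - 1 < card (N1 \<union> N2)"
  proof (rule ccontr)
    assume "\<not> ?thesis"
    then have "card (N1 \<union> N2) \<le> card N1" "card (N1 \<union> N2) \<le> card N2" using N by simp_all
    then have "N1 = N1 \<union> N2" "N2 = N1 \<union> N2" using fin by (simp_all add: card_seteq)
    then show False using N(5) by simp
  qed
  then have "\<not> N1 \<union> N2 \<subseteq> ?P \<inter> X" using cP card_mono[of "?P \<inter> X" "N1 \<union> N2"] finP(1) by (meson finite_Int le_trans not_le)
  then obtain u where u: "u \<in> N1 \<union> N2" "u \<notin> ?P" using N(1,2) by blast
  then obtain e where e: "e \<in> G" "insert u A \<subseteq> e" "e \<inter> X = {u}"
  proof (cases "u \<in> N1")
    case True
    have "insert u f1 \<inter> X = {u}" using True N(1) f(1) by blast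
    then show thesis using that[OF fG(1)[OF True]] A(1) by blast
  next
    case False
    then have u2: "u \<in> N2" using u(1) by blast
    have "insert u f2 \<inter> X = {u}" using u2 N(2) f(2) by blast
    then show thesis using that[OF fG(2)[OF u2]] A(2) by blast
  qed
  have uA: "u \<notin> A" using u N(1,2) AX by blast
  have ker: "kernel s G (insert u A)"
    by (rule clean_famD(5)[OF G(1) e(1)]) (use e A uA in auto)
  have "card ?P \<le> s" using finP(2) bound[of "2 * k - 2 + 1"] by linarith
  with finP(1) obtain e' where e': "e' \<in> G" "insert u A \<subseteq> e'" "(e' - insert u A) \<inter> ?P = {}"
    using kernelE[OF ker] by metis
  define C where "C = e' - A"
  have ce': "finite e'" "card e' = a + b" using clean_famD(1,2)[OF G(1) e'(1)] by simp_all
  have "path_in H (Suc (2 * k - 2)) b a (case_nat C Bl)"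
  proof (rule path_in_Cons[OF p])
    show "finite C" "card C = b" using ce' e'(2) A by (simp_all add: C_def card_Diff_subset)
    have "C \<subseteq> insert u (e' - insert u A)" by (auto simp: C_def)
    then show "C \<inter> ?P = {}" using e'(3) u(2) by blast
    have "C \<union> Bl 0 = e'" using e'(2) by (auto simp: C_def Bl0)
    then show "C \<union> Bl 0 \<in> H" using e'(1) G(2) by auto
  qed
  moreover have "Suc (2 * k - 2) = 2 * k - 1" using k by simp
  ultimately have "has_path H (2 * k - 1) b a" unfolding has_path_def by auto
  moreover have "odd (2 * k - 1)" using k by simp
  ultimately show ?thesis using has_path_rev by blast
qed

text \<open>A centre \<open>v\<close> of \<open>f\<close> inside \<open>h\<close> would give
  \<open>insert v f = h\<close>, an edge. This is why centre sets are compared on non-edges: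
  \<open>h\<close> and the centres can then receive different colours.\<close>

lemma nb_not_in_edge:
  assumes V: "finite V" and H: "H \<subseteq> ksub V r" and E: "E \<subseteq> H" and r: "1 \<le> r"
    and h: "h \<in> ksub V r" "h \<notin> H" and f: "f \<in> ksub V (r - 1)" "f \<subseteq> h"
  shows "nb E c f \<inter> h = {}"
proof (rule ccontr)
  assume "nb E c f \<inter> h \<noteq> {}"
  then obtain v where v: "v \<notin> f" "insert v f \<in> E" "v \<in> h" by (auto simp: nb_def)
  have fin: "finite h" "finite f" using h f V finite_subset by (auto simp: ksub_def)
  have "insert v f \<subseteq> h" using v f by blast
  moreover have "card (insert v f) = card h" using v fin h f r by (simp add: ksub_def)
  ultimately have "insert v f = h" using fin by (simp add: card_subset_eq)
  then show False using v(2) E h(2) by blast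
qed

lemma nb_subset: "finite V \<Longrightarrow> H \<subseteq> ksub V r \<Longrightarrow> E \<subseteq> H \<Longrightarrow> nb E c f \<subseteq> V"
  by (auto simp: nb_def ksub_def)

text \<open>Two \<open>(r-1)\<close>-subsets of \<open>h\<close> share at least
  \<open>r - 2 \<ge> a\<close> vertices, so if both survived cleaning, \<open>two_stars_path\<close>
  would apply. Hence every correctly coloured mixed \<open>h\<close> contains one of the
  \<open>O(n ^ (r - 2))\<close> lost sets, each of which lies in at most \<open>n\<close> sets of
  size \<open>r\<close>.\<close>

lemma few_mixed:
  assumes ab: "b < a" "2 \<le> b" "r = a + b" and k: "2 \<le> k" and s: "(2 * k + 5) * r \<le> s"
    and V: "finite V" and H: "H \<subseteq> ksub V r" and np: "\<not> has_path H (2 * k - 1) a b"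
    and cen: "centred s H E c"
    and F: "F = {f\<in>ksub V (r - 1). card (nb E c f) = k - 1}"
  shows "card {h\<in>ksub V r. h \<notin> H \<and> (\<exists>f\<in>F. \<exists>f'\<in>F. f \<subseteq> h \<and> f' \<subseteq> h \<and> nb E c f \<noteq> nb E c f')}
     \<le> 2 ^ (r + 2 * k) * (card V * (fur r s * card V ^ (r - 2)))"
proof -
  let ?T = "{h\<in>ksub V r. h \<notin> H \<and> (\<exists>f\<in>F. \<exists>f'\<in>F. f \<subseteq> h \<and> f' \<subseteq> h \<and> nb E c f \<noteq> nb E c f')}"
  let ?N = "nb E c"
  have E: "E \<subseteq> H" and cE: "\<And>e. e \<in> E \<Longrightarrow> c e \<in> e \<and> \<not> kernel s H (e - {c e})"
    using cen by (auto simp: centred_def)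
  have b1: "1 \<le> b" and r1: "1 \<le> r" and k1: "1 \<le> k - 1" using ab k by simp_all
  note s2 = size_bounds(1,3)[OF s]
  have "\<forall>h\<in>?T. \<exists>p. fst p \<in> F \<and> snd p \<in> F \<and> fst p \<subseteq> h \<and> snd p \<subseteq> h \<and> ?N (fst p) \<noteq> ?N (snd p)"
  proof
    fix h assume "h \<in> ?T"
    then obtain f f' where "f \<in> F" "f' \<in> F" "f \<subseteq> h" "f' \<subseteq> h" "?N f \<noteq> ?N f'" by blast
    then show "\<exists>p. fst p \<in> F \<and> snd p \<in> F \<and> fst p \<subseteq> h \<and> snd p \<subseteq> h \<and> ?N (fst p) \<noteq> ?N (snd p)"
      by (intro exI[of _ "(f, f')"]) simp
  qed
  from bchoice[OF this] obtain p where
    p: "\<forall>h\<in>?T. fst (p h) \<in> F \<and> snd (p h) \<in> F \<and> fst (p h) \<subseteq> h \<and> snd (p h) \<subseteq> h \<and> ?N (fst (p h)) \<noteq> ?N (snd (p h))"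
    by (elim exE)
  define f1 f2 where "f1 h = fst (p h)" and "f2 h = snd (p h)" for h
  have f12: "f1 h \<in> F" "f2 h \<in> F" "f1 h \<subseteq> h" "f2 h \<subseteq> h" "?N (f1 h) \<noteq> ?N (f2 h)" if "h \<in> ?T" for h
    using p[rule_format, OF that] by (simp_all add: f1_def f2_def)
  have FV: "f \<in> ksub V (r - 1)" "card (?N f) = k - 1" if "f \<in> F" for f using that by (simp_all add: F)
  have disj: "?N f \<inter> h = {}" if "h \<in> ?T" "f \<in> F" "f \<subseteq> h" for f h
    using nb_not_in_edge[OF V H E r1 _ _ FV(1)[OF that(2)] that(3)] that(1) by blast
  let ?P = "\<lambda>h. h \<union> (?N (f1 h) \<union> ?N (f2 h))"
  have "\<exists>\<chi>. card ?T \<le> 2 ^ (r + 2 * k) * card {h\<in>?T. \<forall>v\<in>?P h. \<chi> v = (if v \<in> h then 0 else 1::nat)}"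
  proof (rule colouring_exists[OF V])
    fix h assume h: "h \<in> ?T"
    have "card (?P h) \<le> card h + (card (?N (f1 h)) + card (?N (f2 h)))"
      using card_Un_le[of h "?N (f1 h) \<union> ?N (f2 h)"] card_Un_le[of "?N (f1 h)" "?N (f2 h)"] by linarith
    also have "\<dots> \<le> r + 2 * k" using h FV(2)[OF f12(1)[OF h]] FV(2)[OF f12(2)[OF h]] by (simp add: ksub_def)
    finally show "?P h \<subseteq> V \<and> card (?P h) \<le> r + 2 * k"
      using h nb_subset[OF V H E] by (auto simp: ksub_def)
  qed (use V in auto)
  then obtain \<chi> where chi: "card ?T \<le> 2 ^ (r + 2 * k) * card {h\<in>?T. \<forall>v\<in>?P h. \<chi> v = (if v \<in> h then 0 else 1::nat)}"
    by blast
  define T' where "T' = {h\<in>?T. \<forall>v\<in>?P h. \<chi> v = (if v \<in> h then 0 else 1::nat)}"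
  define X where "X = {v. \<chi> v = 1}"
  define F' where "F' = f1 ` T' \<union> f2 ` T'"
  have T'T: "h \<in> ?T" if "h \<in> T'" for h using that by (simp add: T'_def)
  have hX: "h \<inter> X = {}" "?N (f1 h) \<subseteq> X" "?N (f2 h) \<subseteq> X" if h: "h \<in> T'" for h
  proof -
    have all: "\<forall>v\<in>?P h. \<chi> v = (if v \<in> h then 0 else 1::nat)" using h by (simp add: T'_def)
    note hT = T'T[OF h]
    show "h \<inter> X = {}" using all by (auto simp: X_def)
    show "?N (f1 h) \<subseteq> X" using all disj[OF hT f12(1,3)[OF hT]] by (auto simp: X_def)
    show "?N (f2 h) \<subseteq> X" using all disj[OF hT f12(2,4)[OF hT]] by (auto simp: X_def)
  qed
  have F'F: "f \<in> F" if f: "f \<in> F'" for f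
  proof -
    obtain h where h: "h \<in> T'" "f = f1 h \<or> f = f2 h" using f unfolding F'_def by blast
    then show ?thesis using f12(1,2)[OF T'T[OF h(1)]] by auto
  qed
  have fX: "f \<inter> X = {} \<and> ?N f \<subseteq> X" if f: "f \<in> F'" for f
  proof -
    obtain h where h: "h \<in> T'" "f = f1 h \<or> f = f2 h" using f unfolding F'_def by blast
    then show ?thesis using hX[OF h(1)] f12(3,4)[OF T'T[OF h(1)]] by auto
  qed
  have ins: "insert v f \<in> H \<and> \<not> kernel s H f" if f: "v \<in> ?N f" for f v
  proof -
    have v: "v \<notin> f" "insert v f \<in> E" "c (insert v f) = v" using f by (auto simp: nb_def)
    then show ?thesis using cE[of "insert v f"] E by auto
  qed
  have ownF: "\<not> kernel s H f" if f: "f \<in> F'" for f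
  proof -
    have "?N f \<noteq> {}" using FV(2)[OF F'F[OF f]] k1 by auto
    then show ?thesis using ins by blast
  qed
  have "\<exists>F'' G. F'' \<subseteq> F' \<and> card (F' - F'') \<le> fur r s * card V ^ (r - 2) \<and> star_cleaned H X ?N (k - 1) s r b F'' G"
  proof (rule clean_star[OF ab(1) b1 ab(3) s2 V H np _ _ _ k1 _ ownF])
    show "f \<inter> X = {}" "?N f \<subseteq> X" if "f \<in> F'" for f using fX[OF that] by simp_all
    show "card (?N f) = k - 1" if "f \<in> F'" for f by (rule FV(2)[OF F'F[OF that]])
    show "insert v f \<in> H" if "f \<in> F'" "v \<in> ?N f" for f v using ins[OF that(2)] by simp
  qed
  then obtain F'' G where cF: "card (F' - F'') \<le> fur r s * card V ^ (r - 2)"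
    and sc: "star_cleaned H X ?N (k - 1) s r b F'' G"
    by (elim exE conjE)
  note GH = star_cleanedD(1)[OF sc] and full = star_cleanedD(2)[OF sc]
  have cf: "clean_fam G X (k - 1) s a b" using star_cleanedD(3)[OF sc] ab by simp
  have miss: "f1 h \<in> F' - F'' \<or> f2 h \<in> F' - F''" if h: "h \<in> T'" for h
  proof (rule ccontr)
    assume "\<not> ?thesis"
    then have in'': "f1 h \<in> F''" "f2 h \<in> F''" using h unfolding F'_def by auto
    note hT = T'T[OF h]
    have fV: "f1 h \<in> ksub V (r - 1)" "f2 h \<in> ksub V (r - 1)" using FV(1) f12(1,2)[OF hT] by blast+
    have fh: "finite h" "card h = r" using hT V finite_subset by (auto simp: ksub_def)
    have ff: "finite (f1 h)" "finite (f2 h)" using f12(3,4)[OF hT] fh(1) finite_subset by blast+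
    have "card (f1 h \<union> f2 h) \<le> r" using card_mono[OF fh(1), of "f1 h \<union> f2 h"] f12(3,4)[OF hT] fh(2) by simp
    then have "a \<le> card (f1 h \<inter> f2 h)"
      using card_Un_Int[OF ff] fV ab by (simp add: ksub_def)
    then obtain A where A: "A \<subseteq> f1 h \<inter> f2 h" "card A = a" "finite A" by (rule obtain_subset_with_card_n)
    have sk: "(2 * k + 5) * (a + b) \<le> s" using s ab(3) by simp
    have "has_path H (2 * k - 1) a b"
      by (rule two_stars_path[OF cf GH k sk, where ?f1.0="f1 h" and ?f2.0="f2 h" and ?N1.0="?N (f1 h)" and ?N2.0="?N (f2 h)" and A=A])
        (use hX[OF h] f12[OF hT] FV(2) in'' full A in auto)
    then show False using np by blast
  qed
  have finT': "finite T'" using V by (simp add: T'_def)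
  have finF': "finite F'" using finT' by (simp add: F'_def)
  have "card T' * 1 \<le> card V * card (F' - F'')"
  proof (rule double_count[where R="\<lambda>h f. f \<subseteq> h"])
    show "1 \<le> card {f\<in>F' - F''. f \<subseteq> h}" if h: "h \<in> T'" for h
    proof -
      have "{f\<in>F' - F''. f \<subseteq> h} \<noteq> {}" using miss[OF h] f12(3,4)[OF T'T[OF h]] by blast
      then show ?thesis using finF' by (simp add: Suc_le_eq card_gt_0_iff)
    qed
    show "card {h\<in>T'. f \<subseteq> h} \<le> card V" if f: "f \<in> F' - F''" for f
    proof -
      have fV: "f \<in> ksub V (r - 1)" using FV(1) F'F f by blast
      have "{h\<in>T'. f \<subseteq> h} \<subseteq> (\<lambda>v. insert v f) ` V"
      proof
        fix h assume h: "h \<in> {h\<in>T'. f \<subseteq> h}"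
        then have hh: "h \<in> ksub V r" "f \<subseteq> h" using T'T by blast+
        then have "finite h" using V finite_subset by (auto simp: ksub_def)
        then have fin: "finite h" "finite f" using finite_subset[OF hh(2)] by simp_all
        have "card (h - f) = 1" using hh fV fin r1 by (simp add: ksub_def card_Diff_subset)
        then obtain v where "h - f = {v}" by (rule card_1_singletonE)
        then have "h = insert v f" "v \<in> V" using hh by (auto simp: ksub_def)
        then show "h \<in> (\<lambda>v. insert v f) ` V" by blast
      qed
      then show ?thesis using V by (rule surj_card_le[rotated])
    qed
  qed (use finT' finF' in auto)
  also have "\<dots> \<le> card V * (fur r s * card V ^ (r - 2))" using cF by (rule mult_le_mono2)
  finally have "card T' \<le> card V * (fur r s * card V ^ (r - 2))" by simp
  then have "2 ^ (r + 2 * k) * card T' \<le> 2 ^ (r + 2 * k) * (card V * (fur r s * card V ^ (r - 2)))" by (rule mult_le_mono2)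
  then show ?thesis using chi unfolding T'_def by linarith
qed

section \<open>Sliding windows: from local to global agreement of centre sets\<close>

text \<open>Repetitions are allowed, so that all counts are pure powers; lists with a repetition in
  a window are discarded later as rare.\<close>

definition lists_of :: "'a set \<Rightarrow> nat \<Rightarrow> 'a list set" where
  "lists_of V l = {xs. set xs \<subseteq> V \<and> length xs = l}"

lemma finite_lists_of: "finite V \<Longrightarrow> finite (lists_of V l)"
  unfolding lists_of_def by (rule finite_lists_length_eq)

lemma card_lists_of: "finite V \<Longrightarrow> card (lists_of V l) = card V ^ l"
  unfolding lists_of_def by (rule card_lists_length_eq)

text \<open>A list is determined by its window and the remaining entries, and a window with a given
  underlying set of at most \<open>l\<close> elements can be written in at most \<open>l ^ l\<close>
  ways.\<close>

lemma window_count: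
  assumes V: "finite V" and B: "\<And>T. T \<in> \<B> \<Longrightarrow> T \<subseteq> V \<and> card T \<le> l" and L: "i + l \<le> L"
  shows "card {xs\<in>lists_of V L. set (take l (drop i xs)) \<in> \<B>} \<le> card \<B> * l ^ l * card V ^ (L - l)"
proof -
  let ?D = "{ys\<in>lists_of V l. set ys \<in> \<B>}"
  have finB: "finite \<B>" using B V finite_subset[of \<B> "Pow V"] by auto
  have "card ?D = (\<Sum>T\<in>\<B>. card {ys\<in>?D. set ys = T})"
    using finite_lists_of[OF V] finB by (intro card_fibres) auto
  also have "\<dots> \<le> (\<Sum>T\<in>\<B>. l ^ l)"
  proof (rule sum_mono)
    fix T assume T: "T \<in> \<B>"
    then have fT: "finite T" using B V finite_subset by blast
    have "card {ys\<in>?D. set ys = T} \<le> card (lists_of T l)"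
      by (intro card_mono finite_lists_of[OF fT]) (auto simp: lists_of_def)
    also have "\<dots> = card T ^ l" by (rule card_lists_of[OF fT])
    also have "\<dots> \<le> l ^ l" using B[OF T] by (simp add: power_mono)
    finally show "card {ys\<in>?D. set ys = T} \<le> l ^ l" .
  qed
  finally have cD: "card ?D \<le> card \<B> * l ^ l" by simp
  let ?m = "\<lambda>xs. (take l (drop i xs), take i xs @ drop (i + l) xs)"
  have "inj_on ?m {xs\<in>lists_of V L. set (take l (drop i xs)) \<in> \<B>}"
  proof (rule inj_onI)
    fix xs ys assume x: "xs \<in> {xs\<in>lists_of V L. set (take l (drop i xs)) \<in> \<B>}"
      and y: "ys \<in> {xs\<in>lists_of V L. set (take l (drop i xs)) \<in> \<B>}" and eq: "?m xs = ?m ys"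
    have len: "length (take i xs) = length (take i ys)" using x y by (simp add: lists_of_def)
    have "take i xs = take i ys" "drop (i + l) xs = drop (i + l) ys" "take l (drop i xs) = take l (drop i ys)"
      using eq len by simp_all
    moreover have "zs = take i zs @ take l (drop i zs) @ drop (i + l) zs" for zs :: "'a list"
      by (metis add.commute append_take_drop_id drop_drop)
    ultimately show "xs = ys" by metis
  qed
  moreover have "?m ` {xs\<in>lists_of V L. set (take l (drop i xs)) \<in> \<B>} \<subseteq> ?D \<times> lists_of V (L - l)"
  proof (rule image_subsetI)
    fix xs assume "xs \<in> {xs\<in>lists_of V L. set (take l (drop i xs)) \<in> \<B>}"
    then have x: "set xs \<subseteq> V" "length xs = L" "set (take l (drop i xs)) \<in> \<B>" by (auto simp: lists_of_def)
    have "set (take i xs) \<subseteq> V" "set (drop (i + l) xs) \<subseteq> V" "set (take l (drop i xs)) \<subseteq> V"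
      using x(1) set_take_subset[of i xs] set_drop_subset[of "i + l" xs] B[OF x(3)] by auto
    then show "?m xs \<in> ?D \<times> lists_of V (L - l)" using x(2,3) L by (simp add: lists_of_def)
  qed
  moreover have "finite (?D \<times> lists_of V (L - l))" using finite_lists_of[OF V] by simp
  ultimately have "card {xs\<in>lists_of V L. set (take l (drop i xs)) \<in> \<B>} \<le> card (?D \<times> lists_of V (L - l))"
    by (rule card_inj_on_le)
  also have "\<dots> = card ?D * card V ^ (L - l)" by (simp add: card_cartesian_product card_lists_of[OF V])
  also have "\<dots> \<le> card \<B> * l ^ l * card V ^ (L - l)" using cD by (rule mult_le_mono1)
  finally show ?thesis .
qed

lemma card_small_subsets:
  assumes "finite V" "V \<noteq> {}"
  shows "card {T. T \<subseteq> V \<and> card T \<le> q} \<le> (q + 1) * card V ^ q"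
proof -
  have n: "1 \<le> card V" using assms by (simp add: Suc_leI card_gt_0_iff)
  have "{T. T \<subseteq> V \<and> card T \<le> q} = (\<Union>j\<le>q. ksub V j)" by (auto simp: ksub_def)
  then have "card {T. T \<subseteq> V \<and> card T \<le> q} \<le> (\<Sum>j\<le>q. card (ksub V j))" by (simp add: card_UN_le)
  also have "\<dots> \<le> (\<Sum>j\<le>q. card V ^ q)"
  proof (rule sum_mono)
    fix j assume "j \<in> {..q}"
    then have "card V ^ j \<le> card V ^ q" using n by (intro power_increasing) auto
    then show "card (ksub V j) \<le> card V ^ q" using card_ksub_le[OF assms(1), of j] by linarith
  qed
  finally show ?thesis by simp
qed

text \<open>Two disjoint \<open>q\<close>-sets are joined by sliding a window along a list of length \<open>2 q\<close>.\<close>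
lemma almost_constant:
  fixes N :: "'a set \<Rightarrow> 'b"
  assumes V: "finite V" "V \<noteq> {}" and q: "1 \<le> q" and Fb: "Fb \<subseteq> ksub V q" and Hb: "Hb \<subseteq> ksub V (Suc q)"
    and same: "\<And>h f f'. h \<in> ksub V (Suc q) \<Longrightarrow> h \<notin> Hb \<Longrightarrow> f \<in> ksub V q \<Longrightarrow> f' \<in> ksub V q \<Longrightarrow> f \<notin> Fb \<Longrightarrow> f' \<notin> Fb \<Longrightarrow>
      f \<subseteq> h \<Longrightarrow> f' \<subseteq> h \<Longrightarrow> N f = N f'"
  shows "\<exists>W. card {f\<in>ksub V q. f \<in> Fb \<or> N f \<noteq> W} * card V ^ q \<le> (q + 1) * (card Fb * q ^ q * card V ^ q) +
      q * ((card Hb + (q + 1) * card V ^ q) * (q + 1) ^ (q + 1) * card V ^ (q - 1))"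
proof -
  let ?L = "2 * q"
  \<comment> \<open>Sets of size at most \<open>q\<close> are added so that a list with a repetition
    inside a window of length \<open>q + 1\<close> counts as bad.\<close>
  define D where "D = Hb \<union> {T. T \<subseteq> V \<and> card T \<le> q}"
  define fw where "fw i xs = set (take q (drop i xs))" for i and xs :: "'a list"
  define hw where "hw i xs = set (take (q + 1) (drop i xs))" for i and xs :: "'a list"
  define bad where "bad = (\<Union>i\<le>q. {xs\<in>lists_of V ?L. fw i xs \<in> Fb}) \<union> (\<Union>i<q. {xs\<in>lists_of V ?L. hw i xs \<in> D})"
  have finL: "finite (lists_of V l)" for l by (rule finite_lists_of[OF V(1)])
  have finD: "finite {T. T \<subseteq> V \<and> card T \<le> q}" using V(1) by simp
  have cD: "card D \<le> card Hb + (q + 1) * card V ^ q"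
    unfolding D_def using card_Un_le[of Hb "{T. T \<subseteq> V \<and> card T \<le> q}"] card_small_subsets[OF V, of q] by linarith
  have cb1: "card {xs\<in>lists_of V ?L. fw i xs \<in> Fb} \<le> card Fb * q ^ q * card V ^ q" if "i \<le> q" for i
    using window_count[OF V(1), of Fb q i ?L] Fb that unfolding fw_def by (auto simp: ksub_def)
  have cb2: "card {xs\<in>lists_of V ?L. hw i xs \<in> D} \<le> (card Hb + (q + 1) * card V ^ q) * (q + 1) ^ (q + 1) * card V ^ (q - 1)" if "i < q" for i
  proof -
    have "card {xs\<in>lists_of V ?L. hw i xs \<in> D} \<le> card D * (q + 1) ^ (q + 1) * card V ^ (?L - (q + 1))"
      unfolding hw_def by (rule window_count[OF V(1)]) (use Hb that in \<open>auto simp: D_def ksub_def\<close>)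
    also have "?L - (q + 1) = q - 1" by simp
    finally show ?thesis using cD by (meson le_trans mult_le_mono1)
  qed
  have "card bad \<le> (\<Sum>i\<le>q. card {xs\<in>lists_of V ?L. fw i xs \<in> Fb}) + (\<Sum>i<q. card {xs\<in>lists_of V ?L. hw i xs \<in> D})"
    unfolding bad_def by (intro order_trans[OF card_Un_le] add_mono card_UN_le) auto
  also have "\<dots> \<le> (\<Sum>i\<le>q. card Fb * q ^ q * card V ^ q) + (\<Sum>i<q. (card Hb + (q + 1) * card V ^ q) * (q + 1) ^ (q + 1) * card V ^ (q - 1))"
    using cb1 cb2 by (intro add_mono sum_mono) auto
  also have "\<dots> = (q + 1) * (card Fb * q ^ q * card V ^ q) +
      q * ((card Hb + (q + 1) * card V ^ q) * (q + 1) ^ (q + 1) * card V ^ (q - 1))"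
    by simp
  finally have cbad: "card bad \<le> (q + 1) * (card Fb * q ^ q * card V ^ q) +
      q * ((card Hb + (q + 1) * card V ^ q) * (q + 1) ^ (q + 1) * card V ^ (q - 1))" .
  have badL: "bad \<subseteq> lists_of V ?L" by (auto simp: bad_def)
  have finbad: "finite bad" using badL finL finite_subset by blast
  have good: "fw i xs \<in> ksub V q \<and> fw i xs \<notin> Fb \<and> N (fw i xs) = N (fw 0 xs)"
    if xs: "xs \<in> lists_of V ?L" "xs \<notin> bad" and "i \<le> q" for xs i
  proof -
    have len: "length xs = ?L" "set xs \<subseteq> V" using xs(1) by (simp_all add: lists_of_def)
    have subV: "set (take l (drop j xs)) \<subseteq> V" for l j
      using len(2) set_take_subset[of l "drop j xs"] set_drop_subset[of j xs] by blast
    have nF: "fw j xs \<notin> Fb" if "j \<le> q" for j using xs that by (auto simp: bad_def)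
    have hD: "hw j xs \<notin> D" if "j < q" for j using xs that by (auto simp: bad_def)
    have dist: "distinct (take (q + 1) (drop j xs))" if j: "j < q" for j
    proof -
      have "\<not> card (hw j xs) \<le> q" using hD[OF j] subV unfolding D_def hw_def by blast
      moreover have "length (take (q + 1) (drop j xs)) = q + 1" using len(1) j by simp
      ultimately show ?thesis using card_length[of "take (q + 1) (drop j xs)"] unfolding hw_def
        by (metis Suc_eq_plus1 card_distinct le_SucE)
    qed
    have hk: "hw j xs \<in> ksub V (Suc q)" "hw j xs \<notin> Hb" if j: "j < q" for j
    proof -
      have "card (hw j xs) = q + 1" unfolding hw_def distinct_card[OF dist[OF j]] using len(1) j by simp
      then show "hw j xs \<in> ksub V (Suc q)" using subV by (simp add: ksub_def hw_def)
      show "hw j xs \<notin> Hb" using hD[OF j] by (simp add: D_def)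
    qed
    \<comment> \<open>Two consecutive windows of length \<open>q\<close> are the initial and the
      final part of one window of length \<open>q + 1\<close>, where \<open>same\<close>
      applies.\<close>
    have t1: "take q (drop j xs) = take q (take (q + 1) (drop j xs))" for j by simp
    have t2: "take q (drop (Suc j) xs) = drop 1 (take (q + 1) (drop j xs))" for j
      by (simp add: drop_take)
    have fsub: "fw j xs \<subseteq> hw j xs" "fw (Suc j) xs \<subseteq> hw j xs" for j
      unfolding fw_def hw_def using set_take_subset[of q "take (q + 1) (drop j xs)"] set_drop_subset[of 1 "take (q + 1) (drop j xs)"]
      by (simp_all only: t1[symmetric] t2[symmetric])
    have fk: "fw j xs \<in> ksub V q" if j: "j \<le> q" for j
    proof -
      have "distinct (take q (drop j xs))"
      proof (cases "j < q")
        case True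
        show ?thesis by (subst t1) (rule distinct_take[OF dist[OF True]])
      next
        case False
        then have "j = Suc (q - 1)" "q - 1 < q" using j q by auto
        then show ?thesis using t2[of "q - 1"] dist[of "q - 1"] by (metis distinct_drop)
      qed
      then have "card (fw j xs) = length (take q (drop j xs))" unfolding fw_def by (rule distinct_card)
      also have "\<dots> = q" using len(1) j by simp
      finally show ?thesis using subV by (simp add: ksub_def fw_def)
    qed
    have "N (fw i xs) = N (fw 0 xs)" using \<open>i \<le> q\<close>
    proof (induction i)
      case (Suc i)
      then have i: "i < q" by simp
      have "N (fw (Suc i) xs) = N (fw i xs)"
        using same[OF hk[OF i] fk[of "Suc i"] fk[of i] nF[of "Suc i"] nF[of i] fsub(2) fsub(1)] i by simp
      then show ?case using Suc by simp
    qed simp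
    then show ?thesis using fk nF \<open>i \<le> q\<close> by blast
  qed
  let ?K = "lists_of V q"
  have neK: "?K \<noteq> {}" using card_lists_of[OF V(1), of q] V by (auto simp: card_gt_0_iff)
  have im: "take q ` bad \<subseteq> ?K"
    using badL set_take_subset by (fastforce simp: lists_of_def)
  \<comment> \<open>Averaging over the first half: some \<open>u\<close> has at most the mean number
    of bad continuations, and the value of \<open>N\<close> on it becomes \<open>W\<close>.\<close>
  obtain u where u: "u \<in> ?K" "card V ^ q * card {xs\<in>bad. take q xs = u} \<le> card bad"
  proof (rule ccontr)
    assume "\<not> thesis"
    then have "\<And>u. u \<in> ?K \<Longrightarrow> card bad < card V ^ q * card {xs\<in>bad. take q xs = u}" using that by (meson not_le)
    then have "(\<Sum>u\<in>?K. card bad) < (\<Sum>u\<in>?K. card V ^ q * card {xs\<in>bad. take q xs = u})"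
      using finL neK by (intro sum_strict_mono) auto
    also have "\<dots> = card V ^ q * card bad"
      unfolding sum_distrib_left[symmetric] card_fibres[OF finbad finL im, symmetric] ..
    finally show False by (simp add: card_lists_of[OF V(1)])
  qed
  define W where "W = N (set u)"
  have lu: "length u = q" "set u \<subseteq> V" using u(1) by (simp_all add: lists_of_def)
  have "\<exists>ys. set ys = f \<and> length ys = q" if f: "f \<in> ksub V q" for f
  proof -
    have "finite f" using f V(1) finite_subset by (auto simp: ksub_def)
    then obtain ys where "set ys = f" "distinct ys" using finite_distinct_list by blast
    then show ?thesis using f distinct_card by (fastforce simp: ksub_def)
  qed
  then obtain l where l: "\<And>f. f \<in> ksub V q \<Longrightarrow> set (l f) = f \<and> length (l f) = q" by metis
  let ?S = "{f\<in>ksub V q. f \<in> Fb \<or> N f \<noteq> W}"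
  have "inj_on (\<lambda>f. u @ l f) ?S"
    by (rule inj_onI) (metis (no_types, lifting) l mem_Collect_eq same_append_eq)
  moreover have "(\<lambda>f. u @ l f) ` ?S \<subseteq> {xs\<in>bad. take q xs = u}"
  proof (rule image_subsetI)
    fix f assume f: "f \<in> ?S"
    then have lf: "set (l f) = f" "length (l f) = q" "f \<subseteq> V" using l by (auto simp: ksub_def)
    have inL: "u @ l f \<in> lists_of V ?L" using lf lu by (simp add: lists_of_def)
    have w: "fw 0 (u @ l f) = set u" "fw q (u @ l f) = f" using lf lu by (simp_all add: fw_def)
    \<comment> \<open>Along a good list \<open>N\<close> takes the same value at both ends, so an
      exceptional \<open>f\<close> as second half makes the list bad.\<close>
    have "u @ l f \<in> bad"
    proof (rule ccontr)
      assume "u @ l f \<notin> bad"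
      then have "f \<notin> Fb" "N f = W" using good[OF inL, of q] w by (simp_all add: W_def)
      then show False using f by blast
    qed
    then show "u @ l f \<in> {xs\<in>bad. take q xs = u}" using lu by simp
  qed
  moreover have "finite {xs\<in>bad. take q xs = u}" using finbad by simp
  ultimately have "card ?S \<le> card {xs\<in>bad. take q xs = u}" by (rule card_inj_on_le)
  then have "card ?S * card V ^ q \<le> card {xs\<in>bad. take q xs = u} * card V ^ q" by (rule mult_le_mono1)
  also have "\<dots> \<le> card bad" using u(2) by (simp only: mult.commute)
  finally show ?thesis using cbad by (intro exI[of _ W]) linarith
qed

lemma choose_lower:
  assumes "1 \<le> t" "2 * c \<le> n" "2 * t \<le> n"
  shows "(real n / (2 * real t)) ^ t \<le> real ((n - c) choose t)"
proof -
  have "t \<le> n - c" using assms by linarith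
  have "real n / (2 * real t) \<le> real (n - c) / real t" using assms by (simp add: field_simps of_nat_diff)
  then have "(real n / (2 * real t)) ^ t \<le> (real (n - c) / real t) ^ t" by (intro power_mono) auto
  also have "\<dots> \<le> real ((n - c) choose t)" by (rule binomial_ge_n_over_k_pow_k[OF \<open>t \<le> n - c\<close>])
  finally show ?thesis .
qed

text \<open>The last conjunct is the condition under which \<open>clean_star\<close> accepts
  \<open>f\<close>.\<close>

definition in_star :: "nat \<Rightarrow> 'a set set \<Rightarrow> 'a set \<Rightarrow> 'a set \<Rightarrow> bool" where
  "in_star s H W f \<longleftrightarrow> f \<inter> W = {} \<and> (\<forall>v\<in>W. insert v f \<in> H) \<and> \<not> kernel s H f"

text \<open>The error term is that of \<open>card_Psi_asymp\<close>, so that \<open>large\<close>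
  holds as soon as \<open>H\<close> has at least as many edges as the star.\<close>

definition large :: "nat \<Rightarrow> nat \<Rightarrow> 'a set \<Rightarrow> 'a set set \<Rightarrow> bool" where
  "large k r V H \<longleftrightarrow>
     (k - 1) * (card V choose (r - 1)) \<le> card H + (k - 1) * (k - 1) * card V ^ (r - 2)"

definition unstarred :: "nat \<Rightarrow> nat \<Rightarrow> 'a set \<Rightarrow> 'a set set \<Rightarrow> 'a set \<Rightarrow> 'a set set" where
  "unstarred s r V H W = {f\<in>ksub V (r - 1). \<not> in_star s H W f}"

text \<open>Near-extremality leaves few poor sets, so almost all \<open>f\<close> have exactly
  \<open>k - 1\<close> centres. Two such sets inside a common \<open>h\<close> have the same centres
  unless \<open>h\<close> is mixed or an edge; only \<open>O(n ^ (r - 1))\<close> sets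
  \<open>h\<close> are of this kind, against order \<open>n ^ r\<close> in total, so
  \<open>almost_constant\<close> yields one centre set for almost all \<open>f\<close>.\<close>

lemma stability:
  fixes a b r k :: nat and \<delta> :: real
  assumes ab: "b < a" "2 \<le> b" "r = a + b" and k: "2 \<le> k" and delta: "0 < \<delta>"
  shows "\<exists>s n0. (2 * k + 5) * r \<le> s \<and> (\<forall>(V::'a set) H. finite V \<longrightarrow> n0 \<le> card V \<longrightarrow> H \<subseteq> ksub V r \<longrightarrow>
     \<not> has_path H (2 * k - 1) a b \<longrightarrow>
     large k r V H \<longrightarrow>
     (\<exists>W\<subseteq>V. card W = k - 1 \<and> real (card (unstarred s r V H W)) \<le> \<delta> * real (card V) ^ (r - 1)))"
proof -
  define q where "q = r - 1"
  have q: "1 \<le> q" "r = Suc q" "r - 1 = q" "r - 2 = q - 1" "Suc (q - 1) = q" using ab by (simp_all add: q_def)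
  \<comment> \<open>\<open>Q * n ^ q\<close> is a lower bound for the number of
    \<open>q\<close>-sets. With \<open>\<delta>' < Q\<close> the exceptions cannot exhaust them, so
    some actual \<open>f\<close> has the centre set \<open>W\<close>, which makes \<open>W\<close> a
    subset of \<open>V\<close> of size \<open>k - 1\<close>.\<close>
  define Q where "Q = 1 / (2 * real q) ^ q"
  define \<delta>' where "\<delta>' = min \<delta> (Q / 2)"
  have Q: "0 < Q" using q(1) by (simp add: Q_def)
  then have d': "0 < \<delta>'" "\<delta>' \<le> \<delta>" and "\<delta>' < Q" using delta by (auto simp: \<delta>'_def)
  then have d'3: "\<delta>' < 1 / (2 * real q) ^ q" by (simp add: Q_def)
  define K1 K2 where "K1 = (q + 1) * q ^ q" and "K2 = q * (q + 1) ^ (q + 1)"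
  \<comment> \<open>Poor sets contribute \<open>2 * \<epsilon>\<close> and rich ones
    \<open>\<epsilon>\<close>; after multiplication by \<open>K1\<close> this is half of
    \<open>\<delta>'\<close>. The other half is for the term with \<open>K2\<close>, which is of
    lower order in \<open>n\<close>.\<close>
  define \<epsilon> where "\<epsilon> = \<delta>' / (6 * real K1)"
  have K1: "0 < K1" using q by (simp add: K1_def)
  have eps: "0 < \<epsilon>" "3 * \<epsilon> * real K1 = \<delta>' / 2" using d'(1) K1 by (simp_all add: \<epsilon>_def)
  have k1: "1 \<le> k" and b1: "1 \<le> b" and a1: "1 \<le> a" using k ab by simp_all
  obtain s n1 where s: "(2 * k + 5) * r \<le> s" and st: "\<forall>(V::'a set) H. finite V \<longrightarrow> n1 \<le> card V \<longrightarrow> H \<subseteq> ksub V r \<longrightarrow> \<not> has_path H (2 * k) a b \<longrightarrow>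
     (\<exists>E c. centred s H E c \<and> almost_regular \<epsilon> k r V H E c)"
    using path_free_structure[OF ab(1) b1 ab(3) k1 eps(1), where 'a='a] by (elim exE conjE)
  define CH where "CH = fur r s + 2 ^ (r + 2 * k) * fur r s"
  obtain n2 where n2: "\<And>n. n2 \<le> n \<Longrightarrow> real ((k - 1) * (k - 1)) * real n ^ (q - 1) \<le> \<epsilon> * real n ^ Suc (q - 1)"
    using eventually_power_le[OF eps(1)] by blast
  have d2: "0 < \<delta>' / 2" using d'(1) by simp
  obtain n3 where n3: "\<And>n. n3 \<le> n \<Longrightarrow> real (K2 * (CH + q + 1)) * real n ^ (q - 1) \<le> \<delta>' / 2 * real n ^ Suc (q - 1)"
    using eventually_power_le[OF d2] by blast
  note s2 = size_bounds(1,3)[OF s]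
  define n0 where "n0 = max (max n1 n2) (max n3 (2 * q))"
  have main: "\<exists>W\<subseteq>V. card W = k - 1 \<and> real (card (unstarred s r V H W)) \<le> \<delta> * real (card V) ^ (r - 1)"
    if V: "finite V" and n: "n0 \<le> card V" and H: "H \<subseteq> ksub V r" and np: "\<not> has_path H (2 * k - 1) a b"
      and big: "large k r V H"
    for V :: "'a set" and H
  proof -
    let ?n = "card V"
    have nn: "n1 \<le> ?n" "n2 \<le> ?n" "n3 \<le> ?n" "2 * q \<le> ?n" using n by (simp_all add: n0_def)
    have Vne: "V \<noteq> {}" using nn(4) q(1) by auto
    have np2: "\<not> has_path H (2 * k) a b" using np has_path_prefix[of H "2 * k" a b "2 * k - 1"] by auto
    obtain E c where cen: "centred s H E c" and reg: "almost_regular \<epsilon> k r V H E c"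
      using st[rule_format, OF V nn(1) H np2] by (elim exE conjE)
    note cH = reg[unfolded almost_regular_def, THEN conjunct1] and rich = reg[unfolded almost_regular_def, THEN conjunct2]
    let ?N = "nb E c"
    define F where "F = {f\<in>ksub V (r - 1). card (?N f) = k - 1}"
    define Fb where "Fb = {f\<in>ksub V q. card (?N f) \<noteq> k - 1}"
    define T where "T = {h\<in>ksub V r. h \<notin> H \<and> (\<exists>f\<in>F. \<exists>f'\<in>F. f \<subseteq> h \<and> f' \<subseteq> h \<and> ?N f \<noteq> ?N f')}"
    define Hb where "Hb = H \<union> T"
    have "real ((k - 1) * (?n choose (r - 1))) \<le> real (card H + (k - 1) * (k - 1) * ?n ^ (r - 2))"
      using big unfolding large_def by (rule of_nat_mono)
    then have "real ((k - 1) * (?n choose (r - 1))) \<le> real (card H) + real ((k - 1) * (k - 1)) * real ?n ^ (q - 1)"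
      unfolding q(4) by simp
    moreover have "real ((k - 1) * (k - 1)) * real ?n ^ (q - 1) \<le> \<epsilon> * real ?n ^ q" using n2[OF nn(2)] unfolding q(5) .
    ultimately have poor: "real (card {f\<in>ksub V q. card (?N f) < k - 1}) \<le> 2 * (\<epsilon> * real ?n ^ q)"
      using cH unfolding q(3) by linarith
    have "Fb \<subseteq> {f\<in>ksub V q. card (?N f) < k - 1} \<union> {f\<in>ksub V q. k \<le> card (?N f)}" by (auto simp: Fb_def)
    then have "card Fb \<le> card ({f\<in>ksub V q. card (?N f) < k - 1} \<union> {f\<in>ksub V q. k \<le> card (?N f)})"
      using V by (intro card_mono) auto
    also have "\<dots> \<le> card {f\<in>ksub V q. card (?N f) < k - 1} + card {f\<in>ksub V q. k \<le> card (?N f)}" by (rule card_Un_le)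
    finally have cFb: "real (card Fb) \<le> 3 * \<epsilon> * real ?n ^ q" using poor rich unfolding q(3) by linarith
    have "card H \<le> fur r s * ?n ^ (r - 1)" by (rule path_free_size_power[OF a1 b1 ab(3) s2 V H np])
    moreover have "card T \<le> 2 ^ (r + 2 * k) * (?n * (fur r s * ?n ^ (r - 2)))"
      unfolding T_def by (rule few_mixed[OF ab k s V H np cen F_def])
    moreover have "?n * (fur r s * ?n ^ (r - 2)) = fur r s * ?n ^ q"
      unfolding q(4) by (metis q(5) mult.left_commute power_Suc)
    ultimately have "card Hb \<le> CH * ?n ^ q"
      using card_Un_le[of H T] unfolding Hb_def CH_def q(3) by (simp add: algebra_simps)
    then have Hbn: "(card Hb + (q + 1) * ?n ^ q) \<le> (CH + q + 1) * ?n ^ q" by (simp add: algebra_simps)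
    have "\<exists>W. card {f\<in>ksub V q. f \<in> Fb \<or> ?N f \<noteq> W} * ?n ^ q \<le> (q + 1) * (card Fb * q ^ q * ?n ^ q) +
      q * ((card Hb + (q + 1) * ?n ^ q) * (q + 1) ^ (q + 1) * ?n ^ (q - 1))"
    proof (rule almost_constant[OF V Vne q(1)])
      show "Fb \<subseteq> ksub V q" by (auto simp: Fb_def)
      show "Hb \<subseteq> ksub V (Suc q)" using H q(2) by (auto simp: Hb_def T_def)
      fix h f f' assume *: "h \<in> ksub V (Suc q)" "h \<notin> Hb" "f \<in> ksub V q" "f' \<in> ksub V q" "f \<notin> Fb" "f' \<notin> Fb" "f \<subseteq> h" "f' \<subseteq> h"
      then have "f \<in> F" "f' \<in> F" using q(3) by (auto simp: F_def Fb_def)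
      then show "?N f = ?N f'" using *(1,2,7,8) unfolding Hb_def T_def q(2) by blast
    qed
    then obtain W where W: "card {f\<in>ksub V q. f \<in> Fb \<or> ?N f \<noteq> W} * ?n ^ q \<le> (q + 1) * (card Fb * q ^ q * ?n ^ q) +
      q * ((card Hb + (q + 1) * ?n ^ q) * (q + 1) ^ (q + 1) * ?n ^ (q - 1))" by blast
    let ?S = "{f\<in>ksub V q. f \<in> Fb \<or> ?N f \<noteq> W}"
    have "(q + 1) * (card Fb * q ^ q * ?n ^ q) = K1 * card Fb * ?n ^ q" by (simp only: K1_def mult_ac)
    have "q * ((card Hb + (q + 1) * ?n ^ q) * (q + 1) ^ (q + 1) * ?n ^ (q - 1))
        \<le> q * ((CH + q + 1) * ?n ^ q * (q + 1) ^ (q + 1) * ?n ^ (q - 1))"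
      by (intro mult_le_mono2 mult_le_mono1 Hbn)
    also have "\<dots> = K2 * (CH + q + 1) * ?n ^ (q - 1) * ?n ^ q" by (simp only: K2_def mult_ac)
    finally have "card ?S * ?n ^ q \<le> K1 * card Fb * ?n ^ q + K2 * (CH + q + 1) * ?n ^ (q - 1) * ?n ^ q"
      using W \<open>(q + 1) * (card Fb * q ^ q * ?n ^ q) = K1 * card Fb * ?n ^ q\<close> by linarith
    then have "card ?S * ?n ^ q \<le> (K1 * card Fb + K2 * (CH + q + 1) * ?n ^ (q - 1)) * ?n ^ q"
      by (simp only: distrib_right)
    then have "0 < ?n ^ q \<longrightarrow> card ?S \<le> K1 * card Fb + K2 * (CH + q + 1) * ?n ^ (q - 1)"
      by (simp only: mult_le_cancel2)
    moreover have "0 < ?n ^ q" using V Vne by (simp add: card_gt_0_iff)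
    ultimately have "card ?S \<le> K1 * card Fb + K2 * (CH + q + 1) * ?n ^ (q - 1)" by (rule mp)
    then have "real (card ?S) \<le> real (K1 * card Fb + K2 * (CH + q + 1) * ?n ^ (q - 1))" by (rule of_nat_mono)
    then have "real (card ?S) \<le> real K1 * real (card Fb) + real (K2 * (CH + q + 1)) * real ?n ^ (q - 1)" by simp
    moreover have "real (K2 * (CH + q + 1)) * real ?n ^ (q - 1) \<le> \<delta>' / 2 * real ?n ^ q" using n3[OF nn(3)] unfolding q(5) .
    moreover have "real K1 * real (card Fb) \<le> real K1 * (3 * \<epsilon> * real ?n ^ q)" using cFb by (intro mult_left_mono) auto
    moreover have "real K1 * (3 * \<epsilon> * real ?n ^ q) = \<delta>' / 2 * real ?n ^ q" unfolding eps(2)[symmetric] by simp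
    ultimately have cS: "real (card ?S) \<le> \<delta>' * real ?n ^ q" by linarith
    have "\<delta>' * real ?n ^ q < 1 / (2 * real q) ^ q * real ?n ^ q" using d'3 Vne V by (intro mult_strict_right_mono) (auto simp: card_gt_0_iff)
    also have "\<dots> = (real ?n / (2 * real q)) ^ q" by (simp add: power_divide)
    also have "\<dots> \<le> real ((?n - 0) choose q)" by (rule choose_lower[OF q(1)]) (use nn in auto)
    also have "\<dots> = real (card (ksub V q))" using V by (simp add: card_ksub)
    finally have "card ?S < card (ksub V q)" using cS by linarith
    moreover have "finite ?S" using V by simp
    ultimately have "\<not> ksub V q \<subseteq> ?S" using card_mono[of ?S "ksub V q"] by linarith
    then obtain f where f: "f \<in> ksub V q" "f \<notin> Fb" "?N f = W" by blast
    have cW: "card W = k - 1" using f by (auto simp: Fb_def)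
    have EH: "E \<subseteq> H" using cen by (simp add: centred_def)
    have WV: "W \<subseteq> V" using nb_subset[OF V H EH] f(3) by blast
    have "W \<noteq> {}" using cW k by auto
    then obtain w where w: "w \<in> W" by blast
    have "in_star s H W f" if f: "f \<in> ksub V q" "f \<notin> Fb" "?N f = W" for f
    proof -
      have v: "v \<notin> f" "insert v f \<in> E" "c (insert v f) = v" if "v \<in> W" for v using that f(3) by (auto simp: nb_def)
      have "\<not> kernel s H (insert w f - {c (insert w f)})" using cen v(2)[OF w] unfolding centred_def by blast
      then have "\<not> kernel s H f" using v[OF w] by simp
      then show ?thesis using v EH unfolding in_star_def by blast
    qed
    then have "{f\<in>ksub V q. \<not> in_star s H W f} \<subseteq> ?S" by blast
    then have "card {f\<in>ksub V q. \<not> in_star s H W f} \<le> card ?S" using V by (intro card_mono) auto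
    then have "real (card {f\<in>ksub V q. \<not> in_star s H W f}) \<le> \<delta>' * real ?n ^ q" using cS by linarith
    also have "\<dots> \<le> \<delta> * real ?n ^ q" using d'(2) by (intro mult_right_mono) auto
    finally show ?thesis using WV cW unfolding unstarred_def q(3) by blast
  qed
  show ?thesis
  proof (rule exI[of _ s], rule exI[of _ n0], intro conjI allI impI)
    show "(2 * k + 5) * r \<le> s" by (rule s)
  qed (rule main)
qed

section \<open>Edges that avoid the centres\<close>

text \<open>All extensions of an uncovered \<open>t\<close>-set by \<open>b\<close> vertices are
  missing from \<open>F\<close>, and a \<open>(t + b)\<close>-set has at most
  \<open>2 ^ (t + b)\<close> subsets.\<close>

lemma uncovered_count:
  assumes V: "finite V" and F: "F \<subseteq> ksub V (t + b)"
  shows "card {g\<in>ksub V t. \<forall>f\<in>F. \<not> g \<subseteq> f} * ((card V - t) choose b) \<le> 2 ^ (t + b) * card (ksub V (t + b) - F)"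
proof (rule double_count[where R="\<lambda>g f. g \<subseteq> f"])
  fix g assume g: "g \<in> {g\<in>ksub V t. \<forall>f\<in>F. \<not> g \<subseteq> f}"
  then have gV: "g \<subseteq> V" "card g = t" "finite g" using V finite_subset by (auto simp: ksub_def)
  have "inj_on (\<lambda>y. g \<union> y) (ksub (V - g) b)"
  proof (rule inj_onI)
    fix y z assume "y \<in> ksub (V - g) b" "z \<in> ksub (V - g) b" "g \<union> y = g \<union> z"
    moreover from this have "y = (g \<union> y) - g" "z = (g \<union> z) - g" by (auto simp: ksub_def)
    ultimately show "y = z" by metis
  qed
  moreover have "(\<lambda>y. g \<union> y) ` ksub (V - g) b \<subseteq> {f\<in>ksub V (t + b) - F. g \<subseteq> f}"
  proof (rule image_subsetI)
    fix y assume y: "y \<in> ksub (V - g) b"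
    then have "finite y" using V finite_subset[of y "V - g"] by (auto simp: ksub_def)
    then have "card (g \<union> y) = t + b" using y gV by (subst card_Un_disjoint) (auto simp: ksub_def)
    moreover have "g \<union> y \<notin> F" using g by blast
    ultimately show "g \<union> y \<in> {f\<in>ksub V (t + b) - F. g \<subseteq> f}" using gV(1) y by (auto simp: ksub_def)
  qed
  ultimately have "card (ksub (V - g) b) \<le> card {f\<in>ksub V (t + b) - F. g \<subseteq> f}"
    using V by (intro card_inj_on_le) auto
  then show "(card V - t) choose b \<le> card {f\<in>ksub V (t + b) - F. g \<subseteq> f}"
    using V gV by (simp add: card_ksub card_Diff_subset)
next
  fix f assume "f \<in> ksub V (t + b) - F"
  then have f: "finite f" "card f = t + b" using V finite_subset by (auto simp: ksub_def)
  have "card {g\<in>{g\<in>ksub V t. \<forall>f\<in>F. \<not> g \<subseteq> f}. g \<subseteq> f} \<le> card (Pow f)" using f(1) by (intro card_mono) auto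
  then show "card {g\<in>{g\<in>ksub V t. \<forall>f\<in>F. \<not> g \<subseteq> f}. g \<subseteq> f} \<le> 2 ^ (t + b)" using f by (simp add: card_Pow)
qed (use V in auto)

text \<open>An edge \<open>e\<close> avoiding the centres \<open>W\<close> provides the first edge of a path whose other edges
  come from the stars.\<close>
lemma outside_edge_path:
  assumes G: "clean_fam G W (k - 1) s b a" "G \<subseteq> H" and k: "2 \<le> k" and s: "(2 * k + 5) * (a + b) \<le> s" and a1: "1 \<le> a"
    and e: "e \<in> H" "finite e" "card e = a + b" "e \<inter> W = {}" and B: "B \<subseteq> e" "card B = b"
    and g: "g \<inter> e = {}" "finite g" "card g = a - 1" "g \<subseteq> f" "f \<inter> W = {}" and v: "v \<in> W" "insert v f \<in> G"
    and eH: "insert v (B \<union> g) \<in> H"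
  shows "has_path H (2 * k - 1) a b"
proof -
  define Bl where "Bl i = (if i = 0 then B else insert v g)" for i :: nat
  have fB: "finite B" using B(1) e(2) by (rule finite_subset)
  have vg: "v \<notin> g" "v \<notin> e" using v(1) g(4,5) e(4) by auto
  have p: "path_in H 1 b a Bl"
    unfolding path_in_def
  proof (intro conjI allI impI)
    fix i :: nat assume "i \<le> 1"
    then have "i = 0 \<or> i = 1" by auto
    then show "finite (Bl i)" "card (Bl i) = (if even i then b else a)"
      using fB B(2) g(2,3) vg(1) a1 by (auto simp: Bl_def)
  next
    fix i j :: nat assume "i \<le> 1" "j \<le> 1" "i \<noteq> j"
    then have "i = 0 \<and> j = 1 \<or> i = 1 \<and> j = 0" by auto
    then show "Bl i \<inter> Bl j = {}" using g(1) B(1) vg(2) by (auto simp: Bl_def)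
  next
    fix i :: nat assume "i < 1"
    then show "Bl i \<union> Bl (Suc i) \<in> H" using eH by (simp add: Bl_def Un_commute)
  qed
  have u: "(\<Union>i\<le>1. Bl i) = B \<union> insert v g" by (auto simp: Bl_def le_Suc_eq)
  have uW: "(B \<union> insert v g) \<inter> W = {v}" using B(1) e(4) g(4,5) v(1) by blast
  \<comment> \<open>The rest of \<open>e\<close> is reserved as the block in front of
    \<open>B\<close>, so the walk has to avoid it.\<close>
  let ?U = "e - B"
  have cU: "finite ?U" "card ?U = a" using e(2,3) B fB by (simp_all add: card_Diff_subset)
  have "a + (1 + 2 * (k - 2) + 1) * (b + a) \<le> (2 * k + 5) * (a + b)"
  proof -
    have "a + (1 + 2 * (k - 2) + 1) * (b + a) \<le> (1 + (1 + 2 * (k - 2) + 1)) * (a + b)" by (simp add: algebra_simps)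
    also have "\<dots> \<le> (2 * k + 5) * (a + b)" by (intro mult_le_mono1) simp
    finally show ?thesis .
  qed
  then have sU: "card ?U + (1 + 2 * (k - 2) + 1) * (b + a) \<le> s" using s cU(2) by linarith
  \<comment> \<open>The block \<open>insert v g\<close> already uses the centre \<open>v\<close>, so
    \<open>k - 2\<close> double steps remain.\<close>
  have c1: "card ((\<Union>i\<le>1. Bl i) \<inter> W) + (k - 2) \<le> k - 1" unfolding u uW using k by simp
  have o: "odd (1::nat)" by simp
  have B1: "Bl 1 \<subseteq> insert v f" "insert v f \<inter> W \<subseteq> Bl 1" using g(4,5) by (auto simp: Bl_def)
  have UW: "?U \<inter> W = {}" using e(4) by blast
  obtain Bl' where Bl': "path_in H (1 + 2 * (k - 2) + 1) b a Bl'" "\<forall>i\<le>1. Bl' i = Bl i"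
     "(\<Union>i\<le>1 + 2 * (k - 2) + 1. Bl' i) \<inter> ?U \<subseteq> (\<Union>i\<le>1. Bl i)"
    using walk[OF G p o v(2) B1 cU(1) sU UW c1] by (elim exE conjE)
  have m: "1 + 2 * (k - 2) + 1 = 2 * k - 2" using k by simp
  have Bl0: "Bl' 0 = B" using Bl'(2) by (simp add: Bl_def)
  have "?U \<inter> (B \<union> insert v g) = {}" using g(1) vg(2) by blast
  then have disj: "?U \<inter> (\<Union>i\<le>2 * k - 2. Bl' i) = {}" using Bl'(3) unfolding m u by blast
  have "?U \<union> Bl' 0 = e" using B(1) Bl0 by blast
  then have "path_in H (Suc (2 * k - 2)) a b (case_nat ?U Bl')"
    using path_in_Cons[OF Bl'(1)[unfolded m] cU disj] e(1) by simp
  moreover have "Suc (2 * k - 2) = 2 * k - 1" using k by simp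
  ultimately show ?thesis unfolding has_path_def by auto
qed

text \<open>An own subset \<open>e - {x e}\<close> has \<open>a + b - 1 \<ge> 2 * b\<close>
  vertices, so it splits into two disjoint members of \<open>D\<close> and \<open>a - 1 - b\<close>
  further vertices. A bound quadratic in \<open>card D\<close> is what is needed against the linear
  lower bound of \<open>many_missing\<close>.\<close>

lemma path_free_shadow:
  assumes ab: "b < a" "1 \<le> b" "r = a + b" and s: "2 * r \<le> s" "(m + 1) * r \<le> s"
    and V: "finite V" and M: "M \<subseteq> ksub V r" and np: "\<not> has_path M m a b"
    and D: "D = {B\<in>ksub V b. \<exists>e\<in>M. B \<subseteq> e}"
  shows "card M \<le> fur r s * (card D * (card D * card V ^ (a - 1 - b)))"
proof -
  have a1: "1 \<le> a" using ab by simp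
  obtain Ms x where Ms: "Ms \<subseteq> M" "\<forall>e\<in>Ms. x e \<in> e" "inj_on (\<lambda>e. e - {x e}) Ms" "card M \<le> fur r s * card Ms"
    using own_subsets[OF a1 ab(2,3) s V M np] by blast
  have "\<exists>p. fst p \<union> (fst (snd p) \<union> snd (snd p)) = e - {x e} \<and> fst p \<in> D \<and> fst (snd p) \<in> D \<and> snd (snd p) \<in> ksub V (a - 1 - b)"
    if e: "e \<in> Ms" for e
  proof -
    have eM: "e \<in> M" using e Ms(1) by blast
    note ed = ksub_edge[OF V M eM]
    let ?f = "e - {x e}"
    have f: "finite ?f" "card ?f = a + b - 1" using ed Ms(2) e ab by auto
    then have "b \<le> card ?f" using ab by simp
    then obtain B1 where B1: "B1 \<subseteq> ?f" "card B1 = b" "finite B1" by (rule obtain_subset_with_card_n)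
    have c1: "card (?f - B1) = a - 1" using B1 f by (simp add: card_Diff_subset)
    then have "b \<le> card (?f - B1)" using ab by simp
    then obtain B2 where B2: "B2 \<subseteq> ?f - B1" "card B2 = b" "finite B2" by (rule obtain_subset_with_card_n)
    have "card (?f - B1 - B2) = a - 1 - b" using B2 c1 by (simp add: card_Diff_subset)
    moreover have "B1 \<in> D" "B2 \<in> D" using B1 B2 ed(3) eM by (auto simp: D ksub_def)
    moreover have "?f - B1 - B2 \<subseteq> V" using ed(3) by blast
    moreover have "B1 \<union> (B2 \<union> (?f - B1 - B2)) = ?f" using B1(1) B2(1) by blast
    ultimately show ?thesis by (intro exI[of _ "(B1, B2, ?f - B1 - B2)"]) (simp add: ksub_def)
  qed
  then obtain p where p: "\<And>e. e \<in> Ms \<Longrightarrow> fst (p e) \<union> (fst (snd (p e)) \<union> snd (snd (p e))) = e - {x e} \<and> fst (p e) \<in> D \<and> fst (snd (p e)) \<in> D \<and> snd (snd (p e)) \<in> ksub V (a - 1 - b)"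
    by metis
  have "inj_on p Ms"
  proof (rule inj_onI)
    fix e e' assume "e \<in> Ms" "e' \<in> Ms" "p e = p e'"
    then have "e - {x e} = e' - {x e'}" using p by metis
    then show "e = e'" using inj_onD[OF Ms(3)] \<open>e \<in> Ms\<close> \<open>e' \<in> Ms\<close> by blast
  qed
  moreover have "p ` Ms \<subseteq> D \<times> (D \<times> ksub V (a - 1 - b))"
  proof (rule image_subsetI)
    fix e assume "e \<in> Ms"
    from p[OF this] show "p e \<in> D \<times> (D \<times> ksub V (a - 1 - b))" by (simp add: mem_Times_iff)
  qed
  moreover have "finite D" using V by (simp add: D)
  ultimately have "card Ms \<le> card (D \<times> (D \<times> ksub V (a - 1 - b)))" using V by (intro card_inj_on_le) auto
  also have "\<dots> = card D * (card D * card (ksub V (a - 1 - b)))" by (simp add: card_cartesian_product)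
  also have "\<dots> \<le> card D * (card D * card V ^ (a - 1 - b))" using V by (intro mult_le_mono2 card_ksub_le)
  finally have "fur r s * card Ms \<le> fur r s * (card D * (card D * card V ^ (a - 1 - b)))" by (rule mult_le_mono2)
  then show ?thesis using Ms(4) by linarith
qed

section \<open>The exact result\<close>

text \<open>Removing a vertex of \<open>W\<close> from a missing edge leaves a set whose star at
  \<open>W\<close> is incomplete, and this vertex and set determine the edge.\<close>

lemma few_missing:
  assumes V: "finite V" and W: "finite W"
  shows "card {e\<in>ksub V r. e \<inter> W \<noteq> {} \<and> e \<notin> H} \<le> card W * card (unstarred s r V H W)"
proof -
  let ?M = "{e\<in>ksub V r. e \<inter> W \<noteq> {} \<and> e \<notin> H}" and ?F = "unstarred s r V H W"
  have "?M \<subseteq> (\<lambda>(w, f). insert w f) ` (W \<times> ?F)"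
  proof
    fix e assume e: "e \<in> ?M"
    then obtain w where w: "w \<in> e" "w \<in> W" by blast
    have "insert w (e - {w}) \<notin> H" using e w by (simp add: insert_absorb)
    then have "\<not> in_star s H W (e - {w})" using w(2) unfolding in_star_def by blast
    moreover have "e - {w} \<in> ksub V (r - 1)" using ksub_remove[OF V _ w(1)] e by blast
    moreover have "e = insert w (e - {w})" using w by blast
    ultimately show "e \<in> (\<lambda>(w, f). insert w f) ` (W \<times> ?F)" using w by (intro image_eqI[of _ _ "(w, e - {w})"]) (auto simp: unstarred_def)
  qed
  moreover have "finite (W \<times> ?F)" using V W by (simp add: unstarred_def)
  ultimately have "card ?M \<le> card (W \<times> ?F)" by (rule surj_card_le[rotated])
  then show ?thesis by (simp add: card_cartesian_product)
qed

text \<open>For \<open>B\<close> inside an edge \<open>e\<close> avoiding \<open>W\<close>, every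
  \<open>insert v (B \<union> g)\<close> with \<open>g\<close> covered by \<open>F\<close> and
  disjoint from \<open>e\<close> and \<open>W\<close> is missing from \<open>H\<close>, by
  \<open>outside_edge_path\<close>. Different \<open>g\<close> give different missing edges, and
  each missing edge contains at most \<open>2 ^ r\<close> sets \<open>B\<close>.\<close>

lemma many_missing:
  assumes V: "finite V" and ab: "1 \<le> a" "1 \<le> b" "r = a + b" and k: "2 \<le> k" and s: "(2 * k + 5) * r \<le> s"
    and H: "H \<subseteq> ksub V r" and np: "\<not> has_path H (2 * k - 1) a b"
    and W: "W \<subseteq> V" "card W = k - 1" and G: "clean_fam G W (k - 1) s b a" "G \<subseteq> H"
    and F: "\<And>f. f \<in> F \<Longrightarrow> f \<inter> W = {}" "\<And>f v. f \<in> F \<Longrightarrow> v \<in> W \<Longrightarrow> insert v f \<in> G"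
    and M: "M = {e\<in>H. e \<inter> W = {}}" and D: "D = {B\<in>ksub V b. \<exists>e\<in>M. B \<subseteq> e}"
  shows "card D * (((card V - (k - 1 + r)) choose (a - 1)) - card {g\<in>ksub V (a - 1). \<forall>f\<in>F. \<not> g \<subseteq> f})
     \<le> 2 ^ r * card {e\<in>ksub V r. e \<inter> W \<noteq> {} \<and> e \<notin> H}"
proof (rule double_count[where R="\<lambda>B e. B \<subseteq> e"])
  let ?bad = "{g\<in>ksub V (a - 1). \<forall>f\<in>F. \<not> g \<subseteq> f}" and ?M = "{e\<in>ksub V r. e \<inter> W \<noteq> {} \<and> e \<notin> H}"
  have finW: "finite W" using W(1) V by (rule finite_subset)
  have "W \<noteq> {}" using W(2) k by auto
  then obtain v where v: "v \<in> W" by blast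
  fix B assume "B \<in> D"
  then obtain e where B: "B \<subseteq> V" "card B = b" "B \<subseteq> e" and e: "e \<in> H" "e \<inter> W = {}"
    by (auto simp: D M ksub_def)
  note ed = ksub_edge[OF V H e(1)]
  have fB: "finite B" using B(3) ed(1) by (rule finite_subset)
  let ?R = "V - W - e"
  have finR: "finite ?R" using V by simp
  have cR: "card V - (k - 1 + r) \<le> card ?R"
    using diff_card_le_card_Diff[OF ed(1), of "V - W"] diff_card_le_card_Diff[OF finW, of V] W(2) ed(2) by linarith
  let ?g = "\<lambda>g. insert v (B \<union> g)"
  have "inj_on ?g (ksub ?R (a - 1) - ?bad)"
  proof (rule inj_onI)
    fix g g' assume g: "g \<in> ksub ?R (a - 1) - ?bad" "g' \<in> ksub ?R (a - 1) - ?bad" and eq: "?g g = ?g g'"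
    have key: "h = ?g h - (W \<union> e)" if "h \<in> ksub ?R (a - 1) - ?bad" for h
    proof -
      have "h \<subseteq> ?R" using that by (simp add: ksub_def)
      then show ?thesis using v B(3) by blast
    qed
    have "g = ?g g - (W \<union> e)" by (rule key[OF g(1)])
    also have "\<dots> = g'" unfolding eq by (rule key[OF g(2), symmetric])
    finally show "g = g'" .
  qed
  moreover have "?g ` (ksub ?R (a - 1) - ?bad) \<subseteq> {e'\<in>?M. B \<subseteq> e'}"
  proof (rule image_subsetI)
    fix g assume g: "g \<in> ksub ?R (a - 1) - ?bad"
    then have gR: "g \<subseteq> ?R" "card g = a - 1" by (auto simp: ksub_def)
    have fg: "finite g" using gR(1) finR by (rule finite_subset)
    have "g \<in> ksub V (a - 1)" using gR by (auto simp: ksub_def)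
    then obtain f where f: "f \<in> F" "g \<subseteq> f" using g by blast
    have "card (B \<union> g) = b + (a - 1)" using fB fg B gR by (subst card_Un_disjoint) auto
    moreover have "v \<notin> B \<union> g" using v B(3) e(2) gR(1) by blast
    ultimately have c: "card (?g g) = r" using fB fg ab by simp
    have nH: "?g g \<notin> H"
    proof
      assume gH: "?g g \<in> H"
      have "has_path H (2 * k - 1) a b"
        by (rule outside_edge_path[OF G k _ ab(1) e(1) ed(1) _ e(2) B(3,2) _ fg gR(2) f(2) F(1)[OF f(1)] v F(2)[OF f(1) v] gH])
          (use s ab(3) ed(2) gR(1) in auto)
      then show False using np by blast
    qed
    have "?g g \<in> ksub V r" using c B(1) gR(1) W(1) v by (auto simp: ksub_def)
    then show "?g g \<in> {e'\<in>?M. B \<subseteq> e'}" using nH v by auto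
  qed
  moreover have "finite {e'\<in>?M. B \<subseteq> e'}" using V by simp
  ultimately have "card (ksub ?R (a - 1) - ?bad) \<le> card {e'\<in>?M. B \<subseteq> e'}" by (rule card_inj_on_le)
  moreover have "card (ksub ?R (a - 1)) - card ?bad \<le> card (ksub ?R (a - 1) - ?bad)"
    using V by (intro diff_card_le_card_Diff) simp
  moreover have "(card V - (k - 1 + r)) choose (a - 1) \<le> card (ksub ?R (a - 1))"
    unfolding card_ksub[OF finR] using cR by (rule binomial_right_mono)
  ultimately show "((card V - (k - 1 + r)) choose (a - 1)) - card ?bad \<le> card {e'\<in>?M. B \<subseteq> e'}" by linarith
next
  fix e assume "e \<in> {e\<in>ksub V r. e \<inter> W \<noteq> {} \<and> e \<notin> H}"
  then have e: "finite e" "card e = r" using V finite_subset by (auto simp: ksub_def)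
  have "card {B\<in>D. B \<subseteq> e} \<le> card (Pow e)" using e(1) by (intro card_mono) auto
  then show "card {B\<in>D. B \<subseteq> e} \<le> 2 ^ r" using e by (simp add: card_Pow)
qed (use V in \<open>auto simp: D\<close>)

text \<open>Here \<open>d\<close> is the size of the \<open>b\<close>-shadow of the edges outside
  the stars, of which there are \<open>M\<close>, and \<open>N\<close> is the number of missing edges.\<close>
lemma shadow_vanishes:
  fixes n P \<delta> K :: real and d M N :: nat
  assumes n: "0 < n" and P: "0 < P" and w: "0 \<le> w" and q: "q = a - 1 + b" "b \<le> a - 1"
    and small: "2 ^ r * 2 * K * (2 ^ r * 2 * w * \<delta>) < P * P"
    and low: "real d * (P / 2 * n ^ (a - 1)) \<le> 2 ^ r * real N" and up: "real N \<le> w * (\<delta> * n ^ q)"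
    and M: "real M \<le> K * (real d * (real d * n ^ (a - 1 - b)))" and NM: "N \<le> M" and K: "0 \<le> K"
  shows "d = 0"
proof (rule ccontr)
  assume "d \<noteq> 0"
  then have d: "0 < real d" by simp
  have nq1: "n ^ q = n ^ (a - 1) * n ^ b" unfolding q(1) by (rule power_add)
  have "a - 1 = (a - 1 - b) + b" using q(2) by simp
  then have "n ^ (a - 1) = n ^ (a - 1 - b) * n ^ b" by (metis power_add)
  note nq = nq1 this
  have pos: "0 < n ^ (a - 1)" "0 < n ^ b" "0 < n ^ (a - 1 - b)" using n by simp_all
  have "2 ^ r * real N \<le> 2 ^ r * (w * (\<delta> * n ^ q))" using up by (intro mult_left_mono) auto
  then have "real d * (P / 2 * n ^ (a - 1)) \<le> 2 ^ r * (w * (\<delta> * n ^ q))" using low by linarith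
  then have "(real d * P) * n ^ (a - 1) \<le> (2 ^ r * 2 * w * \<delta> * n ^ b) * n ^ (a - 1)"
    unfolding nq(1) by (simp add: algebra_simps)
  \<comment> \<open>The stability bound on missing edges makes \<open>d\<close> at most a constant
    times \<open>\<delta> * n ^ b\<close>.\<close>
  then have dP: "real d * P \<le> 2 ^ r * 2 * w * \<delta> * n ^ b" using pos(1) by simp
  have "real N \<le> K * (real d * (real d * n ^ (a - 1 - b)))" using M NM by linarith
  then have "2 ^ r * real N \<le> 2 ^ r * (K * (real d * (real d * n ^ (a - 1 - b))))" by (intro mult_left_mono) auto
  then have "real d * (P / 2 * n ^ (a - 1)) \<le> 2 ^ r * (K * (real d * (real d * n ^ (a - 1 - b))))" using low by linarith
  then have "(P * n ^ b) * (real d * n ^ (a - 1 - b)) \<le> (2 ^ r * 2 * K * real d) * (real d * n ^ (a - 1 - b))"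
    unfolding nq(2) by (simp add: algebra_simps)
  \<comment> \<open>The missing edges number at most \<open>M\<close>, which is quadratic in
    \<open>d\<close>. Cancelling one factor \<open>d\<close> bounds \<open>d\<close> below by a
    multiple of \<open>n ^ b\<close> independent of \<open>\<delta>\<close>.\<close>
  then have Pd: "P * n ^ b \<le> 2 ^ r * 2 * K * real d" using d pos(3) by (simp add: mult_le_cancel_right)
  then have "P * (P * n ^ b) \<le> P * (2 ^ r * 2 * K * real d)" using P by (intro mult_left_mono) auto
  also have "\<dots> = 2 ^ r * 2 * K * (real d * P)" by simp
  also have "\<dots> \<le> 2 ^ r * 2 * K * (2 ^ r * 2 * w * \<delta> * n ^ b)" using dP K by (intro mult_left_mono) auto
  also have "\<dots> = 2 ^ r * 2 * K * (2 ^ r * 2 * w * \<delta>) * n ^ b" by simp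
  also have "\<dots> < P * P * n ^ b" using small pos(2) by (intro mult_strict_right_mono)
  finally show False by simp
qed

text \<open>Comparison with the star of the set \<open>W\<close> found by stability shows that at
  most as many edges are missing at \<open>W\<close> as there are edges avoiding \<open>W\<close>.
  For a nonempty shadow this contradicts \<open>many_missing\<close> and
  \<open>path_free_shadow\<close> together.\<close>

lemma exact_structure:
  fixes a b r k :: nat
  assumes ab: "b < a" "2 \<le> b" "r = a + b" and k: "2 \<le> k"
  shows "\<exists>n0. \<forall>(V::'a set) H. finite V \<longrightarrow> n0 \<le> card V \<longrightarrow> H \<subseteq> ksub V r \<longrightarrow> \<not> has_path H (2 * k - 1) a b \<longrightarrow>
     large k r V H \<longrightarrow>
     (\<forall>W\<subseteq>V. card W = k - 1 \<longrightarrow> card {e\<in>ksub V r. e \<inter> W \<noteq> {}} \<le> card H) \<longrightarrow>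
     (\<exists>W\<subseteq>V. card W = k - 1 \<and> H = {e\<in>ksub V r. e \<inter> W \<noteq> {}})"
proof -
  have a1: "1 \<le> a" and b1: "1 \<le> b" and t1: "1 \<le> a - 1" using ab by simp_all
  define q where "q = r - 1"
  have q: "r - 1 = q" "a - 1 + b = q" "Suc (r - 2) = q" using ab by (simp_all add: q_def)
  \<comment> \<open>\<open>K\<close> enters the choice of \<open>\<delta>\<close>, while the
    \<open>s\<close> returned by \<open>stability\<close> depends on \<open>\<delta>\<close>. A
    separate \<open>s0\<close> for the shadow bound avoids this circle.\<close>
  define s0 where "s0 = (2 * k + 5) * r"
  define K where "K = real (fur r s0)"
  define P where "P = (1 / (2 * real (a - 1))) ^ (a - 1)"
  define P' where "P' = (1 / (2 * real b)) ^ b"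
  have P: "0 < P" "0 < P'" using t1 b1 by (simp_all add: P_def P'_def)
  define w where "w = real (k - 1)"
  define L where "L = 2 ^ r * 2 * K * (2 ^ r * 2 * w)"
  have L: "0 \<le> L" "0 \<le> K" "0 \<le> w" by (simp_all add: L_def K_def w_def)
  \<comment> \<open>The first bound is the smallness required by \<open>shadow_vanishes\<close>. The
    second keeps the uncovered \<open>(a - 1)\<close>-sets below half of the guaranteed number of
    candidates \<open>g\<close> in \<open>many_missing\<close>.\<close>
  define \<delta> where "\<delta> = min (P * P / (L + 1)) (P * P' / (4 * 2 ^ q))"
  have delta: "0 < \<delta>" using P L by (simp add: \<delta>_def)
  have d1: "\<delta> * (L + 1) \<le> P * P" and d2: "\<delta> * (4 * 2 ^ q) \<le> P * P'"
  proof -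
    have "\<delta> \<le> P * P / (L + 1)" "\<delta> \<le> P * P' / (4 * 2 ^ q)" unfolding \<delta>_def by (rule min.cobounded1 min.cobounded2)+
    then show "\<delta> * (L + 1) \<le> P * P" "\<delta> * (4 * 2 ^ q) \<le> P * P'" using L(1) by (simp_all add: pos_le_divide_eq)
  qed
  have "L * \<delta> < P * P" using d1 delta by (simp add: algebra_simps)
  then have small: "2 ^ r * 2 * K * (2 ^ r * 2 * w * \<delta>) < P * P" by (simp add: L_def mult_ac)
  obtain s n1 where s: "(2 * k + 5) * r \<le> s" and st: "\<forall>(V::'a set) H. finite V \<longrightarrow> n1 \<le> card V \<longrightarrow> H \<subseteq> ksub V r \<longrightarrow>
     \<not> has_path H (2 * k - 1) a b \<longrightarrow>
     large k r V H \<longrightarrow>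
     (\<exists>W\<subseteq>V. card W = k - 1 \<and> real (card (unstarred s r V H W)) \<le> \<delta> * real (card V) ^ (r - 1))"
    using stability[OF ab k delta, where 'a='a] by (elim exE conjE)
  obtain n2 where n2: "\<And>n. n2 \<le> n \<Longrightarrow> real (fur r s) * real n ^ (r - 2) \<le> \<delta> * real n ^ Suc (r - 2)"
    using eventually_power_le[OF delta] by blast
  define n0 where "n0 = max (max n1 n2) (2 * (k + r))"
  note s2 = size_bounds(1,3)[OF s] and s02 = size_bounds(1,3)[OF eq_refl[OF s0_def[symmetric]]]
  have main: "\<exists>W\<subseteq>V. card W = k - 1 \<and> H = {e\<in>ksub V r. e \<inter> W \<noteq> {}}"
    if V: "finite V" and n: "n0 \<le> card V" and H: "H \<subseteq> ksub V r" and np: "\<not> has_path H (2 * k - 1) a b"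
      and big: "large k r V H"
      and ext: "\<forall>W\<subseteq>V. card W = k - 1 \<longrightarrow> card {e\<in>ksub V r. e \<inter> W \<noteq> {}} \<le> card H"
    for V :: "'a set" and H
  proof -
    let ?n = "real (card V)"
    have nn: "n1 \<le> card V" "n2 \<le> card V" "2 * (k + r) \<le> card V" using n by (simp_all add: n0_def)
    have npos: "0 < ?n" using nn(3) k by simp
    obtain W where W: "W \<subseteq> V" "card W = k - 1"
      and cW: "real (card (unstarred s r V H W)) \<le> \<delta> * ?n ^ (r - 1)"
      using st[rule_format, OF V nn(1) H np big] by (elim exE conjE)
    have finW: "finite W" using W(1) V by (rule finite_subset)
    have k1: "1 \<le> k - 1" using k by simp
    define F0 where "F0 = {f\<in>ksub V (r - 1). in_star s H W f}"
    have "\<exists>F G. F \<subseteq> F0 \<and> card (F0 - F) \<le> fur r s * card V ^ (r - 2) \<and> star_cleaned H W (\<lambda>_. W) (k - 1) s r b F G"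
      by (rule clean_star[OF ab(1) b1 ab(3) s2 V H np, where F=F0 and N="\<lambda>_. W" and \<kappa>="k - 1"])
        (use W k1 in \<open>auto simp: F0_def in_star_def\<close>)
    then obtain F G where F: "F \<subseteq> F0" and cF: "card (F0 - F) \<le> fur r s * card V ^ (r - 2)"
      and sc: "star_cleaned H W (\<lambda>_. W) (k - 1) s r b F G"
      by (elim exE conjE)
    note GH = star_cleanedD(1)[OF sc] and full = star_cleanedD(2)[OF sc]
    \<comment> \<open>The roles of \<open>a\<close> and \<open>b\<close> are exchanged: in
      \<open>outside_edge_path\<close> the centres lie in the \<open>a\<close>-blocks.\<close>
    have cf: "clean_fam G W (k - 1) s b a" using star_cleanedD(3)[OF sc] ab by simp
    have FV: "F \<subseteq> ksub V q" using F q(1) by (auto simp: F0_def)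
    have "ksub V q - F \<subseteq> (unstarred s r V H W) \<union> (F0 - F)"
      unfolding F0_def unstarred_def q(1) by blast
    then have "card (ksub V q - F) \<le> card ((unstarred s r V H W) \<union> (F0 - F))"
      using V by (intro card_mono) (auto simp: F0_def unstarred_def)
    also have "\<dots> \<le> card (unstarred s r V H W) + card (F0 - F)" by (rule card_Un_le)
    finally have c1: "real (card (ksub V q - F)) \<le> \<delta> * ?n ^ q + real (card (F0 - F))" using cW unfolding q(1) by linarith
    have "real (card (F0 - F)) \<le> real (fur r s * card V ^ (r - 2))" using cF by (rule of_nat_mono)
    also have "\<dots> = real (fur r s) * ?n ^ (r - 2)" by simp
    also have "\<dots> \<le> \<delta> * ?n ^ q" using n2[OF nn(2)] unfolding q(3) .
    finally have c2: "real (card (ksub V q - F)) \<le> 2 * (\<delta> * ?n ^ q)" using c1 by linarith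
    define bad where "bad = card {g\<in>ksub V (a - 1). \<forall>f\<in>F. \<not> g \<subseteq> f}"
    have "bad * ((card V - (a - 1)) choose b) \<le> 2 ^ q * card (ksub V q - F)"
      using uncovered_count[OF V, of F "a - 1" b] FV unfolding bad_def q(2) by simp
    then have "real (bad * ((card V - (a - 1)) choose b)) \<le> real (2 ^ q * card (ksub V q - F))" by (rule of_nat_mono)
    then have "real bad * real ((card V - (a - 1)) choose b) \<le> 2 ^ q * real (card (ksub V q - F))" by simp
    moreover have "2 ^ q * real (card (ksub V q - F)) \<le> 2 ^ q * (2 * (\<delta> * ?n ^ q))" by (rule mult_left_mono[OF c2]) simp
    ultimately have b2: "real bad * real ((card V - (a - 1)) choose b) \<le> 2 ^ q * (2 * (\<delta> * ?n ^ q))" by linarith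
    have "P' * ?n ^ b = (?n / (2 * real b)) ^ b" by (simp add: P'_def power_divide)
    also have "\<dots> \<le> real ((card V - (a - 1)) choose b)" by (rule choose_lower[OF b1]) (use nn(3) ab in auto)
    finally have "real bad * (P' * ?n ^ b) \<le> real bad * real ((card V - (a - 1)) choose b)" by (intro mult_left_mono) auto
    then have "real bad * (P' * ?n ^ b) \<le> 2 ^ q * (2 * (\<delta> * ?n ^ q))" using b2 by linarith
    then have "(real bad * P') * ?n ^ b \<le> (\<delta> * (4 * 2 ^ q) / 2 * ?n ^ (a - 1)) * ?n ^ b"
      unfolding q(2)[symmetric] power_add by (simp add: algebra_simps)
    then have "real bad * P' \<le> \<delta> * (4 * 2 ^ q) / 2 * ?n ^ (a - 1)" using npos by simp
    also have "\<dots> \<le> P * P' / 2 * ?n ^ (a - 1)" using d2 by (intro mult_right_mono divide_right_mono) auto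
    finally have "real bad * P' \<le> (P / 2 * ?n ^ (a - 1)) * P'" by (simp add: mult_ac)
    then have cbad: "real bad \<le> P / 2 * ?n ^ (a - 1)" using P(2) by simp
    have "P * ?n ^ (a - 1) = (?n / (2 * real (a - 1))) ^ (a - 1)" by (simp add: P_def power_divide)
    also have "\<dots> \<le> real ((card V - (k - 1 + r)) choose (a - 1))" by (rule choose_lower[OF t1]) (use nn(3) ab in auto)
    finally have ch: "P / 2 * ?n ^ (a - 1) \<le> real ((card V - (k - 1 + r)) choose (a - 1)) - real bad" using cbad by linarith
    define M where "M = {e\<in>H. e \<inter> W = {}}"
    define D where "D = {B\<in>ksub V b. \<exists>e\<in>M. B \<subseteq> e}"
    define N where "N = {e\<in>ksub V r. e \<inter> W \<noteq> {} \<and> e \<notin> H}"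
    have finH: "finite H" by (rule finite_ksub_subset[OF V H])
    have "card D * (((card V - (k - 1 + r)) choose (a - 1)) - bad) \<le> 2 ^ r * card N"
      unfolding bad_def N_def
      by (rule many_missing[OF V a1 b1 ab(3) k s H np W cf GH _ _ M_def D_def])
        (use F full in \<open>auto simp: F0_def in_star_def\<close>)
    then have "real (card D * (((card V - (k - 1 + r)) choose (a - 1)) - bad)) \<le> real (2 ^ r * card N)" by (rule of_nat_mono)
    then have "real (card D) * real (((card V - (k - 1 + r)) choose (a - 1)) - bad) \<le> 2 ^ r * real (card N)" by simp
    moreover have "P / 2 * ?n ^ (a - 1) \<le> real (((card V - (k - 1 + r)) choose (a - 1)) - bad)" using ch by linarith
    then have "real (card D) * (P / 2 * ?n ^ (a - 1)) \<le> real (card D) * real (((card V - (k - 1 + r)) choose (a - 1)) - bad)"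
      by (intro mult_left_mono) auto
    ultimately have low: "real (card D) * (P / 2 * ?n ^ (a - 1)) \<le> 2 ^ r * real (card N)" by linarith
    have "card N \<le> card W * card (unstarred s r V H W)"
      unfolding N_def by (rule few_missing[OF V finW])
    then have "real (card N) \<le> real (card W * card (unstarred s r V H W))" by (rule of_nat_mono)
    also have "\<dots> = w * real (card (unstarred s r V H W))" by (simp add: w_def W(2))
    also have "\<dots> \<le> w * (\<delta> * ?n ^ q)" using cW L(3) unfolding q(1) by (intro mult_left_mono)
    finally have up: "real (card N) \<le> w * (\<delta> * ?n ^ q)" .
    have MH: "M \<subseteq> H" by (auto simp: M_def)
    have MV: "M \<subseteq> ksub V r" using MH H by blast
    have npM: "\<not> has_path M (2 * k - 1) a b" using np has_path_mono[OF _ MH] by blast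
    have "card M \<le> fur r s0 * (card D * (card D * card V ^ (a - 1 - b)))"
      by (rule path_free_shadow[OF ab(1) b1 ab(3) s02 V MV npM D_def])
    then have "real (card M) \<le> real (fur r s0 * (card D * (card D * card V ^ (a - 1 - b))))" by (rule of_nat_mono)
    then have cM: "real (card M) \<le> K * (real (card D) * (real (card D) * ?n ^ (a - 1 - b)))" by (simp add: K_def)
    have HM: "H - M \<subseteq> ksub V r" using H by blast
    have "{e\<in>ksub V r. e \<inter> W \<noteq> {}} = N \<union> (H - M)" using H by (auto simp: N_def M_def)
    moreover have "N \<inter> (H - M) = {}" by (auto simp: N_def)
    moreover have "finite N" using V by (simp add: N_def)
    ultimately have "card {e\<in>ksub V r. e \<inter> W \<noteq> {}} = card N + card (H - M)"
      using finH by (simp add: card_Un_disjoint)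
    moreover have "card {e\<in>ksub V r. e \<inter> W \<noteq> {}} \<le> card H" using ext W by blast
    moreover have "card (H - M) = card H - card M" "card M \<le> card H"
      using finH MH by (simp_all add: card_Diff_subset card_mono finite_subset)
    ultimately have NM: "card N \<le> card M" by linarith
    have ba: "b \<le> a - 1" using ab by simp
    have "card D = 0"
      by (rule shadow_vanishes[OF npos P(1) L(3) q(2)[symmetric] ba small low up cM NM L(2)])
    then have D0: "D = {}" using V by (simp add: D_def)
    have M0: "M = {}"
    proof (rule ccontr)
      assume "M \<noteq> {}"
      then obtain e where e: "e \<in> M" by blast
      note ed = ksub_edge[OF V MV e]
      have "b \<le> card e" using ed(2) ab by simp
      then obtain B where "B \<subseteq> e" "card B = b" by (meson obtain_subset_with_card_n)
      then have "B \<in> D" using e ed(3) by (auto simp: D_def ksub_def)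
      then show False using D0 by blast
    qed
    then have "card N = 0" using NM by simp
    then have N0: "N = {}" using V by (simp add: N_def)
    have "H = {e\<in>ksub V r. e \<inter> W \<noteq> {}}" using H M0 N0 unfolding M_def N_def by blast
    then show ?thesis using W by blast
  qed
  show ?thesis
    by (rule exI[of _ n0], intro allI impI) (rule main)
qed

section \<open>Identification with \<open>Psi\<close> and conclusion\<close>

lemma star_iso:
  assumes V: "finite V" "card V = n" and W: "W \<subseteq> V" "card W = c"
  shows "\<exists>f. bij_betw f V {1..n} \<and> (\<lambda>e. f ` e) ` {e\<in>ksub V r. e \<inter> W \<noteq> {}} = edges (Psi c n r)"
proof -
  have finW: "finite W" using W(1) V(1) by (rule finite_subset)
  have cn: "c \<le> n" using card_mono[OF V(1) W(1)] V W by simp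
  obtain f1 where f1: "bij_betw f1 W {1..c}" using ex_bij_betw_nat_finite_1[OF finW] bij_betw_inv W(2) by metis
  have "card (V - W) = card {c + 1..n}" using V W finW by (simp add: card_Diff_subset)
  then obtain f2 where f2: "bij_betw f2 (V - W) {c + 1..n}"
    using V(1) finite_same_card_bij[of "V - W" "{c + 1..n}"] by auto
  define f where "f v = (if v \<in> W then f1 v else f2 v)" for v
  have b1: "bij_betw f W {1..c}" using f1 bij_betw_cong[of W f f1] by (simp add: f_def)
  have b2: "bij_betw f (V - W) {c + 1..n}" using f2 bij_betw_cong[of "V - W" f f2] by (simp add: f_def)
  have "bij_betw f (W \<union> (V - W)) ({1..c} \<union> {c + 1..n})" by (rule bij_betw_combine[OF b1 b2]) auto
  moreover have "W \<union> (V - W) = V" "{1..c} \<union> {c + 1..n} = {1..n}" using W(1) cn by auto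
  ultimately have bij: "bij_betw f V {1..n}" by simp
  have inj: "inj_on f V" and im: "f ` V = {1..n}" using bij by (simp_all add: bij_betw_def)
  have imW: "f ` W = {1..c}" using b1 by (simp add: bij_betw_def)
  have hit: "f ` e \<inter> {1..c} = f ` (e \<inter> W)" if "e \<subseteq> V" for e
    unfolding imW[symmetric] using inj_on_image_Int[OF inj that W(1)] by simp
  have ce: "card (f ` e) = card e" if "e \<subseteq> V" for e using card_image inj_on_subset[OF inj that] by blast
  have "(\<lambda>e. f ` e) ` {e\<in>ksub V r. e \<inter> W \<noteq> {}} = {e. e \<subseteq> {1..n} \<and> card e = r \<and> e \<inter> {1..c} \<noteq> {}}"
  proof
    show "(\<lambda>e. f ` e) ` {e\<in>ksub V r. e \<inter> W \<noteq> {}} \<subseteq> {e. e \<subseteq> {1..n} \<and> card e = r \<and> e \<inter> {1..c} \<noteq> {}}"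
    proof (rule image_subsetI)
      fix e assume "e \<in> {e\<in>ksub V r. e \<inter> W \<noteq> {}}"
      then have e: "e \<subseteq> V" "card e = r" "e \<inter> W \<noteq> {}" by (auto simp: ksub_def)
      then show "f ` e \<in> {e. e \<subseteq> {1..n} \<and> card e = r \<and> e \<inter> {1..c} \<noteq> {}}"
        using hit[OF e(1)] ce[OF e(1)] im by auto
    qed
    show "{e. e \<subseteq> {1..n} \<and> card e = r \<and> e \<inter> {1..c} \<noteq> {}} \<subseteq> (\<lambda>e. f ` e) ` {e\<in>ksub V r. e \<inter> W \<noteq> {}}"
    proof
      fix e' assume e': "e' \<in> {e. e \<subseteq> {1..n} \<and> card e = r \<and> e \<inter> {1..c} \<noteq> {}}"
      then obtain e where e: "e \<subseteq> V" "e' = f ` e" unfolding im[symmetric] by (auto simp: subset_image_iff)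
      then have "e \<in> {e\<in>ksub V r. e \<inter> W \<noteq> {}}" using e' hit[OF e(1)] ce[OF e(1)] by (auto simp: ksub_def)
      then show "e' \<in> (\<lambda>e. f ` e) ` {e\<in>ksub V r. e \<inter> W \<noteq> {}}" using e(2) by blast
    qed
  qed
  then show ?thesis using bij by (intro exI[of _ f]) (simp add: Psi_def)
qed

lemma card_star:
  assumes V: "finite V" "card V = n" and W: "W \<subseteq> V" "card W = c"
  shows "card {e\<in>ksub V r. e \<inter> W \<noteq> {}} = card (edges (Psi c n r))"
proof -
  obtain f where f: "bij_betw f V {1..n}" "(\<lambda>e. f ` e) ` {e\<in>ksub V r. e \<inter> W \<noteq> {}} = edges (Psi c n r)"
    using star_iso[OF assms, of r] by (elim exE conjE)
  have "inj_on (\<lambda>e. f ` e) (Pow V)" using f(1) by (simp add: bij_betw_def inj_on_image_Pow)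
  then have "inj_on (\<lambda>e. f ` e) {e\<in>ksub V r. e \<inter> W \<noteq> {}}" by (rule inj_on_subset) (auto simp: ksub_def)
  then show ?thesis unfolding f(2)[symmetric] by (simp add: card_image)
qed

text \<open>Extremality of \<open>Psi\<close> is not known beforehand. Any extremal \<open>H\<close>
  has at least as many edges as \<open>Psi\<close>, so it is the star of some \<open>W\<close> by
  \<open>exact_structure\<close>; hence it is isomorphic to \<open>Psi\<close> and both have the
  maximum number of edges.\<close>

lemma unique_extremal:
  assumes ab: "b < a" "2 \<le> b" "r = a + b" and k: "2 \<le> k"
  shows "\<forall>\<^sub>F n in sequentially. extremal r n (ab_path (2 * k - 1) a b) (Psi (k - 1) n r) \<and>
           (\<forall>H. extremal r n (ab_path (2 * k - 1) a b) H \<longrightarrow> isomorphic H (Psi (k - 1) n r))"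
proof -
  let ?P = "ab_path (2 * k - 1) a b"
  have m: "1 \<le> 2 * k - 1" using k by simp
  obtain n0 where n0: "\<forall>(V::nat set) H. finite V \<longrightarrow> n0 \<le> card V \<longrightarrow> H \<subseteq> ksub V r \<longrightarrow> \<not> has_path H (2 * k - 1) a b \<longrightarrow>
     large k r V H \<longrightarrow>
     (\<forall>W\<subseteq>V. card W = k - 1 \<longrightarrow> card {e\<in>ksub V r. e \<inter> W \<noteq> {}} \<le> card H) \<longrightarrow>
     (\<exists>W\<subseteq>V. card W = k - 1 \<and> H = {e\<in>ksub V r. e \<inter> W \<noteq> {}})"
    using exact_structure[OF ab k, where 'a=nat] by (elim exE)
  have "r = Suc (Suc (r - 2))" using ab by simp
  then obtain t where t: "r = Suc (Suc t)" by blast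
  show ?thesis
    unfolding eventually_sequentially
  proof (rule exI[of _ "max n0 k"], intro allI impI)
    fix n assume n: "max n0 k \<le> n"
    have Psi: "Psi (k - 1) n r \<in> free_rgraphs r n ?P" by (rule Psi_free[OF k]) simp
    have kn: "k - 1 \<le> n" using n by linarith
    have iso: "\<exists>f. bij_betw f (verts H) {1..n} \<and> (\<lambda>e. f ` e) ` edges H = edges (Psi (k - 1) n r) \<and> card (edges H) = card (edges (Psi (k - 1) n r))"
      if H: "H \<in> free_rgraphs r n ?P" "card (edges H) = ex r n ?P" for H
    proof -
      have H': "finite (verts H)" "edges H \<subseteq> ksub (verts H) r" "card (verts H) = n" "\<not> has_path (edges H) (2 * k - 1) a b"
        using H(1) unfolding free_rgraphs_ab_path[OF m] by blast+
      have le: "card (edges (Psi (k - 1) n r)) \<le> card (edges H)" unfolding H(2) by (rule ex_ge[OF Psi])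
      have big: "large k r (verts H) (edges H)"
        using card_Psi_asymp[OF t kn] le unfolding large_def H'(3) by linarith
      have ext: "card {e\<in>ksub (verts H) r. e \<inter> W \<noteq> {}} \<le> card (edges H)" if "W \<subseteq> verts H" "card W = k - 1" for W
        using card_star[OF H'(1,3) that] le by simp
      have nv: "n0 \<le> card (verts H)" using n H'(3) by simp
      obtain W where W: "W \<subseteq> verts H" "card W = k - 1" "edges H = {e\<in>ksub (verts H) r. e \<inter> W \<noteq> {}}"
        using n0[rule_format, OF H'(1) nv H'(2,4) big ext] by blast
      show ?thesis using star_iso[OF H'(1,3) W(1,2), of r] card_star[OF H'(1,3) W(1,2), of r] unfolding W(3)[symmetric] by blast
    qed
    obtain H where H: "H \<in> free_rgraphs r n ?P" "card (edges H) = ex r n ?P" using ex_attained[OF m] by blast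
    have "card (edges (Psi (k - 1) n r)) = ex r n ?P" using iso[OF H] H(2) by auto
    then have "extremal r n ?P (Psi (k - 1) n r)" using Psi by (simp add: extremal_def)
    moreover have "isomorphic H (Psi (k - 1) n r)" if "extremal r n ?P H" for H
      using iso[of H] that unfolding extremal_def isomorphic_def by (auto simp: Psi_def)
    ultimately show "extremal r n ?P (Psi (k - 1) n r) \<and> (\<forall>H. extremal r n ?P H \<longrightarrow> isomorphic H (Psi (k - 1) n r))" by blast
  qed
qed

theorem theorem1:
  fixes a b r k :: nat
  assumes "a \<ge> 1" and "b \<ge> 1" and "r = a + b" and "k \<ge> 2"
  shows
    "(odd r \<longrightarrow>
        (\<lambda>n. real (ex r n (ab_path (2 * k - 1) a b)) - (real k - 1) * real (n choose (r - 1)))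
          \<in> o(\<lambda>n. real n ^ (r - 1))) \<and>
     (a > b \<longrightarrow>
        (\<lambda>n. real (ex r n (ab_path (2 * k) a b)) - (real k - 1) * real (n choose (r - 1)))
          \<in> o(\<lambda>n. real n ^ (r - 1))) \<and>
     (a \<noteq> b \<and> a \<ge> 2 \<and> b \<ge> 2 \<longrightarrow>
        (\<forall>\<^sub>F n in sequentially.
           extremal r n (ab_path (2 * k - 1) a b) (Psi (k - 1) n r) \<and>
           (\<forall>H. extremal r n (ab_path (2 * k - 1) a b) H \<longrightarrow> isomorphic H (Psi (k - 1) n r))))"
proof (intro conjI impI)
  have o: "odd (2 * k - 1)" using assms(4) by simp
  have r: "r = b + a" using assms(3) by simp
  show "(\<lambda>n. real (ex r n (ab_path (2 * k - 1) a b)) - (real k - 1) * real (n choose (r - 1)))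
          \<in> o(\<lambda>n. real n ^ (r - 1))" if "odd r"
  proof (cases "b < a")
    case True
    then show ?thesis using ex_asymp[OF True assms(2,3,4), of "2 * k - 1"] by simp
  next
    case False
    \<comment> \<open>Odd \<open>r\<close> excludes \<open>a = b\<close>, and a path with an odd
      number of edges can be read backwards when \<open>a < b\<close>.\<close>
    have "a \<noteq> b" using that assms(3) by auto
    then have "a < b" using False by simp
    then show ?thesis unfolding ex_rev[OF o, of r _ a b] using ex_asymp[OF _ assms(1) r assms(4), of "2 * k - 1"] by simp
  qed
  show "(\<lambda>n. real (ex r n (ab_path (2 * k) a b)) - (real k - 1) * real (n choose (r - 1)))
          \<in> o(\<lambda>n. real n ^ (r - 1))" if "a > b"
    using ex_asymp[OF that assms(2,3,4), of "2 * k"] by simp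
  show "\<forall>\<^sub>F n in sequentially.
           extremal r n (ab_path (2 * k - 1) a b) (Psi (k - 1) n r) \<and>
           (\<forall>H. extremal r n (ab_path (2 * k - 1) a b) H \<longrightarrow> isomorphic H (Psi (k - 1) n r))"
    if *: "a \<noteq> b \<and> a \<ge> 2 \<and> b \<ge> 2"
  proof (cases "b < a")
    case True
    then show ?thesis using unique_extremal[OF True _ assms(3,4)] * by simp
  next
    case False
    then have "a < b" using * by simp
    then show ?thesis
      unfolding extremal_def free_rgraphs_rev[OF o, of r _ a b] ex_rev[OF o, of r _ a b]
      using unique_extremal[OF _ _ r assms(4)] * unfolding extremal_def by simp
  qed
qed

end
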